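(* Let $D=\{x\in\mathbb{R}^2: |x|<1\}$ be the open unit disc. Let $\omega_0$ be a radially symmetric function in $D$, $\omega_0(x)=\omega_0(|x|)$, whose radial profile $r\mapsto\omega_0(r)$ is continuous on $[0,1]$ and satisfies $$\int_0^1 r\,\omega_0(r)\,dr=0 .$$ Define the initial velocity $u_0$ on $D$ by $$u_0(x)=\frac{1}{r^2}\left(\int_0^r\rho\,\omega_0(\rho)\,d\rho\right)\begin{pmatrix}-x_2\\ x_1\end{pmatrix},\qquad r=|x|.$$ For $\nu>0$ and $\alpha>0$ let $u^{(\nu,\alpha)}$ be the solution, with initial velocity $u_0$, of the second-grade fluid equations in $D$ with no-slip boundary condition, $$\partial_t(u-\alpha^2\Delta u)-\nu\Delta u+(u\cdot\nabla)(u-\alpha^2\Delta u)+\sum_{j=1}^2 (u-\alpha^2\Delta u)_j\nabla u_j+\nabla P=0,\qquad \nabla\cdot u=0 \quad\text{in } D,$$ $$u=0\quad\text{on }\partial D.$$ Let $u^E$ be the solution, with the same initial velocity $u_0$, of the Euler equations in $D$ with the no-penetration boundary condition, $$\partial_t u^E+u^E\cdot\nabla u^E+\nabla P^E=0,\qquad \nabla\cdot u^E=0\quad\text{in } D,\qquad u^E\cdot n=0\quad\text{on }\partial D.$$ Let $\omega^{(\nu,\alpha)}$ and $\omega^E$ be the vorticities of $u^{(\nu,\alpha)}$ and $u^E$, respectively. Then for any fixed $T>0$ and all $t\in[0,T]$, the differences $$u^{(\nu,\alpha)}(\cdot,t)-u^E(\cdot,t)\qquad\text{and}\qquad \omega^{(\nu,\alpha)}(\cdot,t)-\omega^E(\cdot,t)$$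 converge to zero, both in $L^2(D)$ and uniformly on compact subsets of $D$, as $\nu\to0$ and $\alpha\to0$ with $\alpha=o(\nu^{1/2})$.
   Context: All fields are two-dimensional: $u=(u_1,u_2)$ is the velocity and $P$ the scalar pressure (likewise $u^E$, $P^E$ for the Euler system). The parameter $\nu>0$ is the viscosity and $\alpha>0$ corresponds to the elastic response. $n$ is the unit normal to $\partial D$. The vorticity of a velocity field $u$ is $\omega=\operatorname{curl}u=\partial_{x_1}u_2-\partial_{x_2}u_1$. $(v)_j$ denotes the $j$-th component of a vector $v$. The existence and uniqueness of the solution of the second-grade fluid system with no-slip boundary condition are taken as known. In vorticity form the second-grade system reads $$\omega_t-\alpha^2\Delta\omega_t-\nu\Delta\omega+u\cdot\nabla(\omega-\alpha^2\Delta\omega)=0,\qquad \nabla\cdot u=0\quad\text{in } D\times(0,T),\qquad u=0\quad\text{on }\partial D\times(0,T).$$ The limit "$\nu\to0$, $\alpha\to0$ with $\alpha=o(\nu^{1/2})$" means that $(\nu,\alpha)\to(0,0)$ through positive values in such a way that $\alpha/\nu^{1/2}\to0$. *)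

theory Defs
  imports "HOL-Analysis.Analysis"
begin

abbreviation disc :: "(real^2) set" where
  "disc \<equiv> ball 0 1"

definition partial :: "2 \<Rightarrow> (real^2 \<Rightarrow> real) \<Rightarrow> real^2 \<Rightarrow> real" where
  "partial i f x = frechet_derivative f (at x) (axis i 1)"

text \<open>\<open>jac v j i x\<close> is the derivative of the \<open>j\<close>-th component of \<open>v\<close> in direction \<open>x\<^sub>i\<close>.\<close>

definition jac :: "(real^2 \<Rightarrow> real^2) \<Rightarrow> 2 \<Rightarrow> 2 \<Rightarrow> real^2 \<Rightarrow> real" where
  "jac v j i x = partial i (\<lambda>y. v y $ j) x"

definition curl2 :: "(real^2 \<Rightarrow> real^2) \<Rightarrow> real^2 \<Rightarrow> real" where
  "curl2 v x = jac v 2 1 x - jac v 1 2 x"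

definition div2 :: "(real^2 \<Rightarrow> real^2) \<Rightarrow> real^2 \<Rightarrow> real" where
  "div2 v x = (\<Sum>i\<in>UNIV. jac v i i x)"

primrec Ck :: "nat \<Rightarrow> (real^2 \<Rightarrow> real) \<Rightarrow> bool" where
  "Ck 0 f \<longleftrightarrow> continuous_on UNIV f"
| "Ck (Suc k) f \<longleftrightarrow> f differentiable_on UNIV \<and> (\<forall>i. Ck k (partial i f))"

definition test_field :: "(real^2 \<Rightarrow> real^2) \<Rightarrow> bool" where
  "test_field \<phi> \<longleftrightarrow>
     (\<forall>j k. Ck k (\<lambda>x. \<phi> x $ j)) \<and>
     (\<exists>K. compact K \<and> K \<subseteq> disc \<and> (\<forall>x. x \<notin> K \<longrightarrow> \<phi> x = 0)) \<and>
     (\<forall>x. div2 \<phi> x = 0)"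

text \<open>
  Velocity fields are written \<open>u t x\<close>.  The class below is
  \<open>C([0,\<infinity>); C\<^sup>1(cball 0 1))\<close>: the field and its spatial derivatives, which are taken
  in the open disc, extend continuously to the closed disc.
\<close>

definition C1_velocity :: "(real \<Rightarrow> real^2 \<Rightarrow> real^2) \<Rightarrow> bool" where
  "C1_velocity u \<longleftrightarrow>
     continuous_on ({0..} \<times> cball 0 1) (\<lambda>(t, x). u t x) \<and>
     (\<forall>t\<ge>0. u t differentiable_on disc) \<and>
     (\<forall>i j. \<exists>g. continuous_on ({0..} \<times> cball 0 1) g \<and>
        (\<forall>t\<ge>0. \<forall>x\<in>disc. g (t, x) = jac (u t) j i x))"

definition swirl_velocity :: "(real \<Rightarrow> real) \<Rightarrow> real^2 \<Rightarrow> real^2" where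
  "swirl_velocity \<omega>0 x =
     (1 / (norm x)\<^sup>2 * integral {0..norm x} (\<lambda>\<rho>. \<rho> * \<omega>0 \<rho>)) *\<^sub>R vector [- x $ 2, x $ 1]"

text \<open>
  The second-grade system is understood in the weak sense.  Initial data whose vorticity is merely
  continuous have no classical third derivatives, and the system does not regularise
  (\<open>\<omega> - \<alpha>\<^sup>2 \<Delta>\<omega>\<close> is transported and damped), so the term \<open>(u \<cdot> \<nabla>) \<Delta>u\<close> is only a
  distribution.

  Write \<open>v = u - \<alpha>\<^sup>2 \<Delta>u\<close>.  Multiplying the momentum equation by a divergence-free
  \<open>\<phi> \<in> C\<^sub>c\<^sup>\<infinity>(disc)\<close> removes the pressure.  With \<open>\<nabla> \<cdot> u = 0\<close>, integration by parts gives
  \<open>\<integral> \<partial>\<^sub>t v \<cdot> \<phi> = d/dt \<integral> (u \<cdot> \<phi> + \<alpha>\<^sup>2 \<nabla>u : \<nabla>\<phi>)\<close> and \<open>- \<integral> \<Delta>u \<cdot> \<phi> = \<integral> \<nabla>u : \<nabla>\<phi>\<close>, together with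

  \<open>- \<integral> (u \<cdot> \<nabla>)\<Delta>u \<cdot> \<phi> = \<integral> \<Delta>u\<^sub>j u\<^sub>i \<partial>\<^sub>i\<phi>\<^sub>j = - \<integral> \<partial>\<^sub>k u\<^sub>j (\<partial>\<^sub>k u\<^sub>i \<partial>\<^sub>i\<phi>\<^sub>j + u\<^sub>i \<partial>\<^sub>k\<partial>\<^sub>i\<phi>\<^sub>j)\<close>,

  \<open>- \<integral> \<Delta>u\<^sub>j \<partial>\<^sub>i u\<^sub>j \<phi>\<^sub>i = \<integral> \<partial>\<^sub>k u\<^sub>j (\<partial>\<^sub>k\<phi>\<^sub>i \<partial>\<^sub>i u\<^sub>j + \<phi>\<^sub>i \<partial>\<^sub>i\<partial>\<^sub>k u\<^sub>j) = \<integral> \<partial>\<^sub>k u\<^sub>j \<partial>\<^sub>i u\<^sub>j \<partial>\<^sub>k\<phi>\<^sub>i\<close>,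

  where the last step uses \<open>\<partial>\<^sub>k u\<^sub>j \<partial>\<^sub>i\<partial>\<^sub>k u\<^sub>j = \<partial>\<^sub>i (|\<nabla>u|\<^sup>2 / 2)\<close>.  These identities define the
  three forms below, of which only first derivatives of \<open>u\<close> are required;
  \<open>sg_transport \<alpha> u \<phi>\<close> is \<open>\<integral> ((u \<cdot> \<nabla>) v + \<Sum>\<^sub>j v\<^sub>j \<nabla>u\<^sub>j) \<cdot> \<phi>\<close> for smooth \<open>u\<close>.
\<close>

definition mass_form :: "(real^2 \<Rightarrow> real^2) \<Rightarrow> (real^2 \<Rightarrow> real^2) \<Rightarrow> real" where
  "mass_form u \<phi> = (LINT x:disc|lborel. u x \<bullet> \<phi> x)"

definition gradient_form :: "(real^2 \<Rightarrow> real^2) \<Rightarrow> (real^2 \<Rightarrow> real^2) \<Rightarrow> real" where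
  "gradient_form u \<phi> =
     (LINT x:disc|lborel. \<Sum>i\<in>UNIV. \<Sum>j\<in>UNIV. jac u j i x * jac \<phi> j i x)"

definition sg_transport :: "real \<Rightarrow> (real^2 \<Rightarrow> real^2) \<Rightarrow> (real^2 \<Rightarrow> real^2) \<Rightarrow> real" where
  "sg_transport \<alpha> u \<phi> = (LINT x:disc|lborel. \<Sum>i\<in>UNIV. \<Sum>j\<in>UNIV.
     u x $ i * jac u j i x * \<phi> x $ j + u x $ j * jac u j i x * \<phi> x $ i +
     \<alpha>\<^sup>2 * (\<Sum>k\<in>UNIV. jac u j k x *
       (jac u j i x * jac \<phi> i k x - jac u i k x * jac \<phi> j i x
        - u x $ i * partial k (\<lambda>y. jac \<phi> j i y) x)))"

definition second_grade_solution ::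
  "real \<Rightarrow> real \<Rightarrow> (real^2 \<Rightarrow> real^2) \<Rightarrow> (real \<Rightarrow> real^2 \<Rightarrow> real^2) \<Rightarrow> bool" where
  "second_grade_solution \<nu> \<alpha> u0 u \<longleftrightarrow>
     C1_velocity u \<and>
     (\<forall>x\<in>disc. u 0 x = u0 x) \<and>
     (\<forall>t\<ge>0. \<forall>x\<in>disc. div2 (u t) x = 0) \<and>
     (\<forall>t\<ge>0. \<forall>x\<in>sphere 0 1. u t x = 0) \<and>
     (\<forall>\<phi>. test_field \<phi> \<longrightarrow> (\<forall>t\<ge>0.
        ((\<lambda>s. mass_form (u s) \<phi> + \<alpha>\<^sup>2 * gradient_form (u s) \<phi>) has_real_derivative
           - (\<nu> * gradient_form (u t) \<phi> + sg_transport \<alpha> (u t) \<phi>)) (at t within {0..})))"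

text \<open>
  Classical Euler solutions, of class \<open>C\<^sup>1\<close> on \<open>[0,\<infinity>) \<times> cball 0 1\<close>; on the unit circle the
  outer normal at \<open>x\<close> is \<open>x\<close> itself.
\<close>

definition euler_solution ::
  "(real^2 \<Rightarrow> real^2) \<Rightarrow> (real \<Rightarrow> real^2 \<Rightarrow> real^2) \<Rightarrow> bool" where
  "euler_solution u0 u \<longleftrightarrow>
     C1_velocity u \<and>
     (\<forall>x\<in>disc. u 0 x = u0 x) \<and>
     (\<forall>t\<ge>0. \<forall>x\<in>disc. div2 (u t) x = 0) \<and>
     (\<forall>t\<ge>0. \<forall>x\<in>sphere 0 1. u t x \<bullet> x = 0) \<and>
     (\<exists>ut P. continuous_on ({0..} \<times> cball 0 1) (\<lambda>(t, x). ut t x) \<and>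
        (\<forall>t\<ge>0. P t differentiable_on disc) \<and>
        (\<forall>t\<ge>0. \<forall>x\<in>disc.
           ((\<lambda>s. u s x) has_vector_derivative ut t x) (at t within {0..}) \<and>
           (\<forall>j. ut t x $ j + (\<Sum>i\<in>UNIV. u t x $ i * jac (u t) j i x) + partial j (P t) x = 0)))"

text \<open>The regime \<open>\<nu> \<rightarrow> 0+\<close>, \<open>\<alpha> \<rightarrow> 0+\<close>, \<open>\<alpha> = o(\<nu>\<^bsup>1/2\<^esup>)\<close>, as a filter on pairs \<open>(\<nu>, \<alpha>)\<close>.\<close>

definition vanishing_regime :: "(real \<times> real) filter" where
  "vanishing_regime =
     inf (at_right 0 \<times>\<^sub>F at_right 0) (filtercomap (\<lambda>(\<nu>, \<alpha>). \<alpha> / sqrt \<nu>) (nhds 0))"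

definition L2_norm_disc :: "(real^2 \<Rightarrow> 'a::real_normed_vector) \<Rightarrow> real" where
  "L2_norm_disc f = sqrt (LINT x:disc|lborel. (norm (f x))\<^sup>2)"

end

theory Submission
  imports Defs
begin

text \<open>
  Circular symmetry makes both flows explicit.  A swirl \<open>h(|x|) x\<^sup>\<bottom>\<close>, with \<open>x\<^sup>\<bottom> = (- x\<^sub>2, x\<^sub>1)\<close>, is
  determined by its radial vorticity \<open>f\<close>, since \<open>h(r) = r\<^bsup>-2\<^esup> \<integral>\<^sub>0\<^sup>r \<rho> f(\<rho>) d\<rho>\<close>.  The nonlinear
  terms of the Euler and of the second-grade system are gradients on such fields.  Hence \<open>u\<^sub>0\<close> is a
  stationary Euler flow, and the second-grade system becomes linear: with \<open>w\<close> the radial vorticity,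
  \<open>(1 - \<alpha>\<^sup>2 \<Delta>) \<partial>\<^sub>t w = \<nu> \<Delta> w\<close>.

  The boundary condition for \<open>w\<close> is of Neumann type.  If \<open>N = (1 - \<alpha>\<^sup>2 \<Delta>)\<^sup>-\<^sup>1\<close> denotes the Neumann
  resolvent on continuous radial functions, then \<open>N f - f = \<alpha>\<^sup>2 \<Delta> N f\<close> has mean zero over the disc,
  so \<open>N\<close> preserves the mean; and mean zero of the vorticity is the no-slip condition for the swirl.
  Since \<open>\<nu> \<Delta> N = (\<nu> / \<alpha>\<^sup>2) (N - 1)\<close>, the solution is an exponential series in the bounded operator
  \<open>N\<close>,
  \<open>w(t) = e\<^bsup>-s\<^esup> \<Sum>\<^sub>n s\<^sup>n / n! N\<^sup>n \<omega>\<^sub>0\<close> with \<open>s = \<nu> t / \<alpha>\<^sup>2\<close>,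
  which is an average of the iterates \<open>N\<^sup>n \<omega>\<^sub>0\<close> with Poisson weights of expectation \<open>s\<close>.  That the
  corresponding swirl solves the weak system is \<open>swirl_evolution_is_solution\<close>; the assumed
  uniqueness then identifies it with \<open>u\<^bsup>(\<nu>,\<alpha>)\<^esup>\<close>.

  Convergence is uniform on the whole disc.  By the maximum principle \<open>N\<close> does not increase distances
  in the supremum norm (\<open>neumann_resolvent_nonexpansive\<close>).  If \<open>g\<close> is a smooth radial function
  with \<open>g'(1) = 0\<close>, then \<open>g = N (g - \<alpha>\<^sup>2 \<Delta> g)\<close>, so one step moves \<open>g\<close> by at most
  \<open>\<alpha>\<^sup>2 \<parallel>\<Delta> g\<parallel>\<close>, and the Poisson average moves it by at most \<open>s \<alpha>\<^sup>2 \<parallel>\<Delta> g\<parallel> = \<nu> t \<parallel>\<Delta> g\<parallel>\<close>.  Such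
  \<open>g\<close> are dense in the continuous functions, so \<open>\<parallel>w(t) - \<omega>\<^sub>0\<parallel> \<le> 2 \<parallel>\<omega>\<^sub>0 - g\<parallel> + \<nu> t \<parallel>\<Delta> g\<parallel>\<close>
  (\<open>evolution_close\<close>) tends to zero.  A supremum bound on the vorticity bounds the velocity, and
  on a disc it yields both kinds of convergence.

  It remains that the given Euler solution is the stationary swirl.  This is the classical energy
  argument (\<open>euler_solution_unique\<close>): the square of the \<open>L\<^sup>2\<close>-distance to the swirl obeys
  a Gronwall inequality, because tangential divergence-free fields are orthogonal to gradients
  (\<open>tangential_flux_zero\<close>).

  Identities between integrals over the disc are proved for swirls \<open>h(|x|\<^sup>2) x\<^sup>\<bottom>\<close> with \<open>h\<close> a
  polynomial, where they are divergences of compactly supported smooth fields, and are carried to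
  continuous vorticities by the Weierstrass theorem.
\<close>

section \<open>Partial derivatives and the divergence theorem for compact support\<close>

lemma partial_eqI:
  assumes "(f has_derivative f') (at x)"
  shows "partial i f x = f' (axis i 1)"
  using frechet_derivative_at[OF assms] by (simp add: partial_def)

lemma partial_cong_open:
  assumes "open S" "x \<in> S" "\<And>y. y \<in> S \<Longrightarrow> f y = g y"
  shows "partial i f x = partial i g x"
proof -
  have "(f has_derivative D) (at x) \<longleftrightarrow> (g has_derivative D) (at x)" for D
    using assms has_derivative_transform_within_open[of f D x UNIV S g]
      has_derivative_transform_within_open[of g D x UNIV S f] by auto
  then show ?thesis by (simp add: partial_def frechet_derivative_def)
qed

lemma has_derivative_partial:
  assumes "f differentiable (at x)"
  shows "(f has_derivative (\<lambda>v. \<Sum>i\<in>UNIV. v $ i * partial i f x)) (at x)"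
proof -
  from assms obtain D where D: "(f has_derivative D) (at x)" by (auto simp: differentiable_def)
  then interpret bounded_linear D by (rule has_derivative_bounded_linear)
  have "D v = (\<Sum>i\<in>UNIV. v $ i * partial i f x)" for v
  proof -
    have v: "(\<Sum>i\<in>UNIV. v $ i *\<^sub>R axis i 1) = v"
      using basis_expansion[of v] by (simp only: scalar_mult_eq_scaleR)
    have "D v = D (\<Sum>i\<in>UNIV. v $ i *\<^sub>R axis i 1)" by (simp only: v)
    also have "\<dots> = (\<Sum>i\<in>UNIV. v $ i * partial i f x)"
      unfolding sum scaleR partial_eqI[OF D] by simp
    finally show ?thesis .
  qed
  then have "D = (\<lambda>v. \<Sum>i\<in>UNIV. v $ i * partial i f x)" by auto
  with D show ?thesis by simp
qed

lemma partial_const [simp]: "partial i (\<lambda>x. c) = (\<lambda>x. 0)"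
  by (rule ext) (rule partial_eqI[THEN trans, OF has_derivative_const], simp)

lemma partial_zero_off:
  assumes "compact K" "\<And>x. x \<notin> K \<Longrightarrow> f x = 0" "x \<notin> K"
  shows "partial i f x = 0"
proof -
  have "partial i f x = partial i (\<lambda>_. 0) x"
    using assms by (intro partial_cong_open[of "- K"]) (auto simp: compact_imp_closed open_Compl)
  then show ?thesis by simp
qed

text \<open>
  Lebesgue measure is invariant under translation, so every difference quotient of \<open>f\<close> in the
  direction \<open>x\<^sub>i\<close> has integral zero.  The quotients are bounded by the maximum of the derivative and
  vanish off a fixed ball, so dominated convergence passes to the derivative.
\<close>

lemma integral_partial_zero:
  fixes f :: "real^2 \<Rightarrow> real"
  assumes diff: "\<And>x. f differentiable (at x)"
    and cont: "continuous_on UNIV (partial i f)"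
    and K: "compact K" "\<And>x. x \<notin> K \<Longrightarrow> f x = 0"
  shows "(LINT x|lborel. partial i f x) = 0"
proof -
  define e :: "real^2" where "e = axis i 1"
  have ne: "norm e = 1" by (simp add: e_def)
  have pz: "partial i f x = 0" if "x \<notin> K" for x
    by (rule partial_zero_off[OF K that])
  have "bounded (partial i f ` K)"
    by (intro compact_imp_bounded compact_continuous_image continuous_on_subset[OF cont] K) auto
  then obtain B0 where B0: "\<And>x. x \<in> K \<Longrightarrow> \<bar>partial i f x\<bar> \<le> B0"
    by (auto simp: bounded_iff)
  define B where "B = max B0 0"
  have B: "\<bar>partial i f x\<bar> \<le> B" for x
    using B0[of x] pz[of x] by (cases "x \<in> K") (auto simp: B_def)
  obtain R where R: "\<And>x. x \<in> K \<Longrightarrow> norm x \<le> R"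
    using compact_imp_bounded[OF K(1)] by (auto simp: bounded_iff)
  define F where "F n x = (f (x + (1 / real (Suc n)) *\<^sub>R e) - f x) * real (Suc n)" for n x
  have cf: "continuous_on UNIV f"
    using diff by (meson continuous_at_imp_continuous_on differentiable_imp_continuous_within)
  have line: "((\<lambda>\<tau>. f (x + \<tau> *\<^sub>R e)) has_real_derivative partial i f (x + \<tau> *\<^sub>R e)) (at \<tau>)" for x \<tau>
  proof -
    have "((\<lambda>\<tau>. f (x + \<tau> *\<^sub>R e)) has_derivative
       (\<lambda>h. \<Sum>k\<in>UNIV. (h *\<^sub>R e) $ k * partial k f (x + \<tau> *\<^sub>R e))) (at \<tau>)"
      by (rule has_derivative_compose[OF _ has_derivative_partial[OF diff]])
        (auto intro!: derivative_eq_intros)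
    moreover have "(\<Sum>k\<in>UNIV. (h *\<^sub>R e) $ k * partial k f y) = partial i f y * h" for h y
    proof -
      have "(\<Sum>k\<in>UNIV. (h *\<^sub>R e) $ k * partial k f y) = (\<Sum>k\<in>UNIV. if k = i then h * partial k f y else 0)"
        by (intro sum.cong) (auto simp: e_def axis_def)
      then show ?thesis by simp
    qed
    ultimately show ?thesis by (simp add: has_field_derivative_def)
  qed
  have fint: "integrable lborel f"
  proof -
    have "integrable lborel (\<lambda>x. indicator K x *\<^sub>R f x)"
      by (intro borel_integrable_compact K continuous_on_subset[OF cf]) auto
    moreover have "(\<lambda>x. indicator K x *\<^sub>R f x) = f"
    proof
      show "indicator K x *\<^sub>R f x = f x" for x using K(2)[of x] by (cases "x \<in> K") auto
    qed
    ultimately show ?thesis by (simp only:)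
  qed
  have F0: "(LINT x|lborel. F n x) = 0" for n
  proof -
    have tr: "integrable lborel (\<lambda>x. f (x + c))" "(LINT x|lborel. f (x + c)) = (LINT x|lborel. f x)" for c
    proof -
      have m: "f \<in> borel_measurable borel" by (rule borel_measurable_continuous_onI[OF cf])
      have d: "distr lborel borel (\<lambda>x. c + x) = (lborel :: (real^2) measure)"
        by (rule lborel_distr_plus)
      have "integrable (distr lborel borel (\<lambda>x. c + x)) f" unfolding d by (rule fint)
      then show "integrable lborel (\<lambda>x. f (x + c))"
        using m by (simp add: integrable_distr_eq add.commute)
      have "(LINT x|distr lborel borel (\<lambda>x. c + x). f x) = (LINT x|lborel. f (c + x))"
        using m by (intro integral_distr) auto
      then show "(LINT x|lborel. f (x + c)) = (LINT x|lborel. f x)"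
        unfolding d by (simp only: add.commute[of c])
    qed
    let ?c = "(1 / real (Suc n)) *\<^sub>R e"
    have "(LINT x|lborel. f (x + ?c) - f x) = 0"
      by (subst Bochner_Integration.integral_diff[OF tr(1) fint]) (simp only: tr(2) diff_self)
    then show ?thesis unfolding F_def by (simp del: of_nat_Suc)
  qed
  have bd: "\<bar>F n x\<bar> \<le> B * indicator (cball 0 (R + 1)) x" for n x
  proof (cases "x \<in> cball 0 (R + 1)")
    case True
    have "\<bar>f (x + (1 / real (Suc n)) *\<^sub>R e) - f (x + 0 *\<^sub>R e)\<bar> \<le> B * norm (1 / real (Suc n) - 0)"
      unfolding real_norm_def[symmetric]
      by (rule field_differentiable_bound[where S = UNIV and f' = "\<lambda>\<tau>. partial i f (x + \<tau> *\<^sub>R e)"])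
        (use line B in auto)
    then have "\<bar>f (x + (1 / real (Suc n)) *\<^sub>R e) - f x\<bar> * real (Suc n) \<le> B * (1 / real (Suc n)) * real (Suc n)"
      by (intro mult_right_mono) auto
    then show ?thesis using True by (simp add: F_def abs_mult)
  next
    case False
    have "x \<notin> K" using False R[of x] by auto
    moreover have "x + (1 / real (Suc n)) *\<^sub>R e \<notin> K"
    proof
      assume "x + (1 / real (Suc n)) *\<^sub>R e \<in> K"
      then have "norm (x + (1 / real (Suc n)) *\<^sub>R e) \<le> R" by (rule R)
      moreover have "norm ((1 / real (Suc n)) *\<^sub>R e) \<le> 1" using ne by simp
      moreover have "norm x \<le> norm (x + (1 / real (Suc n)) *\<^sub>R e) + norm ((1 / real (Suc n)) *\<^sub>R e)"
        by (metis add_diff_cancel_right' norm_triangle_ineq4)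
      ultimately have "norm x \<le> R + 1" by linarith
      then show False using False by simp
    qed
    ultimately show ?thesis using False K(2) by (simp add: F_def)
  qed
  have lim: "(\<lambda>n. F n x) \<longlonglongrightarrow> partial i f x" for x
  proof -
    have "((\<lambda>h. (f (x + h *\<^sub>R e) - f x) / h) \<longlongrightarrow> partial i f x) (at 0)"
      using line[of x 0] by (simp add: has_field_derivative_iff)
    moreover have "filterlim (\<lambda>n. 1 / real (Suc n)) (at 0) sequentially"
      unfolding filterlim_at using LIMSEQ_Suc[OF lim_1_over_n] by auto
    ultimately have "(\<lambda>n. (f (x + (1 / real (Suc n)) *\<^sub>R e) - f x) / (1 / real (Suc n))) \<longlonglongrightarrow> partial i f x"
      by (rule filterlim_compose[where g = "\<lambda>h. (f (x + h *\<^sub>R e) - f x) / h"])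
    then show ?thesis by (simp add: F_def)
  qed
  have "(\<lambda>n. LINT x|lborel. F n x) \<longlonglongrightarrow> (LINT x|lborel. partial i f x)"
  proof (rule integral_dominated_convergence[where w = "\<lambda>x. B * indicator (cball 0 (R + 1)) x"])
    show "partial i f \<in> borel_measurable lborel"
      using borel_measurable_continuous_onI[OF cont] by simp
    show "F n \<in> borel_measurable lborel" for n
    proof -
      have "continuous_on UNIV (F n)"
        unfolding F_def by (intro continuous_intros continuous_on_compose2[OF cf]) auto
      then show ?thesis using borel_measurable_continuous_onI by simp
    qed
    show "integrable lborel (\<lambda>x. B * indicator (cball 0 (R + 1)) x :: real)"
      by (intro integrable_mult_right integrable_real_indicator emeasure_lborel_cball_finite) auto
    show "AE x in lborel. (\<lambda>n. F n x) \<longlonglongrightarrow> partial i f x" using lim by simp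
    show "AE x in lborel. norm (F n x) \<le> B * indicator (cball 0 (R + 1)) x" for n
      unfolding real_norm_def using bd by (rule AE_I2)
  qed
  then show ?thesis unfolding F0 by (simp only: LIMSEQ_const_iff)
qed

lemma integral_divergence_zero:
  fixes F :: "2 \<Rightarrow> real^2 \<Rightarrow> real"
  assumes U: "open U" "compact K" "K \<subseteq> U"
    and supp: "\<And>i x. x \<notin> K \<Longrightarrow> F i x = 0"
    and diff: "\<And>i x. x \<in> U \<Longrightarrow> F i differentiable (at x)"
    and cont: "\<And>i. continuous_on U (partial i (F i))"
  shows "(LINT x:U|lborel. \<Sum>i\<in>UNIV. partial i (F i) x) = 0"
proof -
  have pz: "partial i (F i) x = 0" if "x \<notin> K" for x i
    by (rule partial_zero_off[OF U(2) supp that])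
  have ap: "open (- K)" using U by (simp add: compact_imp_closed open_Compl)
  have c: "continuous_on UNIV (partial i (F i))" for i
  proof -
    have "continuous_on (- K) (partial i (F i))"
      by (rule continuous_on_eq[OF continuous_on_const[of _ 0]]) (simp add: pz)
    then have "continuous_on (U \<union> - K) (partial i (F i))"
      using cont ap U by (intro continuous_on_open_Un) auto
    moreover have "U \<union> - K = UNIV" using U by auto
    ultimately show ?thesis by simp
  qed
  have d: "F i differentiable (at x)" for i x
  proof (cases "x \<in> U")
    case False
    then have "x \<in> - K" using U by auto
    have "(F i has_derivative (\<lambda>_. 0)) (at x)"
      by (rule has_derivative_transform_within_open[OF has_derivative_const[of 0] ap \<open>x \<in> - K\<close>])
        (simp add: supp)
    then show ?thesis by (auto simp: differentiable_def)
  qed (use diff in auto)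
  have int: "integrable lborel (partial i (F i))" for i
  proof -
    have "integrable lborel (\<lambda>x. indicator K x *\<^sub>R partial i (F i) x)"
      by (intro borel_integrable_compact U continuous_on_subset[OF c]) auto
    moreover have "(\<lambda>x. indicator K x *\<^sub>R partial i (F i) x) = partial i (F i)"
    proof
      show "indicator K x *\<^sub>R partial i (F i) x = partial i (F i) x" for x
        using pz[of x i] by (cases "x \<in> K") auto
    qed
    ultimately show ?thesis by (simp only:)
  qed
  have "(LINT x:U|lborel. \<Sum>i\<in>UNIV. partial i (F i) x) = (LINT x|lborel. (\<Sum>i\<in>UNIV. partial i (F i) x))"
    unfolding set_lebesgue_integral_def
  proof (intro Bochner_Integration.integral_cong refl)
    show "indicator U x *\<^sub>R (\<Sum>i\<in>UNIV. partial i (F i) x) = (\<Sum>i\<in>UNIV. partial i (F i) x)" for x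
    proof (cases "x \<in> U")
      case False
      then have "x \<notin> K" using U(3) by auto
      then have "partial i (F i) x = 0" for i by (rule pz)
      then show ?thesis by simp
    qed simp
  qed
  also have "\<dots> = (\<Sum>i\<in>UNIV. (LINT x|lborel. partial i (F i) x))"
    by (intro Bochner_Integration.integral_sum int)
  also have "\<dots> = 0"
    using integral_partial_zero[OF d c U(2) supp] by simp
  finally show ?thesis .
qed

section \<open>Radial profiles and the inverse of the radial Laplacian\<close>

instance bcontfun :: (metric_space, banach) banach ..

text \<open>
  Radial functions are represented by bounded continuous functions on the line, of which only the
  values on the unit interval matter.  This places them in a Banach space with the supremum norm, in
  which operator series converge.
\<close>

type_synonym profile = "real \<Rightarrow>\<^sub>C real"

definition unit_clamp :: "real \<Rightarrow> real" where
  "unit_clamp r = max 0 (min 1 r)"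

lemma unit_clamp_bounds [simp]: "0 \<le> unit_clamp r" "unit_clamp r \<le> 1"
  by (auto simp: unit_clamp_def)

lemma unit_clamp_id [simp]: "0 \<le> r \<Longrightarrow> r \<le> 1 \<Longrightarrow> unit_clamp r = r"
  by (auto simp: unit_clamp_def)

definition profile_of :: "(real \<Rightarrow> real) \<Rightarrow> profile" where
  "profile_of f = Bcontfun (\<lambda>r. f (unit_clamp r))"

lemma apply_profile_of:
  assumes "continuous_on {0..1} f"
  shows "apply_bcontfun (profile_of f) r = f (unit_clamp r)"
proof -
  have c: "continuous_on UNIV (\<lambda>r. f (unit_clamp r))"
    unfolding unit_clamp_def
    by (intro continuous_on_compose2[OF assms] continuous_intros) auto
  have "bounded (f ` {0..1})"
    by (intro compact_imp_bounded compact_continuous_image assms) auto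
  then obtain b where "\<And>r. r \<in> {0..1} \<Longrightarrow> norm (f r) \<le> b" unfolding bounded_iff by blast
  then have "(\<lambda>r. f (unit_clamp r)) \<in> bcontfun"
    by (intro bcontfun_normI[OF c, of b]) auto
  then show ?thesis by (simp add: profile_of_def Bcontfun_inverse)
qed

lemma profile_abs_le: "\<bar>apply_bcontfun f r\<bar> \<le> norm (f :: profile)"
  using norm_bounded[of f r] by simp

lemma continuous_on_profile [continuous_intros]:
  "continuous_on A g \<Longrightarrow> continuous_on A (\<lambda>x. apply_bcontfun (f :: profile) (g x))"
  by (rule continuous_on_compose2[OF continuous_on_apply_bcontfun[of UNIV f]]) auto

text \<open>
  The substitution \<open>\<rho> = r \<theta>\<close> turns this into \<open>r\<^bsup>-2\<^esup> \<integral>\<^sub>0\<^sup>r \<rho> f(\<rho>) d\<rho>\<close>, the angular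
  velocity of the swirl with vorticity \<open>f\<close>, in a form without a singularity at the centre.
\<close>

definition radial_average :: "profile \<Rightarrow> profile" where
  "radial_average f = profile_of (\<lambda>r. integral {0..1} (\<lambda>\<theta>. \<theta> * f (r * \<theta>)))"

text \<open>
  The solution of \<open>(1/r) (r v')' = f\<close> with \<open>v(0) = 0\<close> that is regular at the centre:
  integrating twice gives \<open>v'(r) = r A f(r)\<close> and \<open>v(r) = \<integral>\<^sub>0\<^sup>r \<rho> A f(\<rho>) d\<rho> = r\<^sup>2 A (A f)(r)\<close>, where
  \<open>A\<close> is the average above.
\<close>

definition radial_inverse_laplacian :: "profile \<Rightarrow> profile" where
  "radial_inverse_laplacian f = profile_of (\<lambda>r. r\<^sup>2 * radial_average (radial_average f) r)"

lemma radial_average_apply: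
  "radial_average f r = integral {0..1} (\<lambda>\<theta>. \<theta> * f (unit_clamp r * \<theta>))"
  unfolding radial_average_def
proof (rule apply_profile_of)
  have "continuous_on {0..1} (\<lambda>r. integral (cbox 0 1) (\<lambda>\<theta>. \<theta> * f (r * \<theta>)))"
    by (rule integral_continuous_on_param) (auto simp: split_beta intro!: continuous_intros)
  then show "continuous_on {0..1} (\<lambda>r. integral {0..1} (\<lambda>\<theta>. \<theta> * f (r * \<theta>)))" by simp
qed

lemma radial_inverse_laplacian_apply:
  "radial_inverse_laplacian f r = (unit_clamp r)\<^sup>2 * radial_average (radial_average f) (unit_clamp r)"
  unfolding radial_inverse_laplacian_def
  by (rule apply_profile_of) (auto intro!: continuous_intros)

lemma average_integrable [intro, simp]:
  "(\<lambda>\<theta>. \<theta> * apply_bcontfun (f :: profile) (r * \<theta>)) integrable_on {0..1}"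
  by (intro integrable_continuous_real continuous_intros)

lemma theta_power_integral:
  "((\<lambda>\<theta>. \<theta> * \<theta> ^ n) has_integral 1 / (real n + 2)) {0..1::real}"
proof -
  have "((\<lambda>\<theta>. \<theta> * \<theta> ^ n) has_integral (1 ^ (n + 2) / (real n + 2) - 0 ^ (n + 2) / (real n + 2))) {0..1::real}"
  proof (rule fundamental_theorem_of_calculus)
    fix \<theta> :: real
    have "((\<lambda>\<theta>. \<theta> ^ (n + 2) / (real n + 2)) has_real_derivative \<theta> * \<theta> ^ n) (at \<theta> within {0..1})"
      using DERIV_cdivide[OF DERIV_pow[of "n + 2" \<theta> "{0..1}"], of "real n + 2"]
      by (simp add: nonzero_mult_div_cancel_left[of "2 + real n"] add.commute[of "real n"] del: power_Suc)
        (simp add: add_pos_nonneg less_imp_neq[symmetric])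
    then show "((\<lambda>\<theta>. \<theta> ^ (n + 2) / (real n + 2)) has_vector_derivative \<theta> * \<theta> ^ n) (at \<theta> within {0..1})"
      by (simp add: has_real_derivative_iff_has_vector_derivative)
  qed simp
  then show ?thesis by simp
qed

lemma radial_average_le_power:
  assumes "\<And>r. 0 \<le> r \<Longrightarrow> r \<le> 1 \<Longrightarrow> apply_bcontfun f r \<le> B * r ^ n"
  shows "radial_average f r \<le> B * unit_clamp r ^ n / (real n + 2)"
proof -
  have i: "((\<lambda>\<theta>. B * unit_clamp r ^ n * (\<theta> * \<theta> ^ n)) has_integral
      B * unit_clamp r ^ n * (1 / (real n + 2))) {0..1}"
    by (intro has_integral_mult_right theta_power_integral)
  have "radial_average f r \<le> B * unit_clamp r ^ n * (1 / (real n + 2))"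
    unfolding radial_average_apply
  proof (rule has_integral_le[OF integrable_integral[OF average_integrable] i])
    fix \<theta> :: real assume \<theta>: "\<theta> \<in> {0..1}"
    have "f (unit_clamp r * \<theta>) \<le> B * (unit_clamp r * \<theta>) ^ n"
      using \<theta> by (intro assms) (auto intro: mult_le_one)
    then have "\<theta> * f (unit_clamp r * \<theta>) \<le> \<theta> * (B * (unit_clamp r * \<theta>) ^ n)"
      using \<theta> by (intro mult_left_mono) auto
    then show "\<theta> * f (unit_clamp r * \<theta>) \<le> B * unit_clamp r ^ n * (\<theta> * \<theta> ^ n)"
      by (simp add: power_mult_distrib algebra_simps)
  qed
  then show ?thesis by simp
qed

lemma norm_radial_average_le: "norm (radial_average f) \<le> norm f / 2"
proof (rule norm_bound)
  fix r
  have "\<bar>\<theta> * f (unit_clamp r * \<theta>)\<bar> \<le> norm f * (\<theta> * \<theta> ^ 0)" if "\<theta> \<in> {0..1}" for \<theta>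
  proof -
    have "\<theta> * \<bar>f (unit_clamp r * \<theta>)\<bar> \<le> \<theta> * norm f"
      using that profile_abs_le[of f] by (intro mult_left_mono) auto
    then show ?thesis using that by (simp add: abs_mult mult.commute)
  qed
  moreover have bound: "((\<lambda>\<theta>. norm f * (\<theta> * \<theta> ^ 0)) has_integral norm f * (1/2)) {0..1::real}"
    using has_integral_mult_right[OF theta_power_integral[of 0], of "norm f"] by simp
  ultimately have "norm (integral {0..1} (\<lambda>\<theta>. \<theta> * f (unit_clamp r * \<theta>)))
      \<le> integral {0..1} (\<lambda>\<theta>. norm f * (\<theta> * \<theta> ^ 0))"
    by (intro integral_norm_bound_integral) auto
  also have "\<dots> = norm f / 2" using integral_unique[OF bound] by simp
  finally show "norm (radial_average f r) \<le> norm f / 2"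
    by (simp add: radial_average_apply)
qed

lemma bounded_linear_radial_average: "bounded_linear radial_average"
proof (rule bounded_linear_intro[where K = "1 / 2"])
  show "radial_average (f + g) = radial_average f + radial_average g" for f g
    by (rule bcontfun_eqI)
      (simp add: radial_average_apply ring_distribs integral_add)
  show "radial_average (c *\<^sub>R f) = c *\<^sub>R radial_average f" for c f
    by (rule bcontfun_eqI)
      (simp add: radial_average_apply mult.left_commute[of _ c] integral_mult_right)
qed (use norm_radial_average_le in \<open>simp add: mult.commute\<close>)

text \<open>
  The function \<open>\<theta> \<mapsto> \<integral>\<^sub>0\<^bsup>r \<theta>\<^esup> \<rho> f(\<rho>) d\<rho>\<close> is a primitive of \<open>r\<^sup>2 \<theta> f(r \<theta>)\<close>.
\<close>

lemma radial_average_integral: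
  assumes "0 \<le> r" "r \<le> 1"
  shows "((\<lambda>\<rho>. \<rho> * apply_bcontfun f \<rho>) has_integral r\<^sup>2 * radial_average f r) {0..r}"
proof -
  let ?M = "\<lambda>s. integral {0..s} (\<lambda>\<rho>. \<rho> * f \<rho>)"
  have io: "(\<lambda>\<rho>. \<rho> * apply_bcontfun f \<rho>) integrable_on {0..s}" for s
    by (intro integrable_continuous_real continuous_intros)
  have M: "(?M has_real_derivative s * f s) (at s within {0..1})" if "s \<in> {0..1}" for s
    by (rule integral_has_real_derivative) (use that in \<open>auto intro!: continuous_intros\<close>)
  have "((\<lambda>\<theta>. r\<^sup>2 * (\<theta> * f (r * \<theta>))) has_integral (?M (r * 1) - ?M (r * 0))) {0..1}"
  proof (rule fundamental_theorem_of_calculus)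
    fix \<theta> :: real assume \<theta>: "\<theta> \<in> {0..1}"
    then have in01: "(\<lambda>\<theta>. r * \<theta>) ` {0..1} \<subseteq> {0..1}" using assms by (auto intro: mult_le_one)
    have "((\<lambda>\<theta>. ?M (r * \<theta>)) has_real_derivative (r * \<theta> * f (r * \<theta>)) * r) (at \<theta> within {0..1})"
    proof -
      have "(?M has_real_derivative (r * \<theta>) * f (r * \<theta>)) (at (r * \<theta>) within (\<lambda>\<theta>. r * \<theta>) ` {0..1})"
        using in01 \<theta> assms by (intro DERIV_subset[OF M]) (auto intro: mult_le_one)
      moreover have "((\<lambda>\<theta>. r * \<theta>) has_real_derivative r) (at \<theta> within {0..1})"
        by (auto intro!: derivative_eq_intros)
      ultimately show ?thesis
        using DERIV_image_chain[of ?M _ "\<lambda>\<theta>. r * \<theta>" \<theta> "{0..1}" r] by (simp add: o_def)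
    qed
    then show "((\<lambda>\<theta>. ?M (r * \<theta>)) has_vector_derivative r\<^sup>2 * (\<theta> * f (r * \<theta>))) (at \<theta> within {0..1})"
      by (simp add: has_real_derivative_iff_has_vector_derivative[symmetric] power2_eq_square algebra_simps)
  qed simp
  then have "integral {0..1} (\<lambda>\<theta>. r\<^sup>2 * (\<theta> * f (r * \<theta>))) = ?M r"
    by (simp only: integral_unique) simp
  then have "r\<^sup>2 * radial_average f r = ?M r"
    using assms by (simp only: integral_mult_right) (simp add: radial_average_apply)
  then show ?thesis using integrable_integral[OF io] by simp
qed

lemma radial_average_0: "radial_average f 0 = f 0 / 2"
proof -
  have "((\<lambda>\<theta>. f 0 * (\<theta> * \<theta> ^ 0)) has_integral f 0 * (1 / 2)) {0..1::real}"
    using has_integral_mult_right[OF theta_power_integral[of 0], of "f 0"] by simp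
  then show ?thesis by (simp add: radial_average_apply integral_unique mult.commute)
qed

lemma radial_average_moment_deriv:
  assumes "0 < r" "r < 1"
  shows "((\<lambda>r. r\<^sup>2 * radial_average f r) has_real_derivative r * f r) (at r)"
proof -
  have "((\<lambda>s. integral {0..s} (\<lambda>\<rho>. \<rho> * f \<rho>)) has_real_derivative r * f r) (at r within {0..1})"
    by (rule integral_has_real_derivative) (use assms in \<open>auto intro!: continuous_intros\<close>)
  then have "((\<lambda>s. integral {0..s} (\<lambda>\<rho>. \<rho> * f \<rho>)) has_real_derivative r * f r) (at r)"
    using assms at_within_Icc_at[of 0 r 1] by simp
  then show ?thesis
  proof (rule has_field_derivative_transform_within_open[where S = "{0<..<1}"])
    show "integral {0..s} (\<lambda>\<rho>. \<rho> * f \<rho>) = s\<^sup>2 * radial_average f s" if "s \<in> {0<..<1}" for s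
      using radial_average_integral[of s f] that by (auto simp: integral_unique)
  qed (use assms in auto)
qed

lemma radial_inverse_laplacian_deriv:
  assumes "0 < r" "r < 1"
  shows "((\<lambda>r. radial_inverse_laplacian f r) has_real_derivative r * radial_average f r) (at r)"
proof (rule has_field_derivative_transform_within_open[OF radial_average_moment_deriv[OF assms], where S = "{0<..<1}"])
  show "s\<^sup>2 * radial_average (radial_average f) s = radial_inverse_laplacian f s" if "s \<in> {0<..<1}" for s
    using that by (simp add: radial_inverse_laplacian_apply)
qed (use assms in auto)

lemma radial_average_cong:
  assumes "\<And>r. 0 \<le> r \<Longrightarrow> r \<le> 1 \<Longrightarrow> apply_bcontfun f r = apply_bcontfun g r"
  shows "radial_average f = radial_average g"
proof (rule bcontfun_eqI)
  fix r
  have "f (unit_clamp r * \<theta>) = g (unit_clamp r * \<theta>)" if "\<theta> \<in> {0..1}" for \<theta>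
    using that by (intro assms) (auto intro: mult_le_one)
  then show "radial_average f r = radial_average g r"
    unfolding radial_average_apply by (intro Henstock_Kurzweil_Integration.integral_cong) auto
qed

lemma bounded_linear_radial_inverse_laplacian: "bounded_linear radial_inverse_laplacian"
proof (rule bounded_linear_intro)
  interpret bounded_linear radial_average by (rule bounded_linear_radial_average)
  show "radial_inverse_laplacian (f + g) = radial_inverse_laplacian f + radial_inverse_laplacian g" for f g
    by (rule bcontfun_eqI) (simp add: radial_inverse_laplacian_apply add ring_distribs)
  show "radial_inverse_laplacian (c *\<^sub>R f) = c *\<^sub>R radial_inverse_laplacian f" for c f
    by (rule bcontfun_eqI) (simp add: radial_inverse_laplacian_apply scaleR)
  show "norm (radial_inverse_laplacian f) \<le> norm f * 1" for f
  proof (rule norm_bound)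
    fix r
    have "\<bar>radial_average (radial_average f) (unit_clamp r)\<bar> \<le> norm f"
      using profile_abs_le[of "radial_average (radial_average f)" "unit_clamp r"]
        norm_radial_average_le[of f] norm_radial_average_le[of "radial_average f"] norm_ge_zero[of f]
      by linarith
    moreover have "(unit_clamp r)\<^sup>2 \<le> 1" by (simp add: power_le_one)
    ultimately show "norm (radial_inverse_laplacian f r) \<le> norm f * 1"
      using mult_mono[of "(unit_clamp r)\<^sup>2" 1 "\<bar>radial_average (radial_average f) (unit_clamp r)\<bar>" "norm f"]
      by (simp add: radial_inverse_laplacian_apply abs_mult)
  qed
qed

section \<open>The Neumann resolvent of the radial Laplacian\<close>

abbreviation const_profile :: "real \<Rightarrow> profile" where
  "const_profile c \<equiv> const_bcontfun c"

lemma positive_part_square_deriv: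
  "((\<lambda>y::real. (max 0 y)\<^sup>2) has_real_derivative 2 * max 0 y) (at y)"
proof -
  consider "y > 0" | "y < 0" | "y = 0" by linarith
  then show ?thesis
  proof cases
    case 1
    have "((\<lambda>y::real. y\<^sup>2) has_real_derivative 2 * max 0 y) (at y)"
      using 1 by (auto intro!: derivative_eq_intros)
    then show ?thesis
      by (rule has_field_derivative_transform_within_open[where S = "{0<..}"]) (use 1 in auto)
  next
    case 2
    have "((\<lambda>y::real. 0) has_real_derivative 2 * max 0 y) (at y)"
      using 2 by (auto intro!: derivative_eq_intros)
    then show ?thesis
      by (rule has_field_derivative_transform_within_open[where S = "{..<0}"]) (use 2 in auto)
  next
    case 3
    have "((\<lambda>h::real. (max 0 h)\<^sup>2 / h) \<longlongrightarrow> 0) (at 0)"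
    proof (rule Lim_null_comparison)
      show "((\<lambda>h::real. \<bar>h\<bar>) \<longlongrightarrow> 0) (at 0)" by (intro tendsto_eq_intros) auto
      show "\<forall>\<^sub>F h in at 0. norm ((max 0 h)\<^sup>2 / h) \<le> \<bar>h :: real\<bar>"
        by (rule always_eventually) (auto simp: power2_eq_square max_def)
    qed
    then show ?thesis using 3 by (simp add: has_field_derivative_iff)
  qed
qed

text \<open>
  The equation \<open>w - \<alpha>\<^sup>2 \<Delta> w = f\<close> in integrated form, with \<open>c = w(0)\<close>.  Since
  \<open>\<alpha>\<^sup>2 w'(1)\<close> is the average of \<open>w - f\<close> at \<open>1\<close>, the second condition is \<open>w'(1) = 0\<close>.
\<close>

definition neumann_resolvent_of :: "real \<Rightarrow> profile \<Rightarrow> profile \<Rightarrow> bool" where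
  "neumann_resolvent_of \<alpha> f w \<longleftrightarrow>
     (\<exists>c. w = const_profile c + (1 / \<alpha>\<^sup>2) *\<^sub>R radial_inverse_laplacian (w - f)) \<and>
     radial_average (w - f) 1 = 0"

text \<open>
  Put \<open>g = w - f\<close>, so that \<open>r w' = (r\<^sup>2 A g) / \<alpha>\<^sup>2\<close> and \<open>(r\<^sup>2 A g)' = r g\<close>, and test the equation with the
  square of the positive part of \<open>w - B\<close>.  The product \<open>\<Theta> = r\<^sup>2 A g ((w - B)\<^sub>+)\<^sup>2\<close> vanishes at both
  ends, at \<open>1\<close> by the Neumann condition.  Its derivative is a sum of two nonnegative terms, because
  \<open>g > 0\<close> wherever \<open>w > B\<close>.  So \<open>\<Theta>\<close> is constant, both terms vanish, and \<open>w > B\<close> is impossible.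
  The square makes the positive part differentiable.
\<close>

lemma neumann_maximum_principle:
  assumes w: "neumann_resolvent_of \<alpha> f w" and \<alpha>: "\<alpha> > 0"
    and B: "\<And>r. 0 \<le> r \<Longrightarrow> r \<le> 1 \<Longrightarrow> apply_bcontfun f r \<le> B"
  shows "apply_bcontfun w r \<le> B"
proof -
  define g where "g = w - f"
  from w obtain c where wc: "w = const_profile c + (1 / \<alpha>\<^sup>2) *\<^sub>R radial_inverse_laplacian g"
    and g1: "radial_average g 1 = 0"
    by (auto simp: neumann_resolvent_of_def g_def)
  have wr: "w r = c + radial_inverse_laplacian g r / \<alpha>\<^sup>2" for r
    by (subst wc) (simp add: const_bcontfun.rep_eq)
  define \<Theta> where "\<Theta> r = r\<^sup>2 * radial_average g r * (max 0 (w r - B))\<^sup>2" for r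
  define \<Theta>' where "\<Theta>' r = r * g r * (max 0 (w r - B))\<^sup>2 +
      2 * r ^ 3 / \<alpha>\<^sup>2 * (radial_average g r)\<^sup>2 * max 0 (w r - B)" for r
  have dw: "((\<lambda>r. w r) has_real_derivative r * radial_average g r / \<alpha>\<^sup>2) (at r)" if "0 < r" "r < 1" for r
    unfolding wr
    using DERIV_add[OF DERIV_const DERIV_cdivide[OF radial_inverse_laplacian_deriv[OF that, of g]]]
    by simp
  have d\<Theta>: "(\<Theta> has_real_derivative \<Theta>' r) (at r)" if "0 < r" "r < 1" for r
  proof -
    have "((\<lambda>r. (max 0 (w r - B))\<^sup>2) has_real_derivative
        2 * max 0 (w r - B) * (r * radial_average g r / \<alpha>\<^sup>2)) (at r)"
      by (rule DERIV_chain2[OF positive_part_square_deriv]) (auto intro!: derivative_eq_intros dw that)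
    from DERIV_mult[OF radial_average_moment_deriv[OF that, of g] this]
    show ?thesis unfolding \<Theta>_def \<Theta>'_def
      by (simp add: algebra_simps power2_eq_square power3_eq_cube)
  qed
  have gpos: "g r * (max 0 (w r - B))\<^sup>2 \<ge> 0" "w r > B \<Longrightarrow> g r > 0" if "0 \<le> r" "r \<le> 1" for r
    using B[OF that] by (auto simp: g_def max_def)
  have \<Theta>'0: "\<Theta>' r \<ge> 0" if "0 \<le> r" "r \<le> 1" for r
    unfolding \<Theta>'_def using gpos(1)[OF that] that
    by (auto simp: mult.assoc intro!: add_nonneg_nonneg mult_nonneg_nonneg divide_nonneg_nonneg)
  have c\<Theta>: "continuous_on {0..1} \<Theta>"
    unfolding \<Theta>_def by (intro continuous_intros)
  have mono: "\<Theta> a \<le> \<Theta> b" if "0 \<le> a" "a \<le> b" "b \<le> 1" for a b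
  proof (rule DERIV_nonneg_imp_increasing_open[OF that(2)])
    show "\<exists>y. (\<Theta> has_real_derivative y) (at x) \<and> 0 \<le> y" if "a < x" "x < b" for x
      using d\<Theta>[of x] \<Theta>'0[of x] that \<open>0 \<le> a\<close> \<open>b \<le> 1\<close> by (intro exI[of _ "\<Theta>' x"]) auto
    show "continuous_on {a..b} \<Theta>" using c\<Theta> by (rule continuous_on_subset) (use that in auto)
  qed
  have z: "\<Theta> r = 0" if "0 \<le> r" "r \<le> 1" for r
    using mono[of 0 r] mono[of r 1] that g1 by (auto simp: \<Theta>_def)
  have inner: "w r \<le> B" if "0 < r" "r < 1" for r
  proof (rule ccontr)
    assume "\<not> w r \<le> B"
    then have pos: "w r > B" by simp
    have "((\<lambda>_. 0) has_real_derivative \<Theta>' r) (at r)"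
      by (rule has_field_derivative_transform_within_open[OF d\<Theta>[OF that], where S = "{0<..<1}"])
        (use that z in auto)
    then have "\<Theta>' r = 0" using DERIV_const DERIV_unique by blast
    moreover have "r * (g r * (max 0 (w r - B))\<^sup>2) > 0"
      using gpos(2)[of r] pos that by (intro mult_pos_pos) auto
    moreover have "2 * r ^ 3 / \<alpha>\<^sup>2 * (radial_average g r)\<^sup>2 * max 0 (w r - B) \<ge> 0"
      using that by (intro mult_nonneg_nonneg divide_nonneg_nonneg) auto
    ultimately show False unfolding \<Theta>'_def by (simp add: mult.assoc)
  qed
  have closed: "w r \<le> B" if "r \<in> {0..1}" for r
  proof -
    have "closed {r. w r \<le> B}"
      by (intro closed_Collect_le continuous_intros continuous_on_apply_bcontfun)
    moreover have "{0<..<1} \<subseteq> {r. w r \<le> B}" using inner by auto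
    ultimately have "closure {0<..<1} \<subseteq> {r. w r \<le> B}" by (rule closure_minimal[rotated])
    then show ?thesis using that by (simp add: subset_iff)
  qed
  have "w r = w (unit_clamp r)" by (simp add: wr radial_inverse_laplacian_apply)
  then show ?thesis using closed[of "unit_clamp r"] by simp
qed

text \<open>
  The resolvent equation is linear, so the maximum principle applies to \<open>v - w\<close> and to \<open>w - v\<close>.
\<close>

lemma neumann_resolvent_nonexpansive:
  assumes "neumann_resolvent_of \<alpha> f v" "neumann_resolvent_of \<alpha> g w" "\<alpha> > 0"
  shows "norm (v - w) \<le> norm (f - g)"
proof -
  interpret A: bounded_linear radial_average by (rule bounded_linear_radial_average)
  interpret S: bounded_linear radial_inverse_laplacian by (rule bounded_linear_radial_inverse_laplacian)
  have lin: "neumann_resolvent_of \<alpha> (f - g) (v - w)"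
    if fv: "neumann_resolvent_of \<alpha> f v" and gw: "neumann_resolvent_of \<alpha> g w" for f g v w
  proof -
    from fv obtain c where c: "v = const_profile c + (1 / \<alpha>\<^sup>2) *\<^sub>R radial_inverse_laplacian (v - f)"
      and c1: "radial_average (v - f) 1 = 0" by (auto simp: neumann_resolvent_of_def)
    from gw obtain d where d: "w = const_profile d + (1 / \<alpha>\<^sup>2) *\<^sub>R radial_inverse_laplacian (w - g)"
      and d1: "radial_average (w - g) 1 = 0" by (auto simp: neumann_resolvent_of_def)
    have e: "(v - w) - (f - g) = (v - f) - (w - g)" by simp
    have cd: "const_profile (c - d) = const_profile c - const_profile d"
      by (rule bcontfun_eqI) (simp add: const_bcontfun.rep_eq)
    have "v - w = (const_profile c + (1 / \<alpha>\<^sup>2) *\<^sub>R radial_inverse_laplacian (v - f)) -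
       (const_profile d + (1 / \<alpha>\<^sup>2) *\<^sub>R radial_inverse_laplacian (w - g))"
      using c d by simp
    also have "\<dots> = const_profile (c - d) +
        (1 / \<alpha>\<^sup>2) *\<^sub>R radial_inverse_laplacian ((v - w) - (f - g))"
      unfolding e S.diff cd scaleR_diff_right by simp
    finally have "v - w = \<dots>" .
    moreover have "radial_average ((v - w) - (f - g)) 1 = 0"
      unfolding e A.diff[of "v - f" "w - g"] using c1 d1 by (simp only: minus_bcontfun.rep_eq)
    ultimately show ?thesis unfolding neumann_resolvent_of_def by blast
  qed
  have bd: "(v - w) r \<le> norm (f - g)"
    if fv: "neumann_resolvent_of \<alpha> f v" and gw: "neumann_resolvent_of \<alpha> g w" for f g v w r
    using neumann_maximum_principle[OF lin[OF fv gw] assms(3)] profile_abs_le[of "f - g"]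
    by (meson abs_le_D1)
  show ?thesis
  proof (rule norm_bound)
    fix r
    have "(v - w) r \<le> norm (f - g)" "(w - v) r \<le> norm (g - f)"
      using bd assms by blast+
    then show "norm ((v - w) r) \<le> norm (f - g)" by (simp add: norm_minus_commute abs_le_iff)
  qed
qed

text \<open>
  Each application maps \<open>r\<^bsup>2 n\<^esup>\<close> to \<open>r\<^bsup>2 n + 2\<^esup> / (2 n + 2)\<^sup>2\<close>.  The factorial decay makes the Neumann series
  of the Volterra equation below converge for every \<open>\<alpha>\<close>.
\<close>

lemma inverse_laplacian_power_bound:
  "\<bar>((radial_inverse_laplacian ^^ n) f) r\<bar> \<le> norm f / fact n * unit_clamp r ^ (2 * n)"
  if "\<And>r. apply_bcontfun f r = f (unit_clamp r)"
proof (induction n arbitrary: r)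
  case 0
  then show ?case using profile_abs_le[of f r] by simp
next
  case (Suc n)
  interpret A: bounded_linear radial_average by (rule bounded_linear_radial_average)
  have one: "(radial_inverse_laplacian h) r \<le> B / real (Suc n) * unit_clamp r ^ (2 * Suc n)"
    if h: "\<And>r. 0 \<le> r \<Longrightarrow> r \<le> 1 \<Longrightarrow> apply_bcontfun h r \<le> B * r ^ (2 * n)" and B: "B \<ge> 0" for h B
  proof -
    have "radial_average h r \<le> B / (2 * real n + 2) * r ^ (2 * n)" if "0 \<le> r" "r \<le> 1" for r
      using radial_average_le_power[of h B "2 * n" r] h that by simp
    from radial_average_le_power[OF this, of "unit_clamp r"]
    have "radial_average (radial_average h) (unit_clamp r)
        \<le> B / (2 * real n + 2) * unit_clamp r ^ (2 * n) / (2 * real n + 2)" by simp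
    also have "\<dots> = B * unit_clamp r ^ (2 * n) / ((2 * real n + 2) * (2 * real n + 2))" by simp
    also have "\<dots> \<le> B * unit_clamp r ^ (2 * n) / real (Suc n)"
    proof (rule divide_left_mono)
      have "1 * real (Suc n) \<le> (2 * real n + 2) * (2 * real n + 2)" by (intro mult_mono) auto
      then show "real (Suc n) \<le> (2 * real n + 2) * (2 * real n + 2)" by simp
    qed (use B in auto)
    finally have "(unit_clamp r)\<^sup>2 * radial_average (radial_average h) (unit_clamp r)
        \<le> (unit_clamp r)\<^sup>2 * (B * unit_clamp r ^ (2 * n) / real (Suc n))"
      by (intro mult_left_mono) auto
    then show ?thesis by (simp add: radial_inverse_laplacian_apply power2_eq_square algebra_simps)
  qed
  interpret S: bounded_linear radial_inverse_laplacian by (rule bounded_linear_radial_inverse_laplacian)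
  let ?h = "(radial_inverse_laplacian ^^ n) f"
  have "apply_bcontfun ?h r \<le> norm f / fact n * r ^ (2 * n)" 
     "apply_bcontfun (- ?h) r \<le> norm f / fact n * r ^ (2 * n)" if "0 \<le> r" "r \<le> 1" for r
    using Suc.IH[of r] that by (auto simp: abs_le_iff)
  from one[OF this(1)] one[OF this(2)]
  have "(radial_inverse_laplacian ?h) r \<le> norm f / fact n / real (Suc n) * unit_clamp r ^ (2 * Suc n)"
    "- (radial_inverse_laplacian ?h) r \<le> norm f / fact n / real (Suc n) * unit_clamp r ^ (2 * Suc n)"
    by (auto simp: S.neg)
  then show ?case by (simp add: abs_le_iff mult.commute)
qed

text \<open>
  The equation \<open>E = f + \<alpha>\<^bsup>-2\<^esup> S E\<close>, with \<open>S\<close> the inverse Laplacian, is solved by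
  \<open>E = \<Sum>\<^sub>n \<alpha>\<^bsup>-2 n\<^esup> S\<^sup>n f\<close>.  For \<open>f = 1\<close> this is the modified Bessel function \<open>I\<^sub>0(r / \<alpha>)\<close>.
\<close>

lemma volterra_solution_exists:
  assumes f: "\<And>r. apply_bcontfun f r = f (unit_clamp r)" and \<alpha>: "\<alpha> > 0"
  obtains E where "E = f + (1 / \<alpha>\<^sup>2) *\<^sub>R radial_inverse_laplacian E"
    and "(\<And>r. apply_bcontfun f r \<ge> 0) \<Longrightarrow> (\<And>r. apply_bcontfun E r \<ge> apply_bcontfun f r)"
proof -
  interpret S: bounded_linear radial_inverse_laplacian by (rule bounded_linear_radial_inverse_laplacian)
  interpret A: bounded_linear radial_average by (rule bounded_linear_radial_average)
  define l where "l = 1 / \<alpha>\<^sup>2"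
  define a where "a n = l ^ n *\<^sub>R (radial_inverse_laplacian ^^ n) f" for n
  have l: "l > 0" using \<alpha> by (simp add: l_def)
  have na: "norm (a n) \<le> norm f * (l ^ n / fact n)" for n
  proof -
    have "norm ((radial_inverse_laplacian ^^ n) f) \<le> norm f / fact n"
    proof (rule norm_bound)
      fix r
      have "norm f / fact n * unit_clamp r ^ (2 * n) \<le> norm f / fact n * 1"
        by (intro mult_left_mono power_le_one) auto
      then show "norm ((radial_inverse_laplacian ^^ n) f r) \<le> norm f / fact n"
        using inverse_laplacian_power_bound[OF f, of n r] by simp
    qed
    then have "l ^ n * norm ((radial_inverse_laplacian ^^ n) f) \<le> l ^ n * (norm f / fact n)"
      using l by (intro mult_left_mono) auto
    then show ?thesis using l by (simp add: a_def mult.commute)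
  qed
  have sum: "summable a"
  proof (rule summable_comparison_test)
    show "\<exists>N. \<forall>n\<ge>N. norm (a n) \<le> norm f * (l ^ n / fact n)" using na by auto
    show "summable (\<lambda>n. norm f * (l ^ n / fact n))"
      using summable_exp[of l] by (intro summable_mult) (simp add: divide_inverse mult.commute)
  qed
  have step: "a (Suc n) = l *\<^sub>R radial_inverse_laplacian (a n)" for n
    by (simp add: a_def S.scaleR)
  define E where "E = suminf a"
  have "E = a 0 + (\<Sum>n. a (Suc n))" unfolding E_def by (subst suminf_split_head[OF sum]) simp
  also have "(\<Sum>n. a (Suc n)) = l *\<^sub>R (\<Sum>n. radial_inverse_laplacian (a n))"
    unfolding step by (rule suminf_scaleR_right[symmetric]) (rule S.summable[OF sum])
  also have "(\<Sum>n. radial_inverse_laplacian (a n)) = radial_inverse_laplacian E"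
    unfolding E_def by (rule S.suminf[OF sum, symmetric])
  finally have eq: "E = f + l *\<^sub>R radial_inverse_laplacian E" by (simp add: a_def)
  have "apply_bcontfun E r \<ge> apply_bcontfun f r" if pos: "\<And>r. apply_bcontfun f r \<ge> 0" for r
  proof -
    have Apos: "apply_bcontfun (radial_average h) r \<ge> 0" if "\<And>r. apply_bcontfun h r \<ge> 0" for h r
      unfolding radial_average_apply
      by (intro integral_nonneg average_integrable) (use that in auto)
    have an: "apply_bcontfun (a n) r \<ge> 0" for n r
    proof -
      have "apply_bcontfun ((radial_inverse_laplacian ^^ n) f) r \<ge> 0"
        by (induction n arbitrary: r) (auto simp: radial_inverse_laplacian_apply pos intro!: mult_nonneg_nonneg Apos)
      then show ?thesis using l by (simp add: a_def)
    qed
    have ev: "bounded_linear (\<lambda>f :: profile. f r)"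
      by (rule bounded_linear_intro[where K = 1]) (auto intro: profile_abs_le)
    have "(\<Sum>n\<in>{0}. a n r) \<le> (\<Sum>n. a n r)"
      by (rule sum_le_suminf) (auto intro: bounded_linear.summable[OF ev sum] an)
    also have "\<dots> = E r" unfolding E_def by (rule bounded_linear.suminf[OF ev sum, symmetric])
    finally show ?thesis by (simp add: a_def)
  qed
  with eq show ?thesis using that by (simp add: l_def)
qed

text \<open>
  With \<open>E\<close> and \<open>D\<close> the Volterra solutions for \<open>f\<close> and for \<open>1\<close>, the function \<open>f - E + c D\<close> solves the
  integrated equation for every \<open>c\<close>.  As \<open>D \<ge> 1\<close>, its average at \<open>1\<close> is positive, and \<open>c\<close> can be
  chosen to meet the Neumann condition.
\<close>

lemma neumann_resolvent_exists:
  assumes f: "\<And>r. apply_bcontfun f r = f (unit_clamp r)" and \<alpha>: "\<alpha> > 0"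
  shows "\<exists>w. neumann_resolvent_of \<alpha> f w"
proof -
  interpret S: bounded_linear radial_inverse_laplacian by (rule bounded_linear_radial_inverse_laplacian)
  interpret A: bounded_linear radial_average by (rule bounded_linear_radial_average)
  define l where "l = 1 / \<alpha>\<^sup>2"
  obtain E where E: "E = f + l *\<^sub>R radial_inverse_laplacian E"
    using volterra_solution_exists[OF f \<alpha>] unfolding l_def by blast
  obtain D where D: "D = const_profile 1 + l *\<^sub>R radial_inverse_laplacian D"
    and D1: "\<And>r. apply_bcontfun D r \<ge> 1"
    using volterra_solution_exists[of "const_profile 1" \<alpha>] \<alpha> unfolding l_def
    by (auto simp: const_bcontfun.rep_eq)
  have "radial_average (const_profile 1 - D) 1 \<le> 0"
    using radial_average_le_power[of "const_profile 1 - D" 0 0 1] D1 by (simp add: const_bcontfun.rep_eq)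
  moreover have "radial_average (const_profile 1) 1 = 1 / 2"
    using theta_power_integral[of 0] by (simp add: radial_average_apply const_bcontfun.rep_eq integral_unique)
  ultimately have HD: "radial_average D 1 > 0" by (simp add: A.diff)
  define c where "c = radial_average E 1 / radial_average D 1"
  define w where "w = f - E + c *\<^sub>R D"
  have "w = c *\<^sub>R const_profile 1 + l *\<^sub>R radial_inverse_laplacian (w - f)"
  proof -
    have "c *\<^sub>R D = c *\<^sub>R const_profile 1 + c *\<^sub>R l *\<^sub>R radial_inverse_laplacian D"
      using arg_cong[OF D, of "scaleR c"] by (simp add: scaleR_add_right)
    moreover have "f - E = - (l *\<^sub>R radial_inverse_laplacian E)"
      using E by (metis add_diff_cancel_left' minus_diff_eq)
    moreover have "w - f = c *\<^sub>R D - E" by (simp add: w_def)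
    then have "l *\<^sub>R radial_inverse_laplacian (w - f) =
        c *\<^sub>R l *\<^sub>R radial_inverse_laplacian D - l *\<^sub>R radial_inverse_laplacian E"
      by (simp only: S.diff S.scaleR scaleR_diff_right scaleR_left_commute)
    ultimately show ?thesis unfolding w_def by simp
  qed
  moreover have "c *\<^sub>R const_profile 1 = const_profile c"
    by (rule bcontfun_eqI) (simp add: const_bcontfun.rep_eq)
  moreover have "radial_average (w - f) 1 = 0"
  proof -
    have "w - f = c *\<^sub>R D - E" by (simp add: w_def)
    then show ?thesis using HD by (simp add: A.diff A.scaleR c_def)
  qed
  ultimately show ?thesis unfolding neumann_resolvent_of_def l_def by auto
qed

section \<open>Swirling velocity fields\<close>

definition perp :: "real^2 \<Rightarrow> real^2" where
  "perp x = vector [- x $ 2, x $ 1]"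

lemma perp_nth [simp]: "perp x $ 1 = - x $ 2" "perp x $ 2 = x $ 1"
  by (auto simp: perp_def)

lemma perp_0 [simp]: "perp 0 = 0"
  by (simp add: vec_eq_iff forall_2)

lemma norm_sq_2: "(norm (x :: real^2))\<^sup>2 = (x $ 1)\<^sup>2 + (x $ 2)\<^sup>2"
  by (simp add: norm_vec_def L2_set_def sum_2)

lemma norm_perp [simp]: "norm (perp x) = norm x"
proof -
  have "(norm (perp x))\<^sup>2 = (norm x)\<^sup>2" by (simp only: norm_sq_2) simp
  then show ?thesis by simp
qed

lemma bounded_linear_perp: "bounded_linear perp"
proof (rule bounded_linear_intro[where K = 1])
  show "perp (x + y) = perp x + perp y" for x y by (simp add: vec_eq_iff forall_2)
  show "perp (c *\<^sub>R x) = c *\<^sub>R perp x" for x c by (simp add: vec_eq_iff forall_2)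
qed simp

lemma continuous_on_perp [continuous_intros]:
  "continuous_on A f \<Longrightarrow> continuous_on A (\<lambda>x. perp (f x))"
  by (rule bounded_linear.continuous_on[OF bounded_linear_perp])

text \<open>
  The velocity field with vorticity \<open>f(|x|)\<close>; on the disc it is the field of \<open>swirl_velocity\<close>,
  and its components have the derivatives \<open>swirl_jac\<close>.
\<close>

definition swirl :: "profile \<Rightarrow> real^2 \<Rightarrow> real^2" where
  "swirl f x = radial_average f (norm x) *\<^sub>R perp x"

definition swirl_jac :: "profile \<Rightarrow> 2 \<Rightarrow> 2 \<Rightarrow> real^2 \<Rightarrow> real" where
  "swirl_jac f j i x = radial_average f (norm x) * perp (axis i 1) $ j +
     perp x $ j * x $ i / (norm x)\<^sup>2 * (f (norm x) - 2 * radial_average f (norm x))"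

lemma swirl_velocity_eq_swirl:
  assumes "norm x \<le> 1" and "\<And>r. 0 \<le> r \<Longrightarrow> r \<le> 1 \<Longrightarrow> apply_bcontfun f r = w r"
  shows "swirl_velocity w x = swirl f x"
proof -
  have "integral {0..norm x} (\<lambda>\<rho>. \<rho> * w \<rho>) = integral {0..norm x} (\<lambda>\<rho>. \<rho> * f \<rho>)"
    using assms by (intro Henstock_Kurzweil_Integration.integral_cong) auto
  also have "\<dots> = (norm x)\<^sup>2 * radial_average f (norm x)"
    using radial_average_integral[of "norm x" f] assms(1) by (simp add: integral_unique)
  finally show ?thesis
    by (cases "x = 0") (simp_all add: swirl_velocity_def swirl_def perp_def[symmetric])
qed

lemma radial_average_deriv:
  assumes "0 < r" "r < 1"
  shows "((\<lambda>r. radial_average f r) has_real_derivative (f r - 2 * radial_average f r) / r) (at r)"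
proof -
  have "((\<lambda>r. r\<^sup>2 * radial_average f r / r\<^sup>2) has_real_derivative
      (r * f r * r\<^sup>2 - r\<^sup>2 * radial_average f r * (2 * r)) / (r\<^sup>2 * r\<^sup>2)) (at r)"
    by (rule DERIV_divide[OF radial_average_moment_deriv[OF assms]])
      (use assms in \<open>auto intro!: derivative_eq_intros\<close>)
  moreover have "(r * f r * r\<^sup>2 - r\<^sup>2 * radial_average f r * (2 * r)) / (r\<^sup>2 * r\<^sup>2) = (f r - 2 * radial_average f r) / r"
    using assms by (simp add: field_simps power2_eq_square)
  ultimately show ?thesis
    using assms by (auto intro: has_field_derivative_transform_within_open[where S = "{0<..}"])
qed

text \<open>
  Away from the centre this is the chain rule.  At the centre \<open>h(|x|) x\<^sup>\<bottom>\<close> is a continuous function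
  times a linear one, so only \<open>h(0)\<close> enters the derivative.
\<close>

lemma swirl_has_derivative:
  assumes "x \<in> disc"
  shows "((\<lambda>x. swirl f x $ j) has_derivative (\<lambda>v. radial_average f (norm x) * perp v $ j +
     perp x $ j * (x \<bullet> v) / (norm x)\<^sup>2 * (f (norm x) - 2 * radial_average f (norm x)))) (at x)"
proof (cases "x = 0")
  case False
  let ?d = "(f (norm x) - 2 * radial_average f (norm x)) / norm x"
  have "((\<lambda>r. radial_average f r) has_derivative (\<lambda>h. ?d * h)) (at (norm x))"
    using radial_average_deriv[of "norm x" f] assms False
    unfolding has_field_derivative_def by (metis mem_ball_0 zero_less_norm_iff)
  moreover have "(norm has_derivative (\<lambda>v. x \<bullet> v / norm x)) (at x)"
    using has_derivative_norm[OF False] by (simp add: sgn_div_norm inner_commute divide_inverse_commute)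
  ultimately have a: "((\<lambda>x. radial_average f (norm x)) has_derivative (\<lambda>v. ?d * (x \<bullet> v / norm x))) (at x)"
    by (rule has_derivative_compose[rotated])
  have p: "((\<lambda>x. perp x $ j) has_derivative (\<lambda>v. perp v $ j)) (at x)"
    by (intro bounded_linear_imp_has_derivative bounded_linear_compose[OF bounded_linear_vec_nth bounded_linear_perp])
  show ?thesis
    using has_derivative_mult[OF a p] unfolding swirl_def
    by (simp add: algebra_simps power2_eq_square diff_divide_distrib)
next
  case True
  have bl: "bounded_linear (\<lambda>x. perp x $ j)"
    by (rule bounded_linear_compose[OF bounded_linear_vec_nth bounded_linear_perp])
  have "((\<lambda>x. swirl f x $ j) has_derivative (\<lambda>v. radial_average f 0 * perp v $ j)) (at 0)"
    unfolding has_derivative_at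
  proof
    show "bounded_linear (\<lambda>v. radial_average f 0 * perp v $ j)"
      by (rule bounded_linear_const_mult[OF bl])
    show "((\<lambda>h. norm (swirl f (0 + h) $ j - swirl f 0 $ j - radial_average f 0 * perp h $ j) / norm h) \<longlongrightarrow> 0) (at 0)"
    proof (rule Lim_null_comparison)
      show "\<forall>\<^sub>F h in at 0. norm (norm (swirl f (0 + h) $ j - swirl f 0 $ j - radial_average f 0 * perp h $ j) / norm h)
        \<le> \<bar>radial_average f (norm h) - radial_average f 0\<bar>"
      proof (rule always_eventually, rule allI)
        fix h :: "real^2"
        have "swirl f (0 + h) $ j - swirl f 0 $ j - radial_average f 0 * perp h $ j =
            (radial_average f (norm h) - radial_average f 0) * perp h $ j"
          by (simp add: swirl_def algebra_simps)
        moreover have "\<bar>perp h $ j\<bar> / norm h \<le> 1"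
          using component_le_norm_cart[of "perp h" j] by (simp add: divide_le_eq)
        then have "\<bar>radial_average f (norm h) - radial_average f 0\<bar> * (\<bar>perp h $ j\<bar> / norm h)
            \<le> \<bar>radial_average f (norm h) - radial_average f 0\<bar> * 1"
          by (intro mult_left_mono) auto
        ultimately show "norm (norm (swirl f (0 + h) $ j - swirl f 0 $ j - radial_average f 0 * perp h $ j) / norm h)
            \<le> \<bar>radial_average f (norm h) - radial_average f 0\<bar>"
          by (simp only: real_norm_def abs_mult abs_divide abs_idempotent abs_norm_cancel times_divide_eq_right mult_1_right)
      qed
      have "continuous_on UNIV (\<lambda>h :: real^2. \<bar>radial_average f (norm h) - radial_average f 0\<bar>)"
        by (intro continuous_intros)
      then have "isCont (\<lambda>h :: real^2. \<bar>radial_average f (norm h) - radial_average f 0\<bar>) 0"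
        by (simp add: continuous_on_eq_continuous_at)
      then show "((\<lambda>h :: real^2. \<bar>radial_average f (norm h) - radial_average f 0\<bar>) \<longlongrightarrow> 0) (at 0)"
        by (simp add: isCont_def)
    qed
  qed
  then show ?thesis using True by simp
qed

lemma jac_swirl:
  assumes "x \<in> disc"
  shows "jac (swirl f) j i x = swirl_jac f j i x"
  unfolding jac_def swirl_jac_def
  using partial_eqI[OF swirl_has_derivative[OF assms]] by (simp add: inner_axis)

lemma continuous_on_apply_profile:
  assumes "continuous_on A F" "continuous_on A g"
  shows "continuous_on A (\<lambda>z. apply_bcontfun (F z :: profile) (g z :: real))"
  unfolding continuous_on_def
proof
  fix z assume z: "z \<in> A"
  have g: "((\<lambda>y. apply_bcontfun (F z) (g y)) \<longlongrightarrow> apply_bcontfun (F z) (g z)) (at z within A)"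
    using continuous_on_profile[OF assms(2), of "F z"] z by (auto simp: continuous_on_def)
  have F: "((\<lambda>y. F y - F z) \<longlongrightarrow> 0) (at z within A)"
    using assms(1) z by (auto simp: continuous_on_def intro: LIM_zero)
  have "((\<lambda>y. apply_bcontfun (F y - F z) (g y)) \<longlongrightarrow> 0) (at z within A)"
  proof (rule Lim_null_comparison[OF always_eventually tendsto_norm_zero[OF F]], rule allI)
    show "norm (apply_bcontfun (F y - F z) (g y)) \<le> norm (F y - F z)" for y
      using profile_abs_le[of "F y - F z" "g y"] by (simp only: real_norm_def)
  qed
  from tendsto_add[OF this g] show "((\<lambda>y. F y (g y)) \<longlongrightarrow> F z (g z)) (at z within A)" by simp
qed

lemma perp_quotient_le: "\<bar>perp x $ j * x $ i / (norm x)\<^sup>2\<bar> \<le> 1"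
proof (cases "x = 0")
  case False
  have "\<bar>perp x $ j\<bar> * \<bar>x $ i\<bar> \<le> norm x * norm x"
    using component_le_norm_cart[of "perp x" j] component_le_norm_cart[of x i]
    by (intro mult_mono) auto
  then show ?thesis using False by (simp add: abs_mult power2_eq_square)
qed simp

text \<open>
  The coefficient \<open>x\<^sup>\<bottom>\<^sub>j x\<^sub>i / |x|\<^sup>2\<close> has no limit at the centre but is bounded by \<open>1\<close>, and its cofactor
  \<open>f(r) - 2 A f(r)\<close> vanishes there.
\<close>

lemma continuous_on_swirl_jac:
  assumes F: "continuous_on A F" and y: "continuous_on A y"
  shows "continuous_on A (\<lambda>z. swirl_jac (F z) j i (y z))"
proof -
  let ?H = "\<lambda>z. radial_average (F z)"
  have H: "continuous_on A (\<lambda>z. radial_average (F z))"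
    by (rule bounded_linear.continuous_on[OF bounded_linear_radial_average F])
  have Hr: "continuous_on A (\<lambda>z. ?H z (norm (y z)))"
    by (intro continuous_on_apply_profile H continuous_on_norm y)
  have k: "continuous_on A (\<lambda>z. F z (norm (y z)) - 2 * ?H z (norm (y z)))"
    by (intro continuous_intros Hr continuous_on_apply_profile F y)
  have "continuous_on A (\<lambda>z. perp (y z) $ j * y z $ i / (norm (y z))\<^sup>2 * (F z (norm (y z)) - 2 * ?H z (norm (y z))))"
    unfolding continuous_on_def
  proof
    fix z assume z: "z \<in> A"
    have kz: "((\<lambda>z. F z (norm (y z)) - 2 * ?H z (norm (y z))) \<longlongrightarrow> F z (norm (y z)) - 2 * ?H z (norm (y z))) (at z within A)"
      using k z by (auto simp: continuous_on_def)
    show "((\<lambda>z. perp (y z) $ j * y z $ i / (norm (y z))\<^sup>2 * (F z (norm (y z)) - 2 * ?H z (norm (y z)))) \<longlongrightarrow>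
        perp (y z) $ j * y z $ i / (norm (y z))\<^sup>2 * (F z (norm (y z)) - 2 * ?H z (norm (y z)))) (at z within A)"
    proof (cases "y z = 0")
      case True
      then have k0: "((\<lambda>z. F z (norm (y z)) - 2 * ?H z (norm (y z))) \<longlongrightarrow> 0) (at z within A)"
        using kz by (simp add: radial_average_0)
      have "((\<lambda>z. perp (y z) $ j * y z $ i / (norm (y z))\<^sup>2 * (F z (norm (y z)) - 2 * ?H z (norm (y z)))) \<longlongrightarrow> 0) (at z within A)"
      proof (rule Lim_null_comparison[OF always_eventually tendsto_norm_zero[OF k0]], intro allI)
        fix x
        have "\<bar>perp (y x) $ j * y x $ i / (norm (y x))\<^sup>2\<bar> * \<bar>F x (norm (y x)) - 2 * ?H x (norm (y x))\<bar>
           \<le> 1 * \<bar>F x (norm (y x)) - 2 * ?H x (norm (y x))\<bar>"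
          by (intro mult_right_mono perp_quotient_le) auto
        then show "norm (perp (y x) $ j * y x $ i / (norm (y x))\<^sup>2 * (F x (norm (y x)) - 2 * ?H x (norm (y x))))
           \<le> norm (F x (norm (y x)) - 2 * ?H x (norm (y x)))"
          by (simp only: real_norm_def abs_mult mult_1)
      qed
      with True show ?thesis by simp
    next
      case False
      have yz: "(y \<longlongrightarrow> y z) (at z within A)" using y z by (auto simp: continuous_on_def)
      have "((\<lambda>z. perp (y z)) \<longlongrightarrow> perp (y z)) (at z within A)"
        by (rule bounded_linear.tendsto[OF bounded_linear_perp yz])
      then show ?thesis using False by (intro tendsto_intros kz yz) auto
    qed
  qed
  then show ?thesis unfolding swirl_jac_def
    by (intro continuous_on_add continuous_on_mult_right Hr)
qed

lemma continuous_on_swirl: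
  assumes F: "continuous_on A F" and y: "continuous_on A y"
  shows "continuous_on A (\<lambda>z. swirl (F z) (y z))"
  unfolding swirl_def
  by (intro continuous_intros continuous_on_apply_profile y
     bounded_linear.continuous_on[OF bounded_linear_radial_average F])

lemma swirl_jac_le: "\<bar>swirl_jac f j i x\<bar> \<le> 3 * norm f"
proof -
  have H: "\<bar>radial_average f (norm x)\<bar> \<le> norm f / 2"
    using profile_abs_le[of "radial_average f" "norm x"] norm_radial_average_le[of f] by simp
  have "\<bar>perp (axis i 1) $ j\<bar> \<le> 1" using component_le_norm_cart[of "perp (axis i 1)" j] by simp
  then have "\<bar>radial_average f (norm x) * perp (axis i 1) $ j\<bar> \<le> norm f / 2 * 1"
    unfolding abs_mult using H by (intro mult_mono) auto
  moreover have "\<bar>perp x $ j * x $ i / (norm x)\<^sup>2 * (f (norm x) - 2 * radial_average f (norm x))\<bar> \<le> 1 * (2 * norm f)"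
    unfolding abs_mult[of "perp x $ j * x $ i / (norm x)\<^sup>2"]
    using H profile_abs_le[of f "norm x"] by (intro mult_mono perp_quotient_le) auto
  ultimately show ?thesis unfolding swirl_jac_def
    using norm_ge_zero[of f] by (intro order_trans[OF abs_triangle_ineq]) linarith
qed

lemma norm_swirl_le: "norm (swirl f x) \<le> norm f / 2 * norm x"
proof -
  have "\<bar>radial_average f (norm x)\<bar> \<le> norm f / 2"
    using profile_abs_le[of "radial_average f" "norm x"] norm_radial_average_le[of f] by simp
  then show ?thesis using mult_right_mono[of _ "norm f / 2" "norm x"] by (simp add: swirl_def)
qed

lemma swirl_linear:
  "swirl (f + g) x = swirl f x + swirl g x" "swirl (c *\<^sub>R f) x = c *\<^sub>R swirl f x"
  "swirl_jac (f + g) j i x = swirl_jac f j i x + swirl_jac g j i x"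
  "swirl_jac (c *\<^sub>R f) j i x = c * swirl_jac f j i x"
proof -
  interpret bounded_linear radial_average by (rule bounded_linear_radial_average)
  show "swirl (f + g) x = swirl f x + swirl g x" "swirl (c *\<^sub>R f) x = c *\<^sub>R swirl f x"
    by (simp_all add: swirl_def add scaleR scaleR_add_left)
  show "swirl_jac (f + g) j i x = swirl_jac f j i x + swirl_jac g j i x"
    unfolding swirl_jac_def add plus_bcontfun.rep_eq by algebra
  show "swirl_jac (c *\<^sub>R f) j i x = c * swirl_jac f j i x"
    unfolding swirl_jac_def scaleR scaleR_bcontfun.rep_eq real_scaleR_def by algebra
qed

lemma div2_swirl: "x \<in> disc \<Longrightarrow> div2 (swirl f) x = 0"
  by (simp add: div2_def jac_swirl swirl_jac_def sum_2 axis_def)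

text \<open>
  The curl of \<open>h(r) x\<^sup>\<bottom>\<close> is \<open>2 h + r h'\<close>, and \<open>r h' = f - 2 h\<close>.
\<close>

lemma curl2_swirl: "x \<in> disc \<Longrightarrow> curl2 (swirl f) x = f (norm x)"
proof -
  assume x: "x \<in> disc"
  show ?thesis
  proof (cases "x = 0")
    case True
    with x show ?thesis by (simp add: curl2_def jac_swirl swirl_jac_def axis_def radial_average_0)
  next
    case False
    define N where "N = (norm x)\<^sup>2"
    have N: "N = (x $ 1)\<^sup>2 + (x $ 2)\<^sup>2" by (simp add: N_def norm_sq_2)
    have N0: "N > 0" using False by (simp add: N_def)
    have e: "(x $ 1)\<^sup>2 = N - (x $ 2)\<^sup>2" using N by simp
    from x show ?thesis using N0
      unfolding curl2_def jac_swirl[OF x] swirl_jac_def N_def[symmetric]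
      by (simp add: axis_def field_simps power2_eq_square[symmetric] e)
  qed
qed

section \<open>Smooth functions and polynomial swirls\<close>

text \<open>
  On these functions the rules for partial derivatives are equations between functions, not only
  between their values at a point, so that iterated derivatives are computed by rewriting.
\<close>

definition smooth :: "(real^2 \<Rightarrow> real) \<Rightarrow> bool" where
  "smooth f \<longleftrightarrow> (\<forall>k. Ck k f)"

lemma partial_add:
  assumes "f differentiable (at x)" "g differentiable (at x)"
  shows "partial i (\<lambda>x. f x + g x) x = partial i f x + partial i g x"
proof -
  from assms obtain f' g' where d: "(f has_derivative f') (at x)" "(g has_derivative g') (at x)"
    by (auto simp: differentiable_def)
  show ?thesis by (simp add: partial_eqI[OF d(1)] partial_eqI[OF d(2)] partial_eqI[OF has_derivative_add[OF d]])
qed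

lemma partial_mult:
  assumes "f differentiable (at x)" "g differentiable (at x)"
  shows "partial i (\<lambda>x. f x * g x) x = partial i f x * g x + f x * partial i g x"
proof -
  from assms obtain f' g' where d: "(f has_derivative f') (at x)" "(g has_derivative g') (at x)"
    by (auto simp: differentiable_def)
  show ?thesis by (simp add: partial_eqI[OF d(1)] partial_eqI[OF d(2)] partial_eqI[OF has_derivative_mult[OF d]])
qed

lemma partial_coord [simp]: "partial i (\<lambda>x. x $ j) = (\<lambda>x. if i = j then 1 else 0)"
proof
  fix x :: "real^2"
  have "((\<lambda>x. x $ j) has_derivative (\<lambda>v. v $ j)) (at x)"
    by (rule bounded_linear_imp_has_derivative) (rule bounded_linear_vec_nth)
  then show "partial i (\<lambda>x. x $ j) x = (if i = j then 1 else 0)"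
    by (simp add: partial_eqI axis_def)
qed

lemma Ck_differentiable: "Ck (Suc k) f \<Longrightarrow> f differentiable (at x)"
  by (simp add: differentiable_on_def)

lemma Ck_Suc_imp: "Ck (Suc k) f \<Longrightarrow> Ck k f"
proof (induction k arbitrary: f)
  case 0
  then show ?case by (simp add: differentiable_imp_continuous_on)
next
  case (Suc k)
  then show ?case by simp
qed

lemma Ck_add: "Ck k f \<Longrightarrow> Ck k g \<Longrightarrow> Ck k (\<lambda>x. f x + g x)"
proof (induction k arbitrary: f g)
  case 0
  then show ?case by (simp add: continuous_on_add)
next
  case (Suc k)
  have "partial i (\<lambda>x. f x + g x) = (\<lambda>x. partial i f x + partial i g x)" for i
    using Suc.prems by (intro ext partial_add) (auto intro: Ck_differentiable)
  with Suc show ?case by (auto simp: differentiable_on_def)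
qed

lemma Ck_mult: "Ck k f \<Longrightarrow> Ck k g \<Longrightarrow> Ck k (\<lambda>x. f x * g x)"
proof (induction k arbitrary: f g)
  case 0
  then show ?case by (simp add: continuous_on_mult)
next
  case (Suc k)
  have "partial i (\<lambda>x. f x * g x) = (\<lambda>x. partial i f x * g x + f x * partial i g x)" for i
    using Suc.prems by (intro ext partial_mult) (auto intro: Ck_differentiable)
  moreover have "Ck k (\<lambda>x. partial i f x * g x + f x * partial i g x)" for i
    using Suc.prems Suc.IH Ck_Suc_imp by (intro Ck_add) auto
  ultimately show ?case using Suc.prems by (auto simp: differentiable_on_def)
qed

lemma Ck_const: "Ck k (\<lambda>x. c)"
  by (induction k arbitrary: c) auto

lemma smooth_const [simp, intro]: "smooth (\<lambda>x. c)"
  by (simp add: smooth_def Ck_const)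

lemma smooth_coord [simp, intro]: "smooth (\<lambda>x. x $ j)"
  unfolding smooth_def
proof
  fix k show "Ck k (\<lambda>x. x $ j)"
    by (cases k) (auto intro!: continuous_intros derivative_intros Ck_const
      bounded_linear_imp_differentiable_on bounded_linear_vec_nth)
qed

lemma smooth_add [simp, intro]: "smooth f \<Longrightarrow> smooth g \<Longrightarrow> smooth (\<lambda>x. f x + g x)"
  by (simp add: smooth_def Ck_add)

lemma smooth_mult [simp, intro]: "smooth f \<Longrightarrow> smooth g \<Longrightarrow> smooth (\<lambda>x. f x * g x)"
  by (simp add: smooth_def Ck_mult)

lemma smooth_uminus [simp, intro]: "smooth f \<Longrightarrow> smooth (\<lambda>x. - f x)"
  using smooth_mult[of "\<lambda>_. - 1" f] by simp

lemma smooth_diff [simp, intro]: "smooth f \<Longrightarrow> smooth g \<Longrightarrow> smooth (\<lambda>x. f x - g x)"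
  using smooth_add[of f "\<lambda>x. - g x"] by simp

lemma smooth_partial [simp, intro]: "smooth f \<Longrightarrow> smooth (partial i f)"
  by (metis Ck.simps(2) smooth_def)

lemma smooth_differentiable [simp, intro]: "smooth f \<Longrightarrow> f differentiable (at x)"
  unfolding smooth_def by (rule Ck_differentiable[of 0]) blast

lemma smooth_continuous: "smooth f \<Longrightarrow> continuous_on A f"
  unfolding smooth_def using Ck.simps(1) continuous_on_subset by blast

lemma smooth_partial_add [simp]:
  "smooth f \<Longrightarrow> smooth g \<Longrightarrow> partial i (\<lambda>x. f x + g x) = (\<lambda>x. partial i f x + partial i g x)"
  by (intro ext partial_add) auto

lemma smooth_partial_mult [simp]:
  "smooth f \<Longrightarrow> smooth g \<Longrightarrow> partial i (\<lambda>x. f x * g x) = (\<lambda>x. partial i f x * g x + f x * partial i g x)"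
  by (intro ext partial_mult) auto

lemma smooth_partial_uminus [simp]:
  "smooth f \<Longrightarrow> partial i (\<lambda>x. - f x) = (\<lambda>x. - partial i f x)"
  using smooth_partial_mult[of "\<lambda>_. - 1" f] by simp

lemma smooth_partial_diff [simp]:
  "smooth f \<Longrightarrow> smooth g \<Longrightarrow> partial i (\<lambda>x. f x - g x) = (\<lambda>x. partial i f x - partial i g x)"
  using smooth_partial_add[of f "\<lambda>x. - g x"] by simp

lemma smooth_divide_const [simp, intro]: "smooth f \<Longrightarrow> smooth (\<lambda>x. f x / c)"
  using smooth_mult[of f "\<lambda>_. inverse c"] by (simp add: divide_inverse)

lemma smooth_partial_divide_const [simp]:
  "smooth f \<Longrightarrow> partial i (\<lambda>x. f x / c) = (\<lambda>x. partial i f x / c)"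
  using smooth_partial_mult[of f "\<lambda>_. inverse c" i] by (simp add: divide_inverse)

text \<open>
  Polynomials in \<open>|x|\<^sup>2\<close>, written in coordinates so that they are visibly smooth.
\<close>

definition radial_poly :: "real poly \<Rightarrow> real^2 \<Rightarrow> real" where
  "radial_poly p x = poly p (x $ 1 * x $ 1 + x $ 2 * x $ 2)"

lemma radial_poly_pCons: "radial_poly (pCons a p) = (\<lambda>x. a + (x $ 1 * x $ 1 + x $ 2 * x $ 2) * radial_poly p x)"
  by (auto simp: radial_poly_def)

lemma smooth_radial_poly [simp, intro]: "smooth (radial_poly p)"
proof (induction p)
  case 0
  then show ?case by (simp add: radial_poly_def)
next
  case (pCons a p)
  show ?case unfolding radial_poly_pCons using pCons by simp
qed

lemma partial_radial_poly [simp]: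
  "partial i (radial_poly p) = (\<lambda>x. 2 * x $ i * radial_poly (pderiv p) x)"
proof (induction p)
  case 0
  then show ?case by (simp add: radial_poly_def)
next
  case (pCons a p)
  have "i = 1 \<or> i = 2" using exhaust_2 by auto
  moreover have "radial_poly (pderiv (pCons a p)) x =
      radial_poly p x + (x $ 1 * x $ 1 + x $ 2 * x $ 2) * radial_poly (pderiv p) x" for x
    by (simp add: radial_poly_def pderiv_pCons)
  ultimately show ?case unfolding radial_poly_pCons using pCons
    by (auto simp: fun_eq_iff algebra_simps)
qed

definition poly_swirl :: "real poly \<Rightarrow> real^2 \<Rightarrow> real^2" where
  "poly_swirl h x = radial_poly h x *\<^sub>R perp x"

lemma poly_swirl_nth:
  "(\<lambda>x. poly_swirl h x $ 1) = (\<lambda>x. - (x $ 2 * radial_poly h x))"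
  "(\<lambda>x. poly_swirl h x $ 2) = (\<lambda>x. x $ 1 * radial_poly h x)"
  by (auto simp: poly_swirl_def)

text \<open>
  \<open>\<Delta> (h(s) x\<^sup>\<bottom>) = (8 h'(s) + 4 s h''(s)) x\<^sup>\<bottom>\<close> for \<open>s = |x|\<^sup>2\<close>.
\<close>

definition poly_swirl_laplacian :: "real poly \<Rightarrow> real poly" where
  "poly_swirl_laplacian h = smult 8 (pderiv h) + smult 4 (pCons 0 (pderiv (pderiv h)))"

lemma exists_poly_antiderivative: "\<exists>q :: real poly. pderiv q = p"
proof -
  let ?q = "\<lambda>n. \<Sum>i\<le>n. monom (coeff p i / real (Suc i)) (Suc i)"
  have "pderiv (?q n) = (\<Sum>i\<le>n. monom (coeff p i) i)" for n
    by (induction n) (simp_all add: pderiv_add pderiv_monom del: of_nat_Suc)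
  then show ?thesis by (metis poly_as_sum_of_monoms)
qed

text \<open>
  The \<open>\<alpha>\<^sup>2\<close>-part of the weak transport term arises from the strong one by moving one derivative of
  \<open>\<Delta> w\<close> to the test field.  Undoing this, with \<open>L = \<Delta> w\<close>, leaves the divergence of \<open>F\<close> and the strong
  term \<open>(w \<cdot> \<nabla>) L + \<Sum>\<^sub>i L\<^sub>i \<nabla>w\<^sub>i\<close> paired with the test field.  The last term of \<open>F\<close> comes from
  \<open>\<Sum>\<^sub>j\<^sub>k \<partial>\<^sub>k w\<^sub>j \<partial>\<^sub>i \<partial>\<^sub>k w\<^sub>j = \<partial>\<^sub>i |\<nabla>w|\<^sup>2 / 2\<close>.
\<close>

lemma transport_is_divergence:
  fixes w \<phi> :: "2 \<Rightarrow> real^2 \<Rightarrow> real"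
  assumes smooth: "smooth (w 1)" "smooth (w 2)" "smooth (\<phi> 1)" "smooth (\<phi> 2)"
    and symm: "partial 1 (partial 2 (w 1)) x = partial 2 (partial 1 (w 1)) x"
      "partial 1 (partial 2 (w 2)) x = partial 2 (partial 1 (w 2)) x"
    and div: "partial 1 (w 1) x + partial 2 (w 2) x = 0"
      "partial 1 (\<phi> 1) x + partial 2 (\<phi> 2) x = 0"
  defines "L \<equiv> \<lambda>j x. partial 1 (partial 1 (w j)) x + partial 2 (partial 2 (w j)) x"
  defines "E \<equiv> \<lambda>x. partial 1 (w 1) x * partial 1 (w 1) x + partial 2 (w 1) x * partial 2 (w 1) x +
    partial 1 (w 2) x * partial 1 (w 2) x + partial 2 (w 2) x * partial 2 (w 2) x"
  defines "F \<equiv> \<lambda>k x.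
     - (partial k (w 1) x * (w 1 x * partial 1 (\<phi> 1) x + w 2 x * partial 2 (\<phi> 1) x))
     - partial k (w 2) x * (w 1 x * partial 1 (\<phi> 2) x + w 2 x * partial 2 (\<phi> 2) x)
     + w k x * (L 1 x * \<phi> 1 x + L 2 x * \<phi> 2 x)
     + partial k (w 1) x * (partial 1 (w 1) x * \<phi> 1 x + partial 2 (w 1) x * \<phi> 2 x)
     + partial k (w 2) x * (partial 1 (w 2) x * \<phi> 1 x + partial 2 (w 2) x * \<phi> 2 x)
     - 1/2 * E x * \<phi> k x"
  shows "partial 1 (F 1) x + partial 2 (F 2) x =
     (\<Sum>i\<in>UNIV. \<Sum>j\<in>UNIV. \<Sum>k\<in>UNIV. partial k (w j) x *
       (partial i (w j) x * partial k (\<phi> i) x - partial k (w i) x * partial i (\<phi> j) x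
        - w i x * partial k (partial i (\<phi> j)) x)) +
     (w 1 x * partial 1 (L 1) x + w 2 x * partial 2 (L 1) x
       + L 1 x * partial 1 (w 1) x + L 2 x * partial 1 (w 2) x) * \<phi> 1 x +
     (w 1 x * partial 1 (L 2) x + w 2 x * partial 2 (L 2) x
       + L 1 x * partial 2 (w 1) x + L 2 x * partial 2 (w 2) x) * \<phi> 2 x"
proof -
  have d: "partial 2 (w 2) x = - partial 1 (w 1) x" "partial 2 (\<phi> 2) x = - partial 1 (\<phi> 1) x"
    using div by simp_all
  show ?thesis
    using smooth
    unfolding F_def L_def E_def sum_2
    by (simp add: symm d) (simp add: field_simps)
qed

lemma smooth_poly_swirl [simp]:
  "smooth (\<lambda>x. poly_swirl h x $ j)"
  using exhaust_2[of j] by (auto simp: poly_swirl_nth)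

lemma test_field_smooth:
  assumes "test_field \<phi>"
  shows "smooth (\<lambda>x. \<phi> x $ j)"
  using assms by (auto simp: test_field_def smooth_def)

lemma smooth_jac [simp]: "smooth (\<lambda>x. v x $ j) \<Longrightarrow> smooth (jac v j i)"
proof -
  assume "smooth (\<lambda>x. v x $ j)"
  moreover have "jac v j i = partial i (\<lambda>x. v x $ j)" by (auto simp: jac_def)
  ultimately show ?thesis by simp
qed

lemma disc_divergence_zero:
  fixes F :: "2 \<Rightarrow> real^2 \<Rightarrow> real"
  assumes "compact K" "K \<subseteq> disc" "\<And>i x. x \<notin> K \<Longrightarrow> F i x = 0" "\<And>i. smooth (F i)"
  shows "(LINT x:disc|lborel. partial 1 (F 1) x + partial 2 (F 2) x) = 0"
  using integral_divergence_zero[of disc K F] assms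
  by (simp add: sum_2 smooth_continuous)

text \<open>
  For \<open>w = h(s) x\<^sup>\<bottom>\<close> and \<open>\<Delta> w = k(s) x\<^sup>\<bottom>\<close> the strong transport term is the radial field
  \<open>2 s h' (h - \<alpha>\<^sup>2 k) x\<close>.  It is the gradient of \<open>C(s) / 2\<close> with \<open>C' = 2 s h' (h - \<alpha>\<^sup>2 k)\<close>, and
  gradients are annihilated by divergence-free test fields.
\<close>

lemma poly_swirl_transport_zero:
  assumes \<phi>: "test_field \<phi>"
  shows "sg_transport \<alpha> (poly_swirl h) \<phi> = 0"
proof -
  define w where "w j x = poly_swirl h x $ j" for j x
  define p where "p j x = \<phi> x $ j" for j x
  have w12: "w 1 = (\<lambda>x. - (x $ 2 * radial_poly h x))" "w 2 = (\<lambda>x. x $ 1 * radial_poly h x)"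
    by (simp_all add: fun_eq_iff w_def poly_swirl_def)
  have sw: "smooth (w j)" for j unfolding w_def by (rule smooth_poly_swirl)
  have sp: "smooth (p j)" for j unfolding p_def by (rule test_field_smooth[OF \<phi>])
  obtain K where K: "compact K" "K \<subseteq> disc" and \<phi>K: "\<And>x. x \<notin> K \<Longrightarrow> \<phi> x = 0"
    using \<phi> unfolding test_field_def by blast
  have p0: "p j x = 0" if "x \<notin> K" for j x using \<phi>K[OF that] by (simp add: p_def)
  have dp0: "partial i (p j) x = 0" if "x \<notin> K" for i j x
    by (rule partial_zero_off[OF K(1) p0 that])
  have divp: "partial 1 (p 1) x + partial 2 (p 2) x = 0" for x
    using \<phi> by (simp add: test_field_def div2_def jac_def sum_2 p_def[abs_def])
  define k where "k = poly_swirl_laplacian h"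
  define L where "L j x = partial 1 (partial 1 (w j)) x + partial 2 (partial 2 (w j)) x" for j x
  have L12: "L 1 = (\<lambda>x. - (x $ 2 * radial_poly k x))" "L 2 = (\<lambda>x. x $ 1 * radial_poly k x)"
    by (auto simp: L_def fun_eq_iff w12 k_def poly_swirl_laplacian_def algebra_simps)
      (auto simp: radial_poly_def algebra_simps)
  define G where "G = (\<lambda>k x.
     - (partial k (w 1) x * (w 1 x * partial 1 (p 1) x + w 2 x * partial 2 (p 1) x))
     - partial k (w 2) x * (w 1 x * partial 1 (p 2) x + w 2 x * partial 2 (p 2) x)
     + w k x * (L 1 x * p 1 x + L 2 x * p 2 x)
     + partial k (w 1) x * (partial 1 (w 1) x * p 1 x + partial 2 (w 1) x * p 2 x)
     + partial k (w 2) x * (partial 1 (w 2) x * p 1 x + partial 2 (w 2) x * p 2 x)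
     - 1/2 * (partial 1 (w 1) x * partial 1 (w 1) x + partial 2 (w 1) x * partial 2 (w 1) x +
    partial 1 (w 2) x * partial 1 (w 2) x + partial 2 (w 2) x * partial 2 (w 2) x) * p k x)"
  obtain C where C: "pderiv C = smult 2 (pCons 0 (pderiv h * (h - smult (\<alpha>\<^sup>2) k)))"
    using exists_poly_antiderivative by blast
  define F where "F = (\<lambda>k x. \<alpha>\<^sup>2 * G k x + radial_poly C x * p k x / 2)"
  have sL: "smooth (L j)" for j
    unfolding L_def using sw by simp
  have sG: "smooth (G j)" for j
    unfolding G_def using sw sp sL by simp
  have "(LINT x:disc|lborel. partial 1 (F 1) x + partial 2 (F 2) x) = 0"
  proof (rule disc_divergence_zero[OF K])
    show "F i x = 0" if "x \<notin> K" for i x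
      unfolding F_def G_def using p0[OF that] dp0[OF that] by simp
    show "smooth (F i)" for i unfolding F_def using sG sp by simp
  qed
  moreover have "partial 1 (F 1) x + partial 2 (F 2) x = (\<Sum>i\<in>UNIV. \<Sum>j\<in>UNIV.
     w i x * partial i (w j) x * p j x + w j x * partial i (w j) x * p i x +
     \<alpha>\<^sup>2 * (\<Sum>k\<in>UNIV. partial k (w j) x *
       (partial i (w j) x * partial k (p i) x - partial k (w i) x * partial i (p j) x
        - w i x * partial k (partial i (p j)) x)))" for x
  proof -
    define Q1 where "Q1 = w 1 x * partial 1 (L 1) x + w 2 x * partial 2 (L 1) x
       + L 1 x * partial 1 (w 1) x + L 2 x * partial 1 (w 2) x"
    define Q2 where "Q2 = w 1 x * partial 1 (L 2) x + w 2 x * partial 2 (L 2) x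
       + L 1 x * partial 2 (w 1) x + L 2 x * partial 2 (w 2) x"
    define N where "N = x $ 1 * x $ 1 + x $ 2 * x $ 2"
    have G: "partial 1 (G 1) x + partial 2 (G 2) x = (\<Sum>i\<in>UNIV. \<Sum>j\<in>UNIV. \<Sum>k\<in>UNIV. partial k (w j) x *
       (partial i (w j) x * partial k (p i) x - partial k (w i) x * partial i (p j) x
        - w i x * partial k (partial i (p j)) x)) + Q1 * p 1 x + Q2 * p 2 x"
      unfolding G_def L_def Q1_def Q2_def
    proof (rule transport_is_divergence[OF sw sw sp sp _ _ _ divp])
      show "partial 1 (partial 2 (w 1)) x = partial 2 (partial 1 (w 1)) x"
        "partial 1 (partial 2 (w 2)) x = partial 2 (partial 1 (w 2)) x"
        "partial 1 (w 1) x + partial 2 (w 2) x = 0"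
        by (auto simp: w12 algebra_simps)
    qed
    have Q: "Q1 = 2 * N * radial_poly k x * radial_poly (pderiv h) x * x $ 1"
      "Q2 = 2 * N * radial_poly k x * radial_poly (pderiv h) x * x $ 2"
      unfolding Q1_def Q2_def N_def by (simp_all add: L12 w12 algebra_simps)
    have C': "radial_poly (pderiv C) x =
       2 * N * radial_poly (pderiv h) x * (radial_poly h x - \<alpha>\<^sup>2 * radial_poly k x)"
      unfolding C N_def by (simp add: radial_poly_def) (simp add: algebra_simps)
    have "partial 1 (F 1) x + partial 2 (F 2) x = \<alpha>\<^sup>2 * (partial 1 (G 1) x + partial 2 (G 2) x)
        + radial_poly (pderiv C) x * (x $ 1 * p 1 x + x $ 2 * p 2 x)
        + radial_poly C x / 2 * (partial 1 (p 1) x + partial 2 (p 2) x)"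
      unfolding F_def using sG sp by (simp add: field_simps)
    also have "\<dots> = \<alpha>\<^sup>2 * (\<Sum>i\<in>UNIV. \<Sum>j\<in>UNIV. \<Sum>k\<in>UNIV. partial k (w j) x *
       (partial i (w j) x * partial k (p i) x - partial k (w i) x * partial i (p j) x
        - w i x * partial k (partial i (p j)) x)) +
        2 * N * radial_poly (pderiv h) x * radial_poly h x * (x $ 1 * p 1 x + x $ 2 * p 2 x)"
      unfolding G Q C' divp by (simp add: algebra_simps)
    also have "2 * N * radial_poly (pderiv h) x * radial_poly h x * (x $ 1 * p 1 x + x $ 2 * p 2 x)
       = (\<Sum>i\<in>UNIV. \<Sum>j\<in>UNIV. w i x * partial i (w j) x * p j x + w j x * partial i (w j) x * p i x)"
      unfolding sum_2 N_def by (simp add: w12 algebra_simps)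
    finally show ?thesis
      by (simp add: sum.distrib sum_distrib_left)
  qed
  ultimately have "(LINT x:disc|lborel. (\<Sum>i\<in>UNIV. \<Sum>j\<in>UNIV.
     w i x * partial i (w j) x * p j x + w j x * partial i (w j) x * p i x +
     \<alpha>\<^sup>2 * (\<Sum>k\<in>UNIV. partial k (w j) x *
       (partial i (w j) x * partial k (p i) x - partial k (w i) x * partial i (p j) x
        - w i x * partial k (partial i (p j)) x)))) = 0"
    by (simp only:)
  moreover have "jac (poly_swirl h) = (\<lambda>j i. partial i (w j))" "jac \<phi> = (\<lambda>j i. partial i (p j))"
    by (auto simp: fun_eq_iff jac_def w_def[abs_def] p_def[abs_def])
  ultimately show ?thesis
    unfolding sg_transport_def by (simp only: w_def[symmetric] p_def[symmetric])
qed

lemma poly_swirl_gradient_form: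
  assumes \<phi>: "test_field \<phi>"
  shows "gradient_form (poly_swirl h) \<phi> = - mass_form (poly_swirl (poly_swirl_laplacian h)) \<phi>"
proof -
  define w where "w j x = poly_swirl h x $ j" for j x
  define p where "p j x = \<phi> x $ j" for j x
  have w12: "w 1 = (\<lambda>x. - (x $ 2 * radial_poly h x))" "w 2 = (\<lambda>x. x $ 1 * radial_poly h x)"
    by (simp_all add: fun_eq_iff w_def poly_swirl_def)
  have sw: "smooth (w j)" for j unfolding w_def by (rule smooth_poly_swirl)
  have sp: "smooth (p j)" for j unfolding p_def by (rule test_field_smooth[OF \<phi>])
  obtain K where K: "compact K" "K \<subseteq> disc" and \<phi>K: "\<And>x. x \<notin> K \<Longrightarrow> \<phi> x = 0"
    using \<phi> unfolding test_field_def by blast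
  have p0: "p j x = 0" if "x \<notin> K" for j x using \<phi>K[OF that] by (simp add: p_def)
  define F where "F = (\<lambda>i x. partial i (w 1) x * p 1 x + partial i (w 2) x * p 2 x)"
  define A where "A x = (\<Sum>i\<in>UNIV. \<Sum>j\<in>UNIV. partial i (w j) x * partial i (p j) x)" for x
  define B where "B x = poly_swirl (poly_swirl_laplacian h) x \<bullet> \<phi> x" for x
  have sA: "smooth A" unfolding A_def sum_2 using sw sp by simp
  have sB: "smooth B"
    unfolding B_def inner_vec_def sum_2 using test_field_smooth[OF \<phi>] by simp
  have "(LINT x:disc|lborel. partial 1 (F 1) x + partial 2 (F 2) x) = 0"
  proof (rule disc_divergence_zero[OF K])
    show "F i x = 0" if "x \<notin> K" for i x unfolding F_def using p0[OF that] by simp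
    show "smooth (F i)" for i unfolding F_def using sw sp by simp
  qed
  moreover have "partial 1 (F 1) x + partial 2 (F 2) x = A x + B x" for x
  proof -
    have "partial 1 (F 1) x + partial 2 (F 2) x = A x +
       (partial 1 (partial 1 (w 1)) x + partial 2 (partial 2 (w 1)) x) * p 1 x +
       (partial 1 (partial 1 (w 2)) x + partial 2 (partial 2 (w 2)) x) * p 2 x"
      unfolding F_def A_def sum_2 using sw sp by (simp add: algebra_simps)
    also have "partial 1 (partial 1 (w 1)) x + partial 2 (partial 2 (w 1)) x =
        poly_swirl (poly_swirl_laplacian h) x $ 1"
      by (simp add: w12 poly_swirl_def poly_swirl_laplacian_def algebra_simps)
        (simp add: radial_poly_def algebra_simps)
    also have "partial 1 (partial 1 (w 2)) x + partial 2 (partial 2 (w 2)) x =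
        poly_swirl (poly_swirl_laplacian h) x $ 2"
      by (simp add: w12 poly_swirl_def poly_swirl_laplacian_def algebra_simps)
        (simp add: radial_poly_def algebra_simps)
    finally show ?thesis by (simp add: B_def inner_vec_def sum_2 p_def)
  qed
  ultimately have "(LINT x:disc|lborel. A x + B x) = 0" by simp
  moreover have "set_integrable lborel disc f" if "smooth f" for f
  proof (rule set_integrable_subset)
    show "set_integrable lborel (cball 0 1 :: (real^2) set) f"
      unfolding set_integrable_def
      by (intro borel_integrable_compact smooth_continuous that) auto
  qed auto
  ultimately have "(LINT x:disc|lborel. A x) = - (LINT x:disc|lborel. B x)"
    using set_integral_add(2)[of lborel disc A B] sA sB by simp
  moreover have "jac (poly_swirl h) = (\<lambda>j i. partial i (w j))" "jac \<phi> = (\<lambda>j i. partial i (p j))"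
    by (auto simp: fun_eq_iff jac_def w_def[abs_def] p_def[abs_def])
  ultimately show ?thesis
    unfolding gradient_form_def mass_form_def A_def B_def by simp
qed

section \<open>Averages against the Poisson distribution\<close>

definition poisson_mean :: "(nat \<Rightarrow> 'a :: banach) \<Rightarrow> real \<Rightarrow> 'a" where
  "poisson_mean a s = (\<Sum>n. (exp (- s) * s ^ n / fact n) *\<^sub>R a n)"

lemma poisson_weights_sums: "(\<lambda>n. exp (- s) * s ^ n / fact n) sums (1 :: real)"
proof -
  have "(\<lambda>n. exp (- s) * (s ^ n /\<^sub>R fact n)) sums (exp (- s) * exp s)"
    by (intro sums_mult exp_converges)
  then show ?thesis by (simp add: exp_minus_inverse[of "s"] mult.commute[of "exp (- s)" "exp s"] divide_inverse mult_ac)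
qed

lemma poisson_expectation_sums: "(\<lambda>n. exp (- s) * s ^ n / fact n * real n) sums s"
proof -
  have "(\<lambda>n. s * (exp (- s) * s ^ n / fact n)) sums (s * 1)"
    by (intro sums_mult poisson_weights_sums)
  moreover have "s * (exp (- s) * s ^ n / fact n) = exp (- s) * s ^ Suc n / fact (Suc n) * real (Suc n)" for n
    by (simp add: fact_Suc divide_simps del: of_nat_Suc)
  ultimately have "(\<lambda>n. exp (- s) * s ^ Suc n / fact (Suc n) * real (Suc n)) sums s"
    by (simp only: mult_1_right)
  then show ?thesis
    by (subst (asm) sums_Suc_iff) simp
qed

lemma poisson_mean_summable:
  assumes "\<And>n. norm (a n) \<le> C"
  shows "summable (\<lambda>n. norm ((exp (- s) * s ^ n / fact n) *\<^sub>R a n))"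
proof (rule summable_comparison_test)
  have "summable (\<lambda>n. norm (s ^ n /\<^sub>R fact n))" by (rule summable_norm_exp)
  then show "summable (\<lambda>n. exp (- s) * C * norm (s ^ n /\<^sub>R fact n))" by (rule summable_mult)
  show "\<exists>N. \<forall>n\<ge>N. norm (norm ((exp (- s) * s ^ n / fact n) *\<^sub>R a n)) \<le> exp (- s) * C * norm (s ^ n /\<^sub>R fact n)"
  proof (intro exI allI impI)
    fix n
    have "\<bar>exp (- s) * s ^ n / fact n\<bar> * norm (a n) \<le> \<bar>exp (- s) * s ^ n / fact n\<bar> * C"
      by (intro mult_left_mono assms) auto
    then show "norm (norm ((exp (- s) * s ^ n / fact n) *\<^sub>R a n)) \<le> exp (- s) * C * norm (s ^ n /\<^sub>R fact n)"
      by (simp add: abs_mult divide_inverse mult_ac)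
  qed
qed

lemma bounded_linear_poisson_mean:
  assumes "bounded_linear L" "\<And>n. norm (a n) \<le> C"
  shows "L (poisson_mean a s) = poisson_mean (\<lambda>n. L (a n)) s"
proof -
  interpret L: bounded_linear L by fact
  show ?thesis unfolding poisson_mean_def
    by (subst L.suminf[OF summable_norm_cancel[OF poisson_mean_summable]]) (auto simp: L.scaleR intro: assms)
qed

text \<open>
  The weights sum to \<open>1\<close> and have expectation \<open>s\<close>.
\<close>

lemma norm_poisson_mean_diff_le:
  assumes "\<And>n. norm (a n - b) \<le> c + real n * d" "\<And>n. norm (a n) \<le> C" "s \<ge> 0"
  shows "norm (poisson_mean a s - b) \<le> c + s * d"
proof -
  let ?p = "\<lambda>n. exp (- s) * s ^ n / fact n"
  have p: "?p n \<ge> 0" for n using assms(3) by simp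
  have "(\<lambda>n. ?p n *\<^sub>R a n) sums poisson_mean a s"
    unfolding poisson_mean_def
    by (intro summable_sums summable_norm_cancel[OF poisson_mean_summable[OF assms(2)]])
  moreover have "(\<lambda>n. ?p n *\<^sub>R b) sums (1 *\<^sub>R b)"
    by (rule bounded_linear.sums[OF bounded_linear_scaleR_left poisson_weights_sums])
  ultimately have diff: "(\<lambda>n. ?p n *\<^sub>R (a n - b)) sums (poisson_mean a s - b)"
    using sums_diff by (fastforce simp: scaleR_diff_right)
  have ub: "(\<lambda>n. c * ?p n + d * (?p n * real n)) sums (c * 1 + d * s)"
    by (intro sums_add sums_mult poisson_weights_sums poisson_expectation_sums)
  have le: "norm (?p n *\<^sub>R (a n - b)) \<le> c * ?p n + d * (?p n * real n)" for n
  proof -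
    have "norm (?p n *\<^sub>R (a n - b)) = ?p n * norm (a n - b)"
      using p[of n] by (simp only: norm_scaleR abs_of_nonneg)
    also have "\<dots> \<le> ?p n * (c + real n * d)" by (rule mult_left_mono[OF assms(1) p])
    also have "\<dots> = c * ?p n + d * (?p n * real n)" by (simp add: add_divide_distrib distrib_left mult_ac)
    finally show ?thesis .
  qed
  have "norm (\<Sum>n. ?p n *\<^sub>R (a n - b)) \<le> (\<Sum>n. c * ?p n + d * (?p n * real n))"
    by (rule norm_suminf_le[OF le]) (rule sums_summable[OF ub])
  then show ?thesis using sums_unique[OF diff] sums_unique[OF ub] by (simp add: mult.commute)
qed

text \<open>
  The derivative of the weight \<open>p\<^sub>n(s) = e\<^bsup>-s\<^esup> s\<^sup>n / n!\<close> is \<open>p\<^bsub>n-1\<^esub>(s) - p\<^sub>n(s)\<close>, and summation by parts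
  moves the difference to the sequence.
\<close>

lemma poisson_mean_has_derivative:
  fixes b :: "nat \<Rightarrow> real"
  assumes "\<And>n. norm (b n) \<le> C"
  shows "(poisson_mean b has_real_derivative poisson_mean (\<lambda>n. b (Suc n) - b n) s) (at s)"
proof -
  define c where "c n = b n / fact n" for n
  have sm: "summable (\<lambda>n. c n * y ^ n)" for y
  proof -
    have "summable (\<lambda>n. exp y * ((exp (- y) * y ^ n / fact n) *\<^sub>R b n))"
      by (intro summable_mult summable_norm_cancel[OF poisson_mean_summable[OF assms]])
    moreover have "exp y * ((exp (- y) * y ^ n / fact n) *\<^sub>R b n) = c n * y ^ n" for n
      by (simp add: c_def exp_minus field_simps)
    ultimately show ?thesis by simp
  qed
  have pm: "poisson_mean b = (\<lambda>s. exp (- s) * (\<Sum>n. c n * s ^ n))"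
  proof
    fix s
    show "poisson_mean b s = exp (- s) * (\<Sum>n. c n * s ^ n)"
      unfolding poisson_mean_def suminf_mult[OF sm, symmetric] by (simp add: c_def field_simps)
  qed
  have d: "((\<lambda>s. \<Sum>n. c n * s ^ n) has_real_derivative (\<Sum>n. diffs c n * s ^ n)) (at s)"
    by (rule termdiffs_strong_converges_everywhere[OF sm])
  have smd: "summable (\<lambda>n. diffs c n * s ^ n)"
    by (rule termdiff_converges_all[OF sm])
  have dc: "diffs c n = b (Suc n) / fact n" for n
    by (simp add: diffs_def c_def fact_Suc field_simps del: of_nat_Suc)
  have "poisson_mean (\<lambda>n. b (Suc n) - b n) s = (\<Sum>n. exp (- s) * (diffs c n * s ^ n - c n * s ^ n))"
    unfolding poisson_mean_def by (intro suminf_cong) (simp add: dc c_def field_simps)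
  also have "\<dots> = exp (- s) * ((\<Sum>n. diffs c n * s ^ n) - (\<Sum>n. c n * s ^ n))"
    by (simp add: suminf_mult suminf_diff smd sm summable_diff)
  finally have e: "poisson_mean (\<lambda>n. b (Suc n) - b n) s
      = exp (- s) * ((\<Sum>n. diffs c n * s ^ n) - (\<Sum>n. c n * s ^ n))" .
  have "((\<lambda>s. exp (- s) * (\<Sum>n. c n * s ^ n)) has_real_derivative
      exp (- s) * (- 1) * (\<Sum>n. c n * s ^ n) + (\<Sum>n. diffs c n * s ^ n) * exp (- s)) (at s)"
    by (rule DERIV_mult[OF _ d]) (auto intro!: derivative_eq_intros)
  then show ?thesis unfolding pm[symmetric] e by (simp add: algebra_simps)
qed

lemma continuous_on_poisson_mean:
  assumes "\<And>n. norm (a n) \<le> C"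
  shows "continuous_on UNIV (poisson_mean a)"
proof -
  have "continuous_on {-R<..<R} (poisson_mean a)" for R
  proof -
    have "uniform_limit {-R<..<R} (\<lambda>N s. \<Sum>n<N. (exp (- s) * s ^ n / fact n) *\<^sub>R a n) (poisson_mean a) sequentially"
      unfolding poisson_mean_def
    proof (rule Weierstrass_m_test)
      show "summable (\<lambda>n. exp R * C * (R ^ n /\<^sub>R fact n))"
        by (intro summable_mult summable_exp_generic)
      fix n s assume s: "s \<in> {-R<..<R}"
      have C: "C \<ge> 0" using assms[of 0] norm_ge_zero[of "a 0"] by linarith
      have "\<bar>exp (- s) * s ^ n / fact n\<bar> * norm (a n) \<le> (exp R * (R ^ n / fact n)) * C"
      proof (intro mult_mono assms)
        have "\<bar>s\<bar> ^ n \<le> R ^ n" using s by (intro power_mono) auto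
        then have "exp (- s) * (\<bar>s\<bar> ^ n / fact n) \<le> exp R * (R ^ n / fact n)"
          using s by (intro mult_mono divide_right_mono) auto
        then show "\<bar>exp (- s) * s ^ n / fact n\<bar> \<le> exp R * (R ^ n / fact n)"
          by (simp add: abs_mult power_abs)
      qed (use C s in auto)
      then show "norm ((exp (- s) * s ^ n / fact n) *\<^sub>R a n) \<le> exp R * C * (R ^ n /\<^sub>R fact n)"
        by (simp add: divide_inverse mult_ac)
    qed
    then show ?thesis
      by (rule uniform_limit_theorem[rotated])
        (auto intro!: always_eventually continuous_intros)
  qed
  then have "continuous_on (\<Union>R\<in>UNIV. {-R<..<R}) (poisson_mean a)"
    by (intro continuous_on_open_UN) auto
  moreover have "(\<Union>R\<in>UNIV. {-R<..<R::real}) = UNIV"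
  proof -
    have "x \<in> {-(\<bar>x\<bar>+1)<..<\<bar>x\<bar>+1}" for x :: real by auto
    then show ?thesis by blast
  qed
  ultimately show ?thesis by simp
qed

section \<open>The weak forms on swirling fields\<close>

definition bounded_on :: "'z set \<Rightarrow> ('z \<Rightarrow> real) \<Rightarrow> bool" where
  "bounded_on A g \<longleftrightarrow> (\<exists>C. \<forall>z\<in>A. \<bar>g z\<bar> \<le> C)"

lemma bounded_onI: "(\<And>z. z \<in> A \<Longrightarrow> \<bar>g z\<bar> \<le> C) \<Longrightarrow> bounded_on A g"
  by (auto simp: bounded_on_def)

lemma bounded_on_const: "bounded_on A (\<lambda>z. c)"
  by (rule bounded_onI[of _ _ "\<bar>c\<bar>"]) simp

lemma bounded_on_add: "bounded_on A f \<Longrightarrow> bounded_on A g \<Longrightarrow> bounded_on A (\<lambda>z. f z + g z)"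
  unfolding bounded_on_def by (meson abs_triangle_ineq add_mono order_trans)

lemma bounded_on_mult: "bounded_on A f \<Longrightarrow> bounded_on A g \<Longrightarrow> bounded_on A (\<lambda>z. f z * g z)"
proof -
  assume "bounded_on A f" "bounded_on A g"
  then obtain B C where bc: "\<And>z. z \<in> A \<Longrightarrow> \<bar>f z\<bar> \<le> B" "\<And>z. z \<in> A \<Longrightarrow> \<bar>g z\<bar> \<le> C"
    unfolding bounded_on_def by blast
  have "\<bar>f z * g z\<bar> \<le> \<bar>B\<bar> * \<bar>C\<bar>" if "z \<in> A" for z
    unfolding abs_mult using bc[OF that] by (intro mult_mono) auto
  then show ?thesis by (rule bounded_onI)
qed

lemma bounded_on_diff: "bounded_on A f \<Longrightarrow> bounded_on A g \<Longrightarrow> bounded_on A (\<lambda>z. f z - g z)"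
  using bounded_on_add[of A f "\<lambda>z. - 1 * g z"] bounded_on_mult[OF bounded_on_const, of A g "- 1"] by simp

lemma bounded_on_sum: "(\<And>i. i \<in> I \<Longrightarrow> bounded_on A (f i)) \<Longrightarrow> bounded_on A (\<lambda>z. \<Sum>i\<in>I. f i z)"
  by (induction I rule: infinite_finite_induct) (auto intro: bounded_on_const bounded_on_add)

lemmas bounded_on_intros = bounded_on_const bounded_on_add bounded_on_mult bounded_on_diff bounded_on_sum

lemma bounded_on_compact:
  fixes g :: "'z :: topological_space \<Rightarrow> real"
  assumes "compact K" "continuous_on K g" "A \<subseteq> K"
  shows "bounded_on A g"
proof -
  have "bounded (g ` K)" by (intro compact_imp_bounded compact_continuous_image assms)
  then obtain C where "\<forall>z\<in>K. \<bar>g z\<bar> \<le> C" by (auto simp: bounded_iff)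
  then show ?thesis using assms(3) by (intro bounded_onI[of _ _ C]) auto
qed

lemma integrable_indicator_disc: "integrable lborel (\<lambda>x. indicator disc x *\<^sub>R (C :: real))"
proof -
  have "integrable lborel (indicator disc :: real^2 \<Rightarrow> real)"
    by (rule integrable_real_indicator) (use emeasure_bounded_finite[of "disc"] in \<open>auto simp: top.not_eq_extremum infinity_ennreal_def\<close>)
  then show ?thesis by simp
qed

lemma set_integrable_disc:
  assumes "continuous_on disc g" "bounded_on disc g"
  shows "set_integrable lborel disc g"
  unfolding set_integrable_def
proof -
  obtain C where C: "\<And>z. z \<in> disc \<Longrightarrow> \<bar>g z\<bar> \<le> C" using assms(2) unfolding bounded_on_def by blast
  have "set_integrable lborel disc (\<lambda>x :: real^2. C)"
    unfolding set_integrable_def by (rule integrable_indicator_disc)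
  then show "integrable lborel (\<lambda>x. indicator disc x *\<^sub>R g x)"
    unfolding set_integrable_def
  proof (rule Bochner_Integration.integrable_bound)
    show "(\<lambda>x. indicator disc x *\<^sub>R g x) \<in> borel_measurable lborel"
      using borel_measurable_continuous_on_indicator[OF _ assms(1)] by simp
    show "AE x in lborel. norm (indicator disc x *\<^sub>R g x) \<le> norm (indicator disc x *\<^sub>R C)"
      using C by (auto simp: indicator_def intro: order_trans[OF _ abs_ge_self])
  qed
qed

lemma abs_set_integral_disc_le:
  assumes "continuous_on disc g" "\<And>x. x \<in> disc \<Longrightarrow> \<bar>g x\<bar> \<le> C"
  shows "\<bar>LINT x:disc|lborel. g x\<bar> \<le> C * measure lborel (disc)"
proof -
  have "norm (LINT x:disc|lborel. g x) \<le> (LINT x:disc|lborel. norm (g x))"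
    by (rule set_integral_norm_bound) (intro set_integrable_disc bounded_onI[of _ _ C] assms)
  also have "\<dots> \<le> (LINT x:disc|lborel. C)"
    by (rule set_integral_mono)
      (use assms in \<open>auto intro!: set_integrable_disc bounded_onI[of _ _ C] continuous_intros bounded_on_const\<close>)
  also have "\<dots> = C * measure lborel (disc)"
    by (simp add: set_lebesgue_integral_def)
  finally show ?thesis by simp
qed

lemma tendsto_set_integral_disc:
  assumes "\<And>n. continuous_on disc (g n)" "bounded_on (UNIV \<times> disc) (\<lambda>(n, x). g n x)"
    and "\<And>x. x \<in> disc \<Longrightarrow> (\<lambda>n. g n x) \<longlonglongrightarrow> h x"
  shows "(\<lambda>n. LINT x:disc|lborel. g n x) \<longlonglongrightarrow> (LINT x:disc|lborel. h x)"
proof -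
  obtain C where C: "\<And>n z. z \<in> disc \<Longrightarrow> \<bar>g n z\<bar> \<le> C" using assms(2) unfolding bounded_on_def by fastforce
  have meas: "(\<lambda>x. indicator disc x *\<^sub>R g n x) \<in> borel_measurable lborel" for n
    using borel_measurable_continuous_on_indicator[OF _ assms(1)] by simp
  have lim: "(\<lambda>n. indicator disc x *\<^sub>R g n x) \<longlonglongrightarrow> indicator disc x *\<^sub>R h x" for x
    using assms(3)[of x] by (cases "x \<in> disc") auto
  show ?thesis unfolding set_lebesgue_integral_def
  proof (rule integral_dominated_convergence[where w = "\<lambda>x. indicator disc x *\<^sub>R C"])
    show "(\<lambda>x. indicator disc x *\<^sub>R h x) \<in> borel_measurable lborel"
      by (rule borel_measurable_LIMSEQ_real[OF lim meas])
    show "integrable lborel (\<lambda>x :: real^2. indicator disc x *\<^sub>R C)"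
      by (rule integrable_indicator_disc)
    show "AE x in lborel. norm (indicator disc x *\<^sub>R g n x) \<le> indicator disc x *\<^sub>R C" for n
      using C by (auto simp: indicator_def)
  qed (use meas lim in auto)
qed

text \<open>
  The weak forms are sums of such integrals.  As bounded functionals of the profile they commute with
  the series for the vorticity.
\<close>

lemma bounded_linear_disc_integral:
  fixes K :: "profile \<Rightarrow> real^2 \<Rightarrow> real"
  assumes lin: "\<And>f g x. K (f + g) x = K f x + K g x" "\<And>c f x. K (c *\<^sub>R f) x = c * K f x"
    and le: "\<And>f x. x \<in> disc \<Longrightarrow> \<bar>K f x\<bar> \<le> M * norm f"
    and cont: "\<And>f. continuous_on disc (K f)"
    and \<psi>: "continuous_on disc \<psi>" "bounded_on disc \<psi>"
  shows "bounded_linear (\<lambda>f. LINT x:disc|lborel. K f x * \<psi> x)"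
proof -
  obtain B where B: "\<And>x. x \<in> disc \<Longrightarrow> \<bar>\<psi> x\<bar> \<le> B" using \<psi>(2) unfolding bounded_on_def by blast
  have c: "continuous_on disc (\<lambda>x. K f x * \<psi> x)" for f by (intro continuous_intros cont \<psi>)
  have b: "\<bar>K f x * \<psi> x\<bar> \<le> M * norm f * B" if "x \<in> disc" for f x
    unfolding abs_mult using le[OF that, of f] B[OF that] by (intro mult_mono) auto
  have i: "set_integrable lborel disc (\<lambda>x. K f x * \<psi> x)" for f
    by (intro set_integrable_disc c bounded_onI[OF b])
  show ?thesis
  proof (rule bounded_linear_intro)
    show "(LINT x:disc|lborel. K (f + g) x * \<psi> x) = (LINT x:disc|lborel. K f x * \<psi> x) + (LINT x:disc|lborel. K g x * \<psi> x)" for f g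
      unfolding lin distrib_right by (rule set_integral_add(2)[OF i i])
    show "(LINT x:disc|lborel. K (c *\<^sub>R f) x * \<psi> x) = c *\<^sub>R (LINT x:disc|lborel. K f x * \<psi> x)" for c f
      unfolding lin by (simp add: mult.assoc)
    show "norm (LINT x:disc|lborel. K f x * \<psi> x) \<le> norm f * (M * B * measure lborel disc)" for f
      using abs_set_integral_disc_le[OF c b, of f] by (simp add: mult_ac)
  qed
qed

lemma test_field_bounds:
  assumes "test_field \<phi>"
  shows "continuous_on A (\<lambda>x. \<phi> x $ j)" "continuous_on A (jac \<phi> j i)" "continuous_on A (partial k (jac \<phi> j i))"
    "bounded_on disc (\<lambda>x. \<phi> x $ j)" "bounded_on disc (jac \<phi> j i)" "bounded_on disc (partial k (jac \<phi> j i))"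
proof -
  have s: "smooth (\<lambda>x. \<phi> x $ j)" "smooth (jac \<phi> j i)" "smooth (partial k (jac \<phi> j i))"
    using test_field_smooth[OF assms] by auto
  then show "continuous_on A (\<lambda>x. \<phi> x $ j)" "continuous_on A (jac \<phi> j i)" "continuous_on A (partial k (jac \<phi> j i))"
    by (auto intro: smooth_continuous)
  show "bounded_on disc (\<lambda>x. \<phi> x $ j)" "bounded_on disc (jac \<phi> j i)" "bounded_on disc (partial k (jac \<phi> j i))"
    using s by (auto intro!: bounded_on_compact[of "cball 0 1"] smooth_continuous)
qed

lemma continuous_on_swirl_jac_x: "continuous_on A (\<lambda>x. swirl_jac f j i x)"
  by (rule continuous_on_swirl_jac) (auto intro: continuous_intros)

lemma continuous_on_swirl_x: "continuous_on A (\<lambda>x. swirl f x)"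
  by (rule continuous_on_swirl) (auto intro: continuous_intros)

lemma swirl_nth_le: "x \<in> disc \<Longrightarrow> \<bar>swirl f x $ j\<bar> \<le> 1 * norm f"
proof -
  assume "x \<in> disc"
  then have "norm f / 2 * norm x \<le> norm f * 1" by (intro mult_mono) auto
  then show ?thesis using norm_swirl_le[of f x] component_le_norm_cart[of "swirl f x" j] by simp
qed

lemma gradient_form_swirl:
  "gradient_form (swirl f) \<phi> = (LINT x:disc|lborel. \<Sum>i\<in>UNIV. \<Sum>j\<in>UNIV. swirl_jac f j i x * jac \<phi> j i x)"
  unfolding gradient_form_def
  by (rule set_lebesgue_integral_cong) (auto simp: jac_swirl)

lemma bounded_linear_gradient_form:
  assumes "test_field \<phi>"
  shows "bounded_linear (\<lambda>f. gradient_form (swirl f) \<phi>)"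
proof -
  note tb = test_field_bounds[OF assms]
  have i: "set_integrable lborel disc (\<lambda>x. swirl_jac f j i x * jac \<phi> j i x)" for f i j
    by (intro set_integrable_disc continuous_intros continuous_on_swirl_jac_x tb bounded_on_intros
        bounded_onI[OF swirl_jac_le])
  have "gradient_form (swirl f) \<phi> = (\<Sum>i\<in>UNIV. \<Sum>j\<in>UNIV. LINT x:disc|lborel. swirl_jac f j i x * jac \<phi> j i x)" for f
    unfolding gradient_form_swirl sum_2
    by (simp add: set_integral_add i)
  moreover have "bounded_linear (\<lambda>f. \<Sum>i\<in>UNIV. \<Sum>j\<in>UNIV. LINT x:disc|lborel. swirl_jac f j i x * jac \<phi> j i x)"
    by (intro bounded_linear_sum bounded_linear_disc_integral[where M = 3] swirl_linear swirl_jac_le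
         continuous_on_swirl_jac_x tb)
  ultimately show ?thesis by simp
qed

lemma bounded_linear_mass_form:
  assumes "test_field \<phi>"
  shows "bounded_linear (\<lambda>f. mass_form (swirl f) \<phi>)"
proof -
  note tb = test_field_bounds[OF assms]
  have i: "set_integrable lborel disc (\<lambda>x. swirl f x $ j * \<phi> x $ j)" for f j
    by (intro set_integrable_disc continuous_intros continuous_on_swirl_x tb bounded_on_intros
        bounded_onI[OF swirl_nth_le])
  have "mass_form (swirl f) \<phi> = (\<Sum>j\<in>UNIV. LINT x:disc|lborel. swirl f x $ j * \<phi> x $ j)" for f
    unfolding mass_form_def inner_vec_def sum_2
    by (simp add: set_integral_add i)
  moreover have "bounded_linear (\<lambda>f. \<Sum>j\<in>UNIV. LINT x:disc|lborel. swirl f x $ j * \<phi> x $ j)"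
    by (intro bounded_linear_sum bounded_linear_disc_integral[where M = 1] swirl_nth_le tb
         continuous_intros continuous_on_swirl_x) (auto simp: swirl_linear)
  ultimately show ?thesis by simp
qed

lemma forms_cong:
  assumes "\<And>x. x \<in> disc \<Longrightarrow> v x = w x"
  shows "mass_form v \<phi> = mass_form w \<phi>" "gradient_form v \<phi> = gradient_form w \<phi>"
    "sg_transport \<alpha> v \<phi> = sg_transport \<alpha> w \<phi>"
proof -
  have j: "jac v j i x = jac w j i x" if "x \<in> disc" for j i x
    unfolding jac_def by (rule partial_cong_open[of disc]) (use assms that in auto)
  show "mass_form v \<phi> = mass_form w \<phi>" "gradient_form v \<phi> = gradient_form w \<phi>"
    "sg_transport \<alpha> v \<phi> = sg_transport \<alpha> w \<phi>"
    unfolding mass_form_def gradient_form_def sg_transport_def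
    by (rule set_lebesgue_integral_cong; simp add: assms j)+
qed

definition even_monomial :: "nat \<Rightarrow> profile" where
  "even_monomial i = profile_of (\<lambda>r. r ^ (2 * i))"

lemma even_monomial_apply: "even_monomial i r = unit_clamp r ^ (2 * i)"
  unfolding even_monomial_def by (rule apply_profile_of) (intro continuous_intros)

lemma radial_average_even_monomial:
  "radial_average (even_monomial i) = (1 / (2 * real i + 2)) *\<^sub>R even_monomial i"
proof (rule bcontfun_eqI)
  fix r
  have e: "\<theta> * even_monomial i (unit_clamp r * \<theta>) = unit_clamp r ^ (2 * i) * (\<theta> * \<theta> ^ (2 * i))"
    if "\<theta> \<in> {0..1}" for \<theta>
    using that by (simp add: even_monomial_apply power_mult_distrib mult_le_one)
  have "radial_average (even_monomial i) r = integral {0..1} (\<lambda>\<theta>. unit_clamp r ^ (2 * i) * (\<theta> * \<theta> ^ (2 * i)))"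
    unfolding radial_average_apply using e by (intro Henstock_Kurzweil_Integration.integral_cong) auto
  also have "\<dots> = unit_clamp r ^ (2 * i) * (1 / (real (2 * i) + 2))"
    by (intro integral_unique has_integral_mult_right theta_power_integral)
  finally show "radial_average (even_monomial i) r = ((1 / (2 * real i + 2)) *\<^sub>R even_monomial i) r"
    by (simp add: even_monomial_apply)
qed

lemma radial_inverse_laplacian_even_monomial:
  "radial_inverse_laplacian (even_monomial i) = (1 / (2 * real i + 2)\<^sup>2) *\<^sub>R even_monomial (Suc i)"
proof (rule bcontfun_eqI)
  interpret bounded_linear radial_average by (rule bounded_linear_radial_average)
  fix r
  show "radial_inverse_laplacian (even_monomial i) r = ((1 / (2 * real i + 2)\<^sup>2) *\<^sub>R even_monomial (Suc i)) r"
    by (simp add: radial_inverse_laplacian_apply radial_average_even_monomial scaleR even_monomial_apply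
        power2_eq_square algebra_simps)
qed

lemma even_polynomial_approximation:
  assumes "\<epsilon> > 0"
  obtains a n where "\<And>r. 0 \<le> r \<Longrightarrow> r \<le> 1 \<Longrightarrow>
    \<bar>apply_bcontfun f r - (\<Sum>i\<le>n. a i *\<^sub>R even_monomial i) r\<bar> < \<epsilon>"
proof -
  have "continuous_on {0..1} (\<lambda>s. f (sqrt s))" by (intro continuous_intros)
  then obtain g where g: "real_polynomial_function g" "\<And>s. s \<in> {0..1} \<Longrightarrow> \<bar>f (sqrt s) - g s\<bar> < \<epsilon>"
    using Stone_Weierstrass_real_polynomial_function[of "{0..1::real}" "\<lambda>s. f (sqrt s)" \<epsilon>] assms by blast
  from g(1) obtain a n where gs: "g = (\<lambda>x. \<Sum>i\<le>n. a i * x ^ i)"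
    using real_polynomial_function_iff_sum by blast
  have ap: "(\<Sum>i\<in>I. a i *\<^sub>R even_monomial i) r = (\<Sum>i\<in>I. a i * even_monomial i r)" if "finite I" for I r
    using that by (induction I rule: finite_induct) auto
  have "\<bar>f r - (\<Sum>i\<le>n. a i *\<^sub>R even_monomial i) r\<bar> < \<epsilon>" if "0 \<le> r" "r \<le> 1" for r
  proof -
    have "r\<^sup>2 \<in> {0..1}" using that by (simp add: power_le_one)
    from g(2)[OF this] show ?thesis
      using that by (simp add: gs ap even_monomial_apply power_mult)
  qed
  then show ?thesis by (rule that)
qed

lemma profile_of_clamp: "profile_of (apply_bcontfun f) r = f (unit_clamp r)"
  by (rule apply_profile_of) (intro continuous_intros)

text \<open>
  The Weierstrass theorem for \<open>s \<mapsto> f(\<surd>s)\<close>.  Even powers of \<open>r\<close> give swirls that are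
  polynomial, hence smooth, across the centre.
\<close>

lemma even_polynomials_converge:
  obtains a :: "nat \<Rightarrow> nat \<Rightarrow> real" and N :: "nat \<Rightarrow> nat"
  where "(\<lambda>n. \<Sum>i\<le>N n. a n i *\<^sub>R even_monomial i) \<longlonglongrightarrow> profile_of (apply_bcontfun f)"
proof -
  have "\<exists>a N. norm ((\<Sum>i\<le>N. a i *\<^sub>R even_monomial i) - profile_of (apply_bcontfun f)) \<le> 1 / real (Suc n)" for n
  proof -
    obtain a N where aN: "\<And>r. 0 \<le> r \<Longrightarrow> r \<le> 1 \<Longrightarrow>
      \<bar>apply_bcontfun f r - (\<Sum>i\<le>N. a i *\<^sub>R even_monomial i) r\<bar> < 1 / real (Suc n)"
      using even_polynomial_approximation[of "1 / real (Suc n)" f] by auto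
    have ap: "(\<Sum>i\<in>I. a i *\<^sub>R even_monomial i) r = (\<Sum>i\<in>I. a i *\<^sub>R even_monomial i) (unit_clamp r)" if "finite I" for I r
      using that by (induction I rule: finite_induct) (auto simp: even_monomial_apply)
    have "norm ((\<Sum>i\<le>N. a i *\<^sub>R even_monomial i) - profile_of (apply_bcontfun f)) \<le> 1 / real (Suc n)"
    proof (rule norm_bound)
      fix r
      show "norm (((\<Sum>i\<le>N. a i *\<^sub>R even_monomial i) - profile_of (apply_bcontfun f)) r) \<le> 1 / real (Suc n)"
        using aN[of "unit_clamp r"] ap[of "{..N}" r] by (simp add: profile_of_clamp abs_minus_commute)
    qed
    then show ?thesis by blast
  qed
  then obtain a N where aN: "\<And>n. norm ((\<Sum>i\<le>N n. a n i *\<^sub>R even_monomial i) - profile_of (apply_bcontfun f)) \<le> 1 / real (Suc n)"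
    by metis
  have "(\<lambda>n. (\<Sum>i\<le>N n. a n i *\<^sub>R even_monomial i) - profile_of (apply_bcontfun f)) \<longlonglongrightarrow> 0"
    by (rule Lim_null_comparison[OF always_eventually LIMSEQ_Suc[OF lim_1_over_n]]) (use aN in auto)
  then show ?thesis using that LIM_zero_iff by blast
qed

lemma swirl_even_monomial:
  assumes "x \<in> disc"
  shows "swirl (even_monomial i) x = poly_swirl (monom (1 / (2 * real i + 2)) i) x"
proof -
  have "x $ 1 * x $ 1 + x $ 2 * x $ 2 = (norm x)\<^sup>2" using norm_sq_2[of x] by (simp only: power2_eq_square)
  then show ?thesis
    using assms
    by (simp add: swirl_def poly_swirl_def radial_average_even_monomial even_monomial_apply
       radial_poly_def poly_monom power_mult[symmetric])
qed

lemma swirl_polynomial: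
  assumes "x \<in> disc"
  shows "swirl (\<Sum>i\<le>n. a i *\<^sub>R even_monomial i) x = poly_swirl (\<Sum>i\<le>n. monom (a i / (2 * real i + 2)) i) x"
proof (induction n)
  case 0
  show ?case using swirl_even_monomial[OF assms, of 0]
    by (simp add: swirl_linear poly_swirl_def radial_poly_def poly_monom)
next
  case (Suc n)
  then show ?case using swirl_even_monomial[OF assms, of "Suc n"]
    by (simp add: swirl_linear poly_swirl_def radial_poly_def poly_monom scaleR_add_left)
qed

lemma forms_profile_of_clamp:
  "mass_form (swirl (profile_of (apply_bcontfun f))) \<phi> = mass_form (swirl f) \<phi>"
  "gradient_form (swirl (profile_of (apply_bcontfun f))) \<phi> = gradient_form (swirl f) \<phi>"
  "sg_transport \<alpha> (swirl (profile_of (apply_bcontfun f))) \<phi> = sg_transport \<alpha> (swirl f) \<phi>"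
  "radial_inverse_laplacian (profile_of (apply_bcontfun f)) = radial_inverse_laplacian f"
proof -
  have "radial_average (profile_of (apply_bcontfun f)) = radial_average f"
    by (rule radial_average_cong) (simp add: profile_of_clamp)
  then have "swirl (profile_of (apply_bcontfun f)) = swirl f"
    and S: "radial_inverse_laplacian (profile_of (apply_bcontfun f)) = radial_inverse_laplacian f"
    by (simp_all add: swirl_def[abs_def] radial_inverse_laplacian_def)
  then show "mass_form (swirl (profile_of (apply_bcontfun f))) \<phi> = mass_form (swirl f) \<phi>"
    "gradient_form (swirl (profile_of (apply_bcontfun f))) \<phi> = gradient_form (swirl f) \<phi>"
    "sg_transport \<alpha> (swirl (profile_of (apply_bcontfun f))) \<phi> = sg_transport \<alpha> (swirl f) \<phi>"
    by simp_all
  show "radial_inverse_laplacian (profile_of (apply_bcontfun f)) = radial_inverse_laplacian f"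
    by (fact S)
qed

text \<open>
  The swirl with vorticity \<open>S f\<close>, where \<open>\<Delta> S f = f\<close>, has as its Laplacian the swirl with vorticity
  \<open>f\<close>, so this is integration by parts.  Both sides are bounded functionals of \<open>f\<close>, so that even
  powers suffice.
\<close>

lemma gradient_form_inverse_laplacian:
  assumes \<phi>: "test_field \<phi>"
  shows "gradient_form (swirl (radial_inverse_laplacian f)) \<phi> = - mass_form (swirl f) \<phi>"
proof -
  interpret m: bounded_linear "\<lambda>f. mass_form (swirl f) \<phi>" by (rule bounded_linear_mass_form[OF \<phi>])
  interpret d: bounded_linear "\<lambda>f. gradient_form (swirl f) \<phi>" by (rule bounded_linear_gradient_form[OF \<phi>])
  interpret S: bounded_linear radial_inverse_laplacian by (rule bounded_linear_radial_inverse_laplacian)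
  define L where "L f = gradient_form (swirl (radial_inverse_laplacian f)) \<phi> + mass_form (swirl f) \<phi>" for f
  have L: "bounded_linear L" unfolding L_def
    by (intro bounded_linear_add m.bounded_linear_axioms
       bounded_linear_compose[OF d.bounded_linear_axioms S.bounded_linear_axioms])
  interpret L: bounded_linear L by (fact L)
  have L0: "L (even_monomial i) = 0" for i
  proof -
    \<comment> \<open>\<open>S r\<^bsup>2 i\<^esup> = c r\<^bsup>2 i + 2\<^esup>\<close>, and the swirl with this vorticity is \<open>c s\<^bsup>i + 1\<^esup> / (2 i + 4) x\<^sup>\<bottom>\<close> with \<open>s = |x|\<^sup>2\<close>.\<close>
    define c where "c = 1 / (2 * real i + 2)\<^sup>2"
    have k: "poly_swirl_laplacian (monom (c / (2 * real (Suc i) + 2)) (Suc i)) = monom (1 / (2 * real i + 2)) i"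
    proof -
      have "8 * (real (Suc i) * (c / (2 * real (Suc i) + 2))) +
          4 * (real i * (real (Suc i) * (c / (2 * real (Suc i) + 2)))) = 1 / (2 * real i + 2)"
      proof -
        define y where "y = real i + 1"
        have y: "y > 0" "real i = y - 1" by (auto simp: y_def)
        show ?thesis using y(1) unfolding c_def of_nat_Suc y(2)
          by (simp add: divide_simps power2_eq_square)
      qed
      then show ?thesis
        by (cases i) (simp_all add: poly_swirl_laplacian_def pderiv_monom smult_monom
          add_monom monom_Suc[symmetric] algebra_simps del: of_nat_Suc)
    qed
    have "gradient_form (swirl (radial_inverse_laplacian (even_monomial i))) \<phi> =
       gradient_form (poly_swirl (monom (c / (2 * real (Suc i) + 2)) (Suc i))) \<phi>"
    proof (rule forms_cong)
      fix x assume x: "x \<in> disc"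
      show "swirl (radial_inverse_laplacian (even_monomial i)) x = poly_swirl (monom (c / (2 * real (Suc i) + 2)) (Suc i)) x"
        unfolding radial_inverse_laplacian_even_monomial swirl_linear swirl_even_monomial[OF x]
        by (simp add: poly_swirl_def radial_poly_def poly_monom c_def del: of_nat_Suc)
    qed
    also have "\<dots> = - mass_form (poly_swirl (monom (1 / (2 * real i + 2)) i)) \<phi>"
      unfolding poly_swirl_gradient_form[OF \<phi>] k ..
    also have "mass_form (poly_swirl (monom (1 / (2 * real i + 2)) i)) \<phi> = mass_form (swirl (even_monomial i)) \<phi>"
      by (rule forms_cong) (simp add: swirl_even_monomial)
    finally show ?thesis by (simp add: L_def)
  qed
  obtain a N where aN: "(\<lambda>n. \<Sum>i\<le>N n. a n i *\<^sub>R even_monomial i) \<longlonglongrightarrow> profile_of (apply_bcontfun f)"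
    using even_polynomials_converge .
  have "(\<lambda>n. L (\<Sum>i\<le>N n. a n i *\<^sub>R even_monomial i)) \<longlonglongrightarrow> L (profile_of (apply_bcontfun f))"
    by (rule L.tendsto[OF aN])
  then have "L (profile_of (apply_bcontfun f)) = 0"
    by (simp add: L.sum L.scaleR L0 LIMSEQ_const_iff)
  then show ?thesis by (simp add: L_def forms_profile_of_clamp)
qed

lemma gradient_form_const:
  assumes \<phi>: "test_field \<phi>"
  shows "gradient_form (swirl (const_profile c)) \<phi> = 0"
proof -
  interpret d: bounded_linear "\<lambda>f. gradient_form (swirl f) \<phi>" by (rule bounded_linear_gradient_form[OF \<phi>])
  have "const_profile c = c *\<^sub>R even_monomial 0"
    by (rule bcontfun_eqI) (simp add: const_bcontfun.rep_eq even_monomial_apply)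
  moreover have "gradient_form (swirl (even_monomial 0)) \<phi> = gradient_form (poly_swirl (monom (1 / 2) 0)) \<phi>"
    by (rule forms_cong) (simp add: swirl_even_monomial)
  moreover have "\<dots> = 0"
    unfolding poly_swirl_gradient_form[OF \<phi>]
    by (simp add: poly_swirl_laplacian_def pderiv_monom mass_form_def poly_swirl_def radial_poly_def)
  ultimately show ?thesis by (simp add: d.scaleR)
qed

text \<open>
  The form contains only first derivatives of the velocity, so it is continuous along uniformly
  convergent vorticities, and it vanishes on polynomial swirls.
\<close>

lemma sg_transport_swirl:
  assumes \<phi>: "test_field \<phi>"
  shows "sg_transport \<alpha> (swirl f) \<phi> = 0"
proof -
  note tb = test_field_bounds[OF \<phi>]
  obtain a N where aN: "(\<lambda>n. \<Sum>i\<le>N n. a n i *\<^sub>R even_monomial i) \<longlonglongrightarrow> profile_of (apply_bcontfun f)"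
    using even_polynomials_converge .
  define g where "g = profile_of (apply_bcontfun f)"
  define p where "p n = (\<Sum>i\<le>N n. a n i *\<^sub>R even_monomial i)" for n
  have pg: "p \<longlonglongrightarrow> g" using aN by (simp add: p_def[abs_def] g_def)
  define I where "I q x = (\<Sum>i\<in>UNIV. \<Sum>j\<in>UNIV.
     swirl q x $ i * swirl_jac q j i x * \<phi> x $ j + swirl q x $ j * swirl_jac q j i x * \<phi> x $ i +
     \<alpha>\<^sup>2 * (\<Sum>k\<in>UNIV. swirl_jac q j k x *
       (swirl_jac q j i x * jac \<phi> i k x - swirl_jac q i k x * jac \<phi> j i x
        - swirl q x $ i * partial k (jac \<phi> j i) x)))" for q x
  have T: "sg_transport \<alpha> (swirl q) \<phi> = (LINT x:disc|lborel. I q x)" for q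
    unfolding sg_transport_def I_def by (rule set_lebesgue_integral_cong) (auto simp: jac_swirl)
  have "sg_transport \<alpha> (swirl (p n)) \<phi> = 0" for n
  proof -
    have "sg_transport \<alpha> (swirl (p n)) \<phi> = sg_transport \<alpha> (poly_swirl (\<Sum>i\<le>N n. monom (a n i / (2 * real i + 2)) i)) \<phi>"
      by (rule forms_cong) (simp add: p_def swirl_polynomial)
    then show ?thesis using poly_swirl_transport_zero[OF \<phi>] by simp
  qed
  moreover have "(\<lambda>n. LINT x:disc|lborel. I (p n) x) \<longlonglongrightarrow> (LINT x:disc|lborel. I g x)"
  proof (rule tendsto_set_integral_disc)
    show "continuous_on disc (I (p n))" for n
      unfolding I_def
      by (intro continuous_intros continuous_on_swirl_jac_x continuous_on_swirl_x tb)
    obtain M where M: "\<And>n. norm (p n) \<le> M"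
      using convergent_imp_Bseq[OF convergentI[OF pg]] by (auto simp: Bseq_def)
    have bj: "bounded_on (UNIV \<times> disc) (\<lambda>z. swirl_jac (p (fst z)) j i (snd z))" for j i
    proof (rule bounded_onI)
      show "\<bar>swirl_jac (p (fst z)) j i (snd z)\<bar> \<le> 3 * M" for z
        using swirl_jac_le[of "p (fst z)" j i "snd z"] M[of "fst z"] by linarith
    qed
    have bs: "bounded_on (UNIV \<times> disc) (\<lambda>z. swirl (p (fst z)) (snd z) $ j)" for j
    proof (rule bounded_onI)
      show "\<bar>swirl (p (fst z)) (snd z) $ j\<bar> \<le> M" if "z \<in> UNIV \<times> disc" for z
        using swirl_nth_le[of "snd z" "p (fst z)" j] M[of "fst z"] that by (auto simp: mem_Times_iff)
    qed
    have bx: "bounded_on (UNIV \<times> disc) (\<lambda>z. \<psi> (snd z))" if "bounded_on disc \<psi>" for \<psi>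
      using that unfolding bounded_on_def by auto
    have "bounded_on (UNIV \<times> disc) (\<lambda>z. I (p (fst z)) (snd z))"
      unfolding I_def
      by (intro bounded_on_intros bj bs bx tb)
    then show "bounded_on (UNIV \<times> disc) (\<lambda>(n, x). I (p n) x)" by (simp add: bounded_on_def)
    have ls: "(\<lambda>n. swirl (p n) x) \<longlonglongrightarrow> swirl g x" for x
    proof -
      have "continuous_on UNIV (\<lambda>q. swirl q x)"
        by (rule continuous_on_swirl) (auto intro: continuous_intros)
      then show ?thesis using pg by (rule continuous_on_tendsto_compose) auto
    qed
    have lj: "(\<lambda>n. swirl_jac (p n) j i x) \<longlonglongrightarrow> swirl_jac g j i x" for i j x
    proof -
      have "continuous_on UNIV (\<lambda>q. swirl_jac q j i x)"
        by (rule continuous_on_swirl_jac) (auto intro: continuous_intros)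
      then show ?thesis using pg by (rule continuous_on_tendsto_compose) auto
    qed
    show "(\<lambda>n. I (p n) x) \<longlonglongrightarrow> I g x" for x
      unfolding I_def by (intro tendsto_intros ls lj)
  qed
  ultimately have "sg_transport \<alpha> (swirl g) \<phi> = 0" by (simp add: T[symmetric] LIMSEQ_const_iff)
  then show ?thesis by (simp add: g_def forms_profile_of_clamp)
qed

section \<open>The circularly symmetric second-grade flow\<close>

definition neumann_resolvent :: "real \<Rightarrow> profile \<Rightarrow> profile" where
  "neumann_resolvent \<alpha> f = (SOME w. neumann_resolvent_of \<alpha> f w)"

definition clamped :: "profile \<Rightarrow> bool" where
  "clamped f \<longleftrightarrow> (\<forall>r. f r = f (unit_clamp r))"

lemma neumann_resolvent_of_clamped:
  assumes "neumann_resolvent_of \<alpha> f w"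
  shows "clamped w"
proof -
  from assms obtain c where "w = const_profile c + (1 / \<alpha>\<^sup>2) *\<^sub>R radial_inverse_laplacian (w - f)"
    by (auto simp: neumann_resolvent_of_def)
  then have "w r = c + (1 / \<alpha>\<^sup>2) * radial_inverse_laplacian (w - f) r" for r
    by (metis const_bcontfun.rep_eq plus_bcontfun.rep_eq real_scaleR_def scaleR_bcontfun.rep_eq)
  moreover have "radial_inverse_laplacian (w - f) (unit_clamp r) = radial_inverse_laplacian (w - f) r" for r
    by (simp add: radial_inverse_laplacian_apply)
  ultimately show ?thesis unfolding clamped_def by metis
qed

text \<open>
  Resolvents exist for clamped profiles and are clamped themselves, so every step of the iteration
  is covered by the existence lemma.
\<close>

lemma neumann_iterates:
  assumes "\<alpha> > 0" "clamped f"
  shows "clamped ((neumann_resolvent \<alpha> ^^ n) f)"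
    and "neumann_resolvent_of \<alpha> ((neumann_resolvent \<alpha> ^^ n) f) ((neumann_resolvent \<alpha> ^^ Suc n) f)"
proof -
  have step: "neumann_resolvent_of \<alpha> g (neumann_resolvent \<alpha> g)" if "clamped g" for g
    unfolding neumann_resolvent_def
    by (rule someI_ex[OF neumann_resolvent_exists]) (use that assms(1) in \<open>auto simp: clamped_def\<close>)
  show c: "clamped ((neumann_resolvent \<alpha> ^^ n) f)" for n
    by (induction n) (auto simp: assms intro: neumann_resolvent_of_clamped[OF step])
  show "neumann_resolvent_of \<alpha> ((neumann_resolvent \<alpha> ^^ n) f) ((neumann_resolvent \<alpha> ^^ Suc n) f)"
    using step[OF c] by simp
qed

lemma neumann_resolvent_of_0: "neumann_resolvent_of \<alpha> 0 0"
proof -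
  have "radial_inverse_laplacian 0 = 0" "radial_average 0 = 0"
    using bounded_linear.linear[OF bounded_linear_radial_inverse_laplacian] linear_0
      bounded_linear.linear[OF bounded_linear_radial_average] by blast+
  moreover have "const_profile 0 = 0" by simp
  ultimately show ?thesis unfolding neumann_resolvent_of_def by (auto intro!: exI[of _ 0])
qed

lemma norm_neumann_iterates_le:
  assumes "\<alpha> > 0" "clamped f"
  shows "norm ((neumann_resolvent \<alpha> ^^ n) f) \<le> norm f"
proof (induction n)
  case (Suc n)
  then show ?case
    using neumann_resolvent_nonexpansive[OF neumann_iterates(2)[OF assms, of n] neumann_resolvent_of_0 assms(1)]
    by simp
qed simp

text \<open>
  The exponential series \<open>exp (s (N - 1)) f\<close> with \<open>s = \<nu> t / \<alpha>\<^sup>2\<close>.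
\<close>

definition vorticity_evolution :: "real \<Rightarrow> real \<Rightarrow> profile \<Rightarrow> real \<Rightarrow> profile" where
  "vorticity_evolution \<nu> \<alpha> f t = poisson_mean (\<lambda>n. (neumann_resolvent \<alpha> ^^ n) f) (\<nu> / \<alpha>\<^sup>2 * t)"

lemma continuous_on_vorticity_evolution:
  assumes "\<alpha> > 0" "clamped f"
  shows "continuous_on A (vorticity_evolution \<nu> \<alpha> f)"
  unfolding vorticity_evolution_def
  by (intro continuous_on_compose2[OF continuous_on_poisson_mean[OF norm_neumann_iterates_le[OF assms]]]
     continuous_intros) auto

lemma vorticity_evolution_functional:
  assumes "\<alpha> > 0" "clamped f" "bounded_linear L"
  shows "L (vorticity_evolution \<nu> \<alpha> f t) = poisson_mean (\<lambda>n. L ((neumann_resolvent \<alpha> ^^ n) f)) (\<nu> / \<alpha>\<^sup>2 * t)"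
  unfolding vorticity_evolution_def
  by (rule bounded_linear_poisson_mean[OF assms(3) norm_neumann_iterates_le[OF assms(1,2)]])

text \<open>
  On the unit circle the swirl is its average at \<open>1\<close> times \<open>x\<^sup>\<bottom>\<close>, and the Neumann condition says
  that each resolvent step preserves this number.
\<close>

lemma evolution_no_slip:
  assumes "\<alpha> > 0" "clamped f" "radial_average f 1 = 0"
  shows "radial_average (vorticity_evolution \<nu> \<alpha> f t) 1 = 0"
proof -
  interpret A: bounded_linear radial_average by (rule bounded_linear_radial_average)
  have ev: "bounded_linear (\<lambda>f. radial_average f 1)"
    by (rule bounded_linear_compose[OF bounded_linear_intro[where K = 1 and f = "\<lambda>f :: profile. f 1"] A.bounded_linear_axioms])
      (auto intro: profile_abs_le)
  have "radial_average ((neumann_resolvent \<alpha> ^^ n) f) 1 = 0" for n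
  proof (induction n)
    case (Suc n)
    have "radial_average ((neumann_resolvent \<alpha> ^^ Suc n) f - (neumann_resolvent \<alpha> ^^ n) f) 1 = 0"
      using neumann_iterates(2)[OF assms(1,2), of n] by (simp add: neumann_resolvent_of_def)
    with Suc show ?case by (simp add: A.diff)
  qed (simp add: assms)
  then show ?thesis
    unfolding vorticity_evolution_functional[OF assms(1,2) ev] by (simp add: poisson_mean_def)
qed

text \<open>
  Let \<open>a\<^sub>n = N\<^sup>n f\<close>, and let \<open>L = m + \<alpha>\<^sup>2 d\<close> be the mass form plus \<open>\<alpha>\<^sup>2\<close> times the gradient form against
  \<open>\<phi>\<close>.  The resolvent equation gives \<open>\<alpha>\<^sup>2 d a\<^bsub>n+1\<^esub> = - m (a\<^bsub>n+1\<^esub> - a\<^sub>n)\<close>, that is,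
  \<open>L a\<^bsub>n+1\<^esub> = m a\<^sub>n = L a\<^sub>n - \<alpha>\<^sup>2 d a\<^sub>n\<close>.  Differentiating the Poisson average of \<open>L a\<^sub>n\<close> produces exactly
  these differences.
\<close>

lemma weak_momentum_balance:
  fixes \<nu> :: real
  assumes \<alpha>: "\<alpha> > 0" and f: "clamped f" and \<phi>: "test_field \<phi>"
  defines "w \<equiv> vorticity_evolution \<nu> \<alpha> f"
  shows "((\<lambda>s. mass_form (swirl (w s)) \<phi> + \<alpha>\<^sup>2 * gradient_form (swirl (w s)) \<phi>)
     has_real_derivative - (\<nu> * gradient_form (swirl (w t)) \<phi>)) (at t)"
proof -
  let ?m = "\<lambda>f. mass_form (swirl f) \<phi>" and ?d = "\<lambda>f. gradient_form (swirl f) \<phi>"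
  interpret m: bounded_linear ?m by (rule bounded_linear_mass_form[OF \<phi>])
  interpret d: bounded_linear ?d by (rule bounded_linear_gradient_form[OF \<phi>])
  define a where "a n = (neumann_resolvent \<alpha> ^^ n) f" for n
  define L where "L f = ?m f + \<alpha>\<^sup>2 * ?d f" for f
  have L: "bounded_linear L"
    unfolding L_def
    by (intro bounded_linear_add bounded_linear_const_mult m.bounded_linear_axioms d.bounded_linear_axioms)
  interpret L: bounded_linear L by (fact L)
  obtain C where C: "\<And>f. norm (L f) \<le> norm f * C" using L.bounded by blast
  have step: "L (a (Suc n)) = ?m (a n)" for n
  proof -
    obtain c where c: "a (Suc n) = const_profile c + (1 / \<alpha>\<^sup>2) *\<^sub>R radial_inverse_laplacian (a (Suc n) - a n)"
      using neumann_iterates(2)[OF \<alpha> f, of n] unfolding neumann_resolvent_of_def a_def by blast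
    have "?d (a (Suc n)) = ?d (const_profile c + (1 / \<alpha>\<^sup>2) *\<^sub>R radial_inverse_laplacian (a (Suc n) - a n))"
      using c by simp
    also have "\<dots> = - (1 / \<alpha>\<^sup>2) * ?m (a (Suc n) - a n)"
      by (simp add: d.add d.scaleR gradient_form_const[OF \<phi>] gradient_form_inverse_laplacian[OF \<phi>])
    finally show ?thesis using \<alpha> by (simp add: L_def m.diff)
  qed
  have bd: "norm (L (a n)) \<le> norm f * \<bar>C\<bar>" for n
  proof -
    have "norm (L (a n)) \<le> norm (a n) * \<bar>C\<bar>"
      using C[of "a n"] mult_left_mono[OF abs_ge_self[of C] norm_ge_zero[of "a n"]] by linarith
    also have "\<dots> \<le> norm f * \<bar>C\<bar>"
      unfolding a_def by (intro mult_right_mono norm_neumann_iterates_le[OF \<alpha> f]) auto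
    finally show ?thesis .
  qed
  let ?k = "\<nu> / \<alpha>\<^sup>2"
  have "((\<lambda>s. poisson_mean (\<lambda>n. L (a n)) (?k * s)) has_real_derivative
     poisson_mean (\<lambda>n. L (a (Suc n)) - L (a n)) (?k * t) * ?k) (at t)"
    by (rule DERIV_chain2[OF poisson_mean_has_derivative[OF bd] DERIV_cmult_Id])
  moreover have "poisson_mean (\<lambda>n. L (a n)) (?k * s) = ?m (w s) + \<alpha>\<^sup>2 * ?d (w s)" for s
    using vorticity_evolution_functional[OF \<alpha> f L, of \<nu> s] by (simp add: L_def a_def w_def)
  moreover have "poisson_mean (\<lambda>n. L (a (Suc n)) - L (a n)) (?k * t) * ?k = - (\<nu> * ?d (w t))"
  proof -
    have s: "bounded_linear (\<lambda>f. - (\<alpha>\<^sup>2 * ?d f))"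
      by (intro bounded_linear_minus bounded_linear_const_mult d.bounded_linear_axioms)
    have "poisson_mean (\<lambda>n. L (a (Suc n)) - L (a n)) (?k * t) = poisson_mean (\<lambda>n. - (\<alpha>\<^sup>2 * ?d (a n))) (?k * t)"
      by (simp only: step) (simp add: L_def)
    also have "\<dots> = - (\<alpha>\<^sup>2 * ?d (w t))"
      using vorticity_evolution_functional[OF \<alpha> f s, of \<nu> t] by (simp add: a_def w_def)
    finally show ?thesis using \<alpha> by simp
  qed
  ultimately show ?thesis by simp
qed

lemma swirl_evolution_is_solution:
  assumes \<nu>: "\<nu> > 0" and \<alpha>: "\<alpha> > 0" and f: "clamped f" and f1: "radial_average f 1 = 0"
    and u0: "\<And>x. x \<in> disc \<Longrightarrow> u0 x = swirl f x"
  shows "second_grade_solution \<nu> \<alpha> u0 (\<lambda>t. swirl (vorticity_evolution \<nu> \<alpha> f t))"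
proof -
  let ?w = "vorticity_evolution \<nu> \<alpha> f"
  have w: "continuous_on A (\<lambda>z. ?w (fst z))" for A :: "(real \<times> (real^2)) set"
    by (rule continuous_on_compose2[OF continuous_on_vorticity_evolution[OF \<alpha> f, of UNIV]])
      (auto intro!: continuous_intros)
  have C1: "C1_velocity (\<lambda>t. swirl (?w t))"
    unfolding C1_velocity_def
  proof (intro conjI allI impI)
    have "continuous_on ({0..} \<times> cball 0 1) (\<lambda>z. swirl (?w (fst z)) (snd z))"
      by (intro continuous_on_swirl w continuous_intros)
    then show "continuous_on ({0..} \<times> cball 0 1) (\<lambda>(t, x). swirl (?w t) x)"
      by (simp add: case_prod_beta')
    show "swirl (?w t) differentiable_on disc" for t
      unfolding differentiable_on_def
    proof
      fix x :: "real^2" assume x: "x \<in> disc"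
      have "(\<lambda>x. swirl (?w t) x $ j) differentiable (at x within disc)" for j
        using swirl_has_derivative[OF x] has_derivative_at_withinI unfolding differentiable_def by blast
      then show "swirl (?w t) differentiable (at x within disc)"
        by (auto simp: differentiable_componentwise_within[of "swirl (?w t)"] Basis_vec_def inner_axis)
    qed
    fix i j
    show "\<exists>g. continuous_on ({0..} \<times> cball 0 1) g \<and>
        (\<forall>t\<ge>0. \<forall>x\<in>disc. g (t, x) = jac (swirl (?w t)) j i x)"
      by (rule exI[of _ "\<lambda>z. swirl_jac (?w (fst z)) j i (snd z)"])
        (auto intro!: continuous_on_swirl_jac w continuous_intros simp: jac_swirl)
  qed
  have w0: "?w 0 = f"
  proof -
    \<comment> \<open>The iterates differ from \<open>f\<close> by at most \<open>2 \<parallel>f\<parallel>\<close>, and by nothing for \<open>n = 0\<close>; the expectation at time \<open>0\<close> is \<open>0\<close>.\<close>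
    have "norm (poisson_mean (\<lambda>n. (neumann_resolvent \<alpha> ^^ n) f) 0 - f) \<le> 0 + 0 * (2 * norm f)"
    proof (rule norm_poisson_mean_diff_le[OF _ norm_neumann_iterates_le[OF \<alpha> f]])
      show "norm ((neumann_resolvent \<alpha> ^^ n) f - f) \<le> 0 + real n * (2 * norm f)" for n
      proof (cases n)
        case (Suc m)
        have "norm ((neumann_resolvent \<alpha> ^^ n) f - f) \<le> 2 * norm f"
          using norm_triangle_ineq4[of "(neumann_resolvent \<alpha> ^^ n) f" f] norm_neumann_iterates_le[OF \<alpha> f, of n] by simp
        also have "\<dots> \<le> real n * (2 * norm f)"
          using Suc mult_right_mono[of 1 "real n" "2 * norm f"] by simp
        finally show ?thesis by simp
      qed simp
    qed simp
    then show ?thesis by (simp add: vorticity_evolution_def)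
  qed
  have bc: "swirl (?w t) x = 0" if "x \<in> sphere 0 1" for t x
    using that evolution_no_slip[OF \<alpha> f f1] by (simp add: swirl_def)
  show ?thesis
    unfolding second_grade_solution_def
    using C1 bc w0 u0 weak_momentum_balance[OF \<alpha> f, of _ \<nu>] sg_transport_swirl
    by (auto simp: div2_swirl intro: has_field_derivative_at_within)
qed

text \<open>
  The assumptions on \<open>g\<close> say that \<open>g\<close> is twice differentiable with \<open>\<Delta> g = k\<close> and \<open>g'(1) = 0\<close>, so
  \<open>g\<close> is the resolvent of \<open>g - \<alpha>\<^sup>2 k\<close>.  Comparing \<open>N\<^sup>n f\<close> with \<open>g\<close> costs \<open>\<alpha>\<^sup>2 \<parallel>k\<parallel>\<close> per step, and the
  expected number of steps is \<open>\<nu> t / \<alpha>\<^sup>2\<close>.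
\<close>

lemma evolution_close:
  assumes \<alpha>: "\<alpha> > 0" and f: "clamped f" and \<nu>: "\<nu> > 0" and t: "t \<ge> 0"
    and g: "g = const_profile c + radial_inverse_laplacian k" and k: "radial_average k 1 = 0"
  shows "norm (vorticity_evolution \<nu> \<alpha> f t - f) \<le> 2 * norm (f - g) + \<nu> * t * norm k"
proof -
  let ?N = "\<lambda>n. (neumann_resolvent \<alpha> ^^ n)"
  have gN: "neumann_resolvent_of \<alpha> (g - \<alpha>\<^sup>2 *\<^sub>R k) g"
  proof -
    interpret S: bounded_linear radial_inverse_laplacian by (rule bounded_linear_radial_inverse_laplacian)
    interpret A: bounded_linear radial_average by (rule bounded_linear_radial_average)
    show ?thesis unfolding neumann_resolvent_of_def
      using \<alpha> by (auto simp: S.scaleR A.scaleR k intro!: exI[of _ c] g)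
  qed
  have it: "norm (?N n f - g) \<le> norm (f - g) + real n * (\<alpha>\<^sup>2 * norm k)" for n
  proof (induction n)
    case (Suc n)
    have "norm (?N (Suc n) f - g) \<le> norm (?N n f - (g - \<alpha>\<^sup>2 *\<^sub>R k))"
      by (rule neumann_resolvent_nonexpansive[OF neumann_iterates(2)[OF \<alpha> f] gN \<alpha>])
    also have "\<dots> = norm ((?N n f - g) + \<alpha>\<^sup>2 *\<^sub>R k)" by (simp add: algebra_simps)
    also have "\<dots> \<le> norm (?N n f - g) + \<alpha>\<^sup>2 * norm k"
      using norm_triangle_ineq[of "?N n f - g" "\<alpha>\<^sup>2 *\<^sub>R k"] by simp
    finally show ?case using Suc by (simp add: algebra_simps)
  qed simp
  have "norm (?N n f - f) \<le> 2 * norm (f - g) + real n * (\<alpha>\<^sup>2 * norm k)" for n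
    using it[of n] norm_triangle_ineq[of "?N n f - g" "g - f"] by (simp add: norm_minus_commute)
  from norm_poisson_mean_diff_le[OF this norm_neumann_iterates_le[OF \<alpha> f], of "\<nu> / \<alpha>\<^sup>2 * t"]
  show ?thesis using \<alpha> \<nu> t by (simp add: vorticity_evolution_def mult_ac)
qed

section \<open>Tangential fields carry no flux through the circle\<close>

text \<open>
  A continuously differentiable function that vanishes on \<open>y \<le> 1\<close>, increases to \<open>1\<close>, and has
  \<open>y cutoff'(y)\<close> bounded with limit \<open>0\<close> at infinity.
\<close>

definition cutoff :: "real \<Rightarrow> real" where
  "cutoff y = (max 0 (y - 1))\<^sup>2 / (1 + (max 0 (y - 1))\<^sup>2)"

definition cutoff' :: "real \<Rightarrow> real" where
  "cutoff' y = 2 * max 0 (y - 1) / (1 + (max 0 (y - 1))\<^sup>2)\<^sup>2"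

lemma cutoff_deriv: "(cutoff has_real_derivative cutoff' y) (at y)"
proof -
  have d: "((\<lambda>y. (max 0 (y - 1))\<^sup>2) has_real_derivative 2 * max 0 (y - 1)) (at y)"
  proof -
    have "((\<lambda>y. y - 1) has_real_derivative 1) (at y)" by (auto intro!: derivative_eq_intros)
    from DERIV_chain2[OF positive_part_square_deriv this] show ?thesis by simp
  qed
  have p: "1 + (max 0 (y - 1))\<^sup>2 \<noteq> 0"
    by (metis add_pos_nonneg less_numeral_extra(1) order_less_irrefl zero_le_power2)
  show ?thesis
    unfolding cutoff_def[abs_def] cutoff'_def
    using DERIV_divide[OF d DERIV_add[OF DERIV_const[of 1] d] p]
    by (simp add: power2_eq_square algebra_simps)
qed

lemma continuous_on_cutoff [continuous_intros]:
  "continuous_on A f \<Longrightarrow> continuous_on A (\<lambda>x. cutoff (f x))"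
  "continuous_on A f \<Longrightarrow> continuous_on A (\<lambda>x. cutoff' (f x))"
  unfolding cutoff_def cutoff'_def
  by (intro continuous_intros; simp add: add_nonneg_eq_0_iff)+

lemma cutoff_bounds: "0 \<le> cutoff y" "cutoff y \<le> 1" "0 \<le> cutoff' y"
proof -
  have *: "p / (1 + p) \<le> 1" if "p \<ge> 0" for p :: real using that by (simp add: divide_le_eq)
  show "cutoff y \<le> 1" unfolding cutoff_def by (rule *) simp
qed (auto simp: cutoff_def cutoff'_def)

lemma cutoff_zero: "y \<le> 1 \<Longrightarrow> cutoff y = 0" "y \<le> 1 \<Longrightarrow> cutoff' y = 0"
  by (auto simp: cutoff_def cutoff'_def)

lemma cutoff_tendsto: "(cutoff \<longlongrightarrow> 1) at_top"
proof -
  have "((\<lambda>z::real. z\<^sup>2 / (1 + z\<^sup>2)) \<longlongrightarrow> 1) at_top" by real_asymp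
  moreover have "filterlim (\<lambda>y::real. y - 1) at_top at_top" by real_asymp
  ultimately have "((\<lambda>y::real. (y - 1)\<^sup>2 / (1 + (y - 1)\<^sup>2)) \<longlongrightarrow> 1) at_top" by (rule filterlim_compose)
  then show ?thesis
    by (rule Lim_transform_eventually)
      (auto simp: cutoff_def eventually_at_top_linorder max_def intro!: exI[of _ 1])
qed

lemma cutoff'_tendsto: "((\<lambda>y. y * cutoff' y) \<longlongrightarrow> 0) at_top"
proof -
  have "((\<lambda>z::real. (z + 1) * (2 * z / (1 + z\<^sup>2)\<^sup>2)) \<longlongrightarrow> 0) at_top" by real_asymp
  moreover have "filterlim (\<lambda>y::real. y - 1) at_top at_top" by real_asymp
  ultimately have "((\<lambda>y::real. (y - 1 + 1) * (2 * (y - 1) / (1 + (y - 1)\<^sup>2)\<^sup>2)) \<longlongrightarrow> 0) at_top"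
    by (rule filterlim_compose)
  then show ?thesis
    by (rule Lim_transform_eventually)
      (auto simp: cutoff'_def eventually_at_top_linorder max_def intro!: exI[of _ 1])
qed

lemma cutoff'_bound: "y \<ge> 0 \<Longrightarrow> \<bar>y * cutoff' y\<bar> \<le> 4"
proof -
  assume y: "y \<ge> 0"
  define z where "z = max 0 (y - 1)"
  have z: "z \<ge> 0" "y \<le> z + 1" by (auto simp: z_def)
  have "(z + 1) * (2 * z) \<le> 4 * (1 + z\<^sup>2)\<^sup>2"
  proof -
    have "0 \<le> (z - 1)\<^sup>2" by simp
    then have "2 * z \<le> 1 + z\<^sup>2" by (simp add: power2_eq_square algebra_simps)
    then have "z \<le> 1 + z\<^sup>2" using z(1) by linarith
    then have "(z + 1) * (2 * z) \<le> 4 * (1 + z\<^sup>2)" by (simp add: power2_eq_square algebra_simps)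
    also have "\<dots> \<le> 4 * (1 + z\<^sup>2)\<^sup>2"
      using self_le_power[of "1 + z\<^sup>2" 2] by simp
    finally show ?thesis .
  qed
  then have "(z + 1) * (2 * z / (1 + z\<^sup>2)\<^sup>2) \<le> 4"
    by (simp add: divide_le_eq add_nonneg_pos)
  moreover have "y * cutoff' y \<le> (z + 1) * cutoff' y"
    by (intro mult_right_mono z cutoff_bounds)
  ultimately show ?thesis
    using y cutoff_bounds(3)[of y] by (simp add: cutoff'_def z_def abs_mult)
qed

definition disc_cutoff :: "nat \<Rightarrow> real^2 \<Rightarrow> real" where
  "disc_cutoff n x = cutoff (real n * (1 - (norm x)\<^sup>2))"

lemma disc_cutoff_partial:
  "disc_cutoff n differentiable (at x)"
  "partial i (disc_cutoff n) x = - (2 * real n * cutoff' (real n * (1 - (norm x)\<^sup>2)) * x $ i)"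
proof -
  have "((\<lambda>x :: real^2. real n * (1 - x \<bullet> x)) has_derivative (\<lambda>v. real n * (- (x \<bullet> v + v \<bullet> x)))) (at x)"
    by (auto intro!: derivative_eq_intros)
  from has_derivative_compose[OF this, of cutoff "\<lambda>h. cutoff' (real n * (1 - (norm x)\<^sup>2)) * h"]
  have d: "(disc_cutoff n has_derivative
      (\<lambda>v. cutoff' (real n * (1 - (norm x)\<^sup>2)) * (real n * (- (x \<bullet> v + v \<bullet> x))))) (at x)"
    using cutoff_deriv[of "real n * (1 - (norm x)\<^sup>2)"]
    by (simp add: disc_cutoff_def[abs_def] power2_norm_eq_inner has_field_derivative_def)
  then show "disc_cutoff n differentiable (at x)" by (auto simp: differentiable_def)
  show "partial i (disc_cutoff n) x = - (2 * real n * cutoff' (real n * (1 - (norm x)\<^sup>2)) * x $ i)"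
    by (simp add: partial_eqI[OF d] inner_axis inner_axis')
qed

lemma continuous_on_disc_cutoff [continuous_intros]: "continuous_on A (disc_cutoff n)"
  "continuous_on A (partial i (disc_cutoff n))"
proof -
  show "continuous_on A (disc_cutoff n)" unfolding disc_cutoff_def[abs_def]
    by (intro continuous_intros)
  have "partial i (disc_cutoff n) = (\<lambda>x. - (2 * real n * cutoff' (real n * (1 - (norm x)\<^sup>2)) * x $ i))"
    by (rule ext) (rule disc_cutoff_partial)
  then show "continuous_on A (partial i (disc_cutoff n))"
    by (simp only:) (intro continuous_intros)
qed

lemma disc_cutoff_limits:
  assumes "x \<in> disc"
  shows "(\<lambda>n. disc_cutoff n x) \<longlonglongrightarrow> 1"
    "(\<lambda>n. real n * (1 - (norm x)\<^sup>2) * cutoff' (real n * (1 - (norm x)\<^sup>2))) \<longlonglongrightarrow> 0"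
proof -
  have "1 - (norm x)\<^sup>2 > 0" using assms by (simp add: power_less_one_iff)
  then have "filterlim (\<lambda>n. real n * (1 - (norm x)\<^sup>2)) at_top sequentially"
    using filterlim_tendsto_pos_mult_at_top[OF tendsto_const _ filterlim_real_sequentially, of "1 - (norm x)\<^sup>2"]
    by (simp add: mult.commute)
  from filterlim_compose[OF cutoff_tendsto this] filterlim_compose[OF cutoff'_tendsto this]
  show "(\<lambda>n. disc_cutoff n x) \<longlonglongrightarrow> 1"
    "(\<lambda>n. real n * (1 - (norm x)\<^sup>2) * cutoff' (real n * (1 - (norm x)\<^sup>2))) \<longlonglongrightarrow> 0"
    by (simp_all add: disc_cutoff_def)
qed

lemma disc_cutoff_support:
  assumes "n \<ge> 1" "x \<notin> cball 0 (sqrt (1 - 1 / real n))"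
  shows "disc_cutoff n x = 0"
proof -
  have "sqrt (1 - 1 / real n) < norm x" using assms by simp
  then have "1 - 1 / real n < (norm x)\<^sup>2"
    using assms(1) by (metis norm_ge_zero not_le real_le_rsqrt)
  then have "real n * (1 - (norm x)\<^sup>2) \<le> 1"
    using assms(1) by (simp add: field_simps)
  then show ?thesis by (simp add: disc_cutoff_def cutoff_zero)
qed

lemma differentiable_mult_real:
  fixes f g :: "real^2 \<Rightarrow> real"
  shows "f differentiable (at x) \<Longrightarrow> g differentiable (at x) \<Longrightarrow> (\<lambda>x. f x * g x) differentiable (at x)"
  by (rule differentiable_mult)

text \<open>
  The divergence theorem for the compactly supported field \<open>\<eta>\<^sub>n f v\<close>, where \<open>\<eta>\<^sub>n\<close> is the cutoff.
\<close>

lemma integral_cutoff_by_parts: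
  fixes v :: "real^2 \<Rightarrow> real^2"
  assumes v: "\<And>j x. x \<in> disc \<Longrightarrow> (\<lambda>y. v y $ j) differentiable (at x)"
    and cv: "continuous_on disc v"  "\<And>i. continuous_on disc (jac v i i)"
    and bv: "\<And>j. bounded_on disc (\<lambda>x. v x $ j)"
    and f: "\<And>x. x \<in> disc \<Longrightarrow> f differentiable (at x)"
    and cf: "\<And>i. continuous_on disc (partial i f)" and bf: "bounded_on disc f" "\<And>i. bounded_on disc (partial i f)"
    and bd: "bounded_on disc (div2 v)"
    and n: "n \<ge> 1"
  shows "(LINT x:disc|lborel. disc_cutoff n x * (f x * div2 v x + (\<Sum>i\<in>UNIV. v x $ i * partial i f x))) =
     (LINT x:disc|lborel. 2 * real n * cutoff' (real n * (1 - (norm x)\<^sup>2)) * f x * (v x \<bullet> x))"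
proof -
  let ?K = "cball 0 (sqrt (1 - 1 / real n)) :: (real^2) set"
  define F where "F i x = disc_cutoff n x * (f x * v x $ i)" for i x
  have fc: "continuous_on disc f"
    using f by (meson continuous_at_imp_continuous_on differentiable_imp_continuous_within)
  have pf: "partial i (F i) x = partial i (disc_cutoff n) x * (f x * v x $ i) +
      disc_cutoff n x * (partial i f x * v x $ i + f x * jac v i i x)" if "x \<in> disc" for i x
    unfolding F_def jac_def
    by (subst partial_mult, rule disc_cutoff_partial, rule differentiable_mult_real[OF f[OF that] v[OF that]],
        subst partial_mult[OF f[OF that] v[OF that]]) simp
  have "(LINT x:disc|lborel. \<Sum>i\<in>UNIV. partial i (F i) x) = 0"
  proof (rule integral_divergence_zero[of disc ?K])
    have "sqrt (1 - 1 / real n) < 1" using n by simp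
    then show "?K \<subseteq> disc" unfolding cball_subset_ball_iff by simp
    show "F i x = 0" if "x \<notin> ?K" for i x using disc_cutoff_support[OF n that] by (simp add: F_def)
    show "F i differentiable at x" if "x \<in> disc" for i x
      unfolding F_def by (intro differentiable_mult_real disc_cutoff_partial f v that)
    have "continuous_on disc (\<lambda>x. partial i (disc_cutoff n) x * (f x * v x $ i) +
      disc_cutoff n x * (partial i f x * v x $ i + f x * jac v i i x))" for i
      by (intro continuous_intros fc cf cv)
    then show "continuous_on disc (partial i (F i))" for i
      by (rule continuous_on_eq) (simp add: pf)
  qed auto
  moreover have "(\<Sum>i\<in>UNIV. partial i (F i) x) = disc_cutoff n x * (f x * div2 v x + (\<Sum>i\<in>UNIV. v x $ i * partial i f x))
     - 2 * real n * cutoff' (real n * (1 - (norm x)\<^sup>2)) * f x * (v x \<bullet> x)" if "x \<in> disc" for x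
    by (simp add: pf[OF that] disc_cutoff_partial div2_def inner_vec_def sum_2 algebra_simps)
  then have "(LINT x:disc|lborel. \<Sum>i\<in>UNIV. partial i (F i) x) =
     (LINT x:disc|lborel. disc_cutoff n x * (f x * div2 v x + (\<Sum>i\<in>UNIV. v x $ i * partial i f x))
     - 2 * real n * cutoff' (real n * (1 - (norm x)\<^sup>2)) * f x * (v x \<bullet> x))"
    by (intro set_lebesgue_integral_cong) auto
  ultimately have 0: "(LINT x:disc|lborel. disc_cutoff n x * (f x * div2 v x + (\<Sum>i\<in>UNIV. v x $ i * partial i f x))
     - 2 * real n * cutoff' (real n * (1 - (norm x)\<^sup>2)) * f x * (v x \<bullet> x)) = 0"
    by simp
  have b1: "bounded_on disc (disc_cutoff n)" "bounded_on disc (\<lambda>x. cutoff' (real n * (1 - (norm x)\<^sup>2)))"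
    "bounded_on disc (\<lambda>x. x $ i)" for i :: 2
    by (auto intro!: bounded_on_compact[of "cball 0 1"] continuous_intros)
  have cd: "continuous_on disc (div2 v)"
    unfolding div2_def[abs_def] by (intro continuous_intros cv)
  have "set_integrable lborel disc (\<lambda>x. disc_cutoff n x * (f x * div2 v x + (\<Sum>i\<in>UNIV. v x $ i * partial i f x)))"
    by (intro set_integrable_disc continuous_intros fc cd cf cv bounded_on_intros b1 bf bv bd)
  moreover have "set_integrable lborel disc (\<lambda>x. 2 * real n * cutoff' (real n * (1 - (norm x)\<^sup>2)) * f x * (v x \<bullet> x))"
    unfolding inner_vec_def inner_real_def
    by (intro set_integrable_disc continuous_intros fc cv bounded_on_intros b1 bf bv)
  ultimately show ?thesis using 0 set_integral_diff(2) by fastforce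
qed

lemma bounded_on_of_bounded_partials:
  assumes f: "\<And>x. x \<in> disc \<Longrightarrow> f differentiable (at x)"
    and b: "\<And>i. bounded_on disc (partial i f)"
  shows "bounded_on disc f"
proof -
  from b obtain B where B: "\<And>i x. x \<in> disc \<Longrightarrow> \<bar>partial i f x\<bar> \<le> B i"
    unfolding bounded_on_def by metis
  have o: "norm (\<Sum>i\<in>UNIV. v $ i * partial i f x) \<le> (\<Sum>i\<in>UNIV. B i) * norm v" if "x \<in> disc" for x v
  proof -
    have "norm (\<Sum>i\<in>UNIV. v $ i * partial i f x) \<le> (\<Sum>i\<in>UNIV. norm v * B i)"
    proof (rule sum_norm_le)
      show "norm (v $ i * partial i f x) \<le> norm v * B i" for i
        using component_le_norm_cart[of v i] B[OF that, of i]
        by (simp add: abs_mult) (intro mult_mono, auto)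
    qed
    then show ?thesis by (simp add: sum_distrib_left sum_distrib_right mult.commute)
  qed
  have "norm (f x - f 0) \<le> (\<Sum>i\<in>UNIV. B i) * norm (x - 0)" if "x \<in> disc" for x
    by (rule differentiable_bound[where S = disc and f' = "\<lambda>x v. \<Sum>i\<in>UNIV. v $ i * partial i f x"])
      (use that f o in \<open>auto intro!: has_derivative_at_withinI has_derivative_partial onorm_le\<close>)
  moreover have "(\<Sum>i\<in>UNIV. B i) * norm (x - 0) \<le> \<bar>\<Sum>i\<in>UNIV. B i\<bar> * 1" if "x \<in> disc" for x :: "real^2"
    using that by (intro mult_mono) auto
  ultimately have "\<bar>f x\<bar> \<le> \<bar>\<Sum>i\<in>UNIV. B i\<bar> + \<bar>f 0\<bar>" if "x \<in> disc" for x
    using that abs_triangle_ineq[of "f x - f 0" "f 0"] by (simp only: real_norm_def) (smt (verit))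
  then show ?thesis by (rule bounded_onI)
qed

text \<open>
  The set where the first term fails to dominate is compact and misses the circle, so
  \<open>1 - |x|\<^sup>2\<close> has a positive minimum on it.
\<close>

lemma small_near_sphere:
  fixes g :: "real^2 \<Rightarrow> real"
  assumes g: "continuous_on (cball 0 1) g" and g0: "\<And>x. norm x = 1 \<Longrightarrow> g x = 0" and \<epsilon>: "\<epsilon> > 0"
  obtains C where "C \<ge> 0" "\<And>x. x \<in> cball 0 1 \<Longrightarrow> \<bar>g x\<bar> \<le> \<epsilon> * (norm x)\<^sup>2 + C * (1 - (norm x)\<^sup>2)"
proof -
  define A where "A = {x \<in> cball 0 1. \<epsilon> * (norm x)\<^sup>2 \<le> \<bar>g x\<bar>}"
  have "closed A"
    unfolding A_def by (intro continuous_on_closed_Collect_le continuous_intros g closed_cball)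
  then have A: "compact A"
    using compact_Int_closed[OF compact_cball, of A 0 1] by (simp add: A_def Int_def conj_commute)
  have "bounded_on (cball 0 1) g" by (rule bounded_on_compact[OF compact_cball g]) auto
  then obtain M where M: "\<And>x. x \<in> cball 0 1 \<Longrightarrow> \<bar>g x\<bar> \<le> M" unfolding bounded_on_def by blast
  have M0: "M \<ge> 0" using M[of 0] by simp
  have "\<exists>m>0. \<forall>x\<in>A. m \<le> 1 - (norm x)\<^sup>2"
  proof (cases "A = {}")
    case False
    have "continuous_on A (\<lambda>x. 1 - (norm x)\<^sup>2)" by (intro continuous_intros)
    then obtain z where z: "z \<in> A" "\<And>x. x \<in> A \<Longrightarrow> 1 - (norm z)\<^sup>2 \<le> 1 - (norm x)\<^sup>2"
      using continuous_attains_inf[OF A False] by blast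
    have "norm z \<noteq> 1" using z(1) g0[of z] \<epsilon> by (auto simp: A_def)
    then have "norm z < 1" using z(1) by (auto simp: A_def)
    then have "1 - (norm z)\<^sup>2 > 0" by (simp add: power_less_one_iff)
    then show ?thesis using z(2) by blast
  qed (auto intro: exI[of _ 1])
  then obtain m where m: "m > 0" "\<And>x. x \<in> A \<Longrightarrow> m \<le> 1 - (norm x)\<^sup>2" by blast
  show ?thesis
  proof (rule that[of "M / m"])
    fix x :: "real^2" assume x: "x \<in> cball 0 1"
    have n1: "1 - (norm x)\<^sup>2 \<ge> 0" using x by (simp add: power_le_one)
    show "\<bar>g x\<bar> \<le> \<epsilon> * (norm x)\<^sup>2 + M / m * (1 - (norm x)\<^sup>2)"
    proof (cases "x \<in> A")
      case True
      have "M / m * m \<le> M / m * (1 - (norm x)\<^sup>2)"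
        using m(2)[OF True] M0 m(1) by (intro mult_left_mono) auto
      then have "\<bar>g x\<bar> \<le> M / m * (1 - (norm x)\<^sup>2)" using M[OF x] m(1) by simp
      moreover have "0 \<le> \<epsilon> * (norm x)\<^sup>2" using \<epsilon> by simp
      ultimately show ?thesis by linarith
    next
      case False
      then have "\<bar>g x\<bar> \<le> \<epsilon> * (norm x)\<^sup>2" using x by (auto simp: A_def)
      moreover have "0 \<le> M / m * (1 - (norm x)\<^sup>2)" using M0 m(1) n1 by simp
      ultimately show ?thesis by linarith
    qed
  qed (use M0 m(1) in auto)
qed

text \<open>
  The error of the cutoff is \<open>\<integral> 2 n cutoff'(y) f (v \<cdot> x)\<close> with \<open>y = n (1 - |x|\<^sup>2)\<close>.  Here
  \<open>v \<cdot> x\<close> is continuous and vanishes on the circle, so \<open>|v \<cdot> x| \<le> \<epsilon> |x|\<^sup>2 + C (1 - |x|\<^sup>2)\<close>.  The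
  first part contributes at most \<open>\<epsilon>\<close> times \<open>\<integral> 2 n cutoff'(y) |x|\<^sup>2\<close>, which is bounded: by
  \<open>integral_cutoff_by_parts\<close> for the field \<open>x\<close> it equals \<open>2 \<integral> \<eta>\<^sub>n\<close>.  The second contributes a
  multiple of \<open>\<integral> y cutoff'(y)\<close>, which tends to zero.
\<close>

lemma tangential_flux_zero:
  fixes v :: "real^2 \<Rightarrow> real^2"
  assumes v: "\<And>j x. x \<in> disc \<Longrightarrow> (\<lambda>y. v y $ j) differentiable (at x)"
    and cv: "continuous_on (cball 0 1) v" "\<And>i. continuous_on disc (jac v i i)"
    and tang: "\<And>x. norm x = 1 \<Longrightarrow> v x \<bullet> x = 0" and div: "\<And>x. x \<in> disc \<Longrightarrow> div2 v x = 0"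
    and f: "\<And>x. x \<in> disc \<Longrightarrow> f differentiable (at x)"
    and cf: "\<And>i. continuous_on disc (partial i f)" and bf: "\<And>i. bounded_on disc (partial i f)"
  shows "(LINT x:disc|lborel. \<Sum>i\<in>UNIV. v x $ i * partial i f x) = 0"
proof -
  have bdf: "bounded_on disc f" by (rule bounded_on_of_bounded_partials[OF f bf])
  then obtain F where F: "\<And>x. x \<in> disc \<Longrightarrow> \<bar>f x\<bar> \<le> F" unfolding bounded_on_def by blast
  have F0: "F \<ge> 0" using F[of 0] by simp
  have cvd: "continuous_on disc v" by (rule continuous_on_subset[OF cv(1)]) auto
  have bv: "bounded_on disc (\<lambda>x. v x $ j)" for j
    by (rule bounded_on_compact[of "cball 0 1"]) (auto intro!: continuous_intros cv)
  have bdiv: "bounded_on disc (div2 v)" by (rule bounded_onI[of _ _ 0]) (simp add: div)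
  have cfc: "continuous_on disc f"
    using f by (meson continuous_at_imp_continuous_on differentiable_imp_continuous_within)
  define y where "y n x = real n * (1 - (norm x)\<^sup>2)" for n and x :: "real^2"
  have y0: "y n x \<ge> 0" if "x \<in> disc" for n x
    using that by (auto simp: y_def intro!: mult_nonneg_nonneg power_le_one)
  define I where "I = (LINT x:disc|lborel. \<Sum>i\<in>UNIV. v x $ i * partial i f x)"
  define A where "A n = (LINT x:disc|lborel. disc_cutoff n x * (\<Sum>i\<in>UNIV. v x $ i * partial i f x))" for n
  define B where "B n = (LINT x:disc|lborel. 2 * real n * cutoff' (y n x) * f x * (v x \<bullet> x))" for n
  define R where "R n = (LINT x:disc|lborel. 2 * (y n x * cutoff' (y n x)))" for n
  define V where "V = measure lborel (disc)"
  have bc: "bounded_on (UNIV \<times> disc) (\<lambda>z. disc_cutoff (fst z) (snd z))"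
    by (rule bounded_onI[of _ _ 1]) (auto simp: disc_cutoff_def cutoff_bounds)
  have bx: "bounded_on (UNIV \<times> disc) (\<lambda>z. \<psi> (snd z))" if "bounded_on disc \<psi>" for \<psi>
    using that unfolding bounded_on_def by auto
  have "A \<longlonglongrightarrow> (LINT x:disc|lborel. 1 * (\<Sum>i\<in>UNIV. v x $ i * partial i f x))"
    unfolding A_def
  proof (rule tendsto_set_integral_disc)
    show "continuous_on disc (\<lambda>x. disc_cutoff n x * (\<Sum>i\<in>UNIV. v x $ i * partial i f x))" for n
      by (intro continuous_intros cvd cf)
    have "bounded_on (UNIV \<times> disc) (\<lambda>z. disc_cutoff (fst z) (snd z) * (\<Sum>i\<in>UNIV. v (snd z) $ i * partial i f (snd z)))"
      by (intro bounded_on_intros bc bx bv bf)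
    then show "bounded_on (UNIV \<times> disc) (\<lambda>(n, x). disc_cutoff n x * (\<Sum>i\<in>UNIV. v x $ i * partial i f x))"
      by (simp add: bounded_on_def)
    show "(\<lambda>n. disc_cutoff n x * (\<Sum>i\<in>UNIV. v x $ i * partial i f x)) \<longlonglongrightarrow> 1 * (\<Sum>i\<in>UNIV. v x $ i * partial i f x)"
      if "x \<in> disc" for x by (intro tendsto_intros disc_cutoff_limits that)
  qed
  then have AI: "A \<longlonglongrightarrow> I" by (simp add: I_def)
  have AB: "A n = B n" if "n \<ge> 1" for n
  proof -
    have "A n = (LINT x:disc|lborel. disc_cutoff n x * (f x * div2 v x + (\<Sum>i\<in>UNIV. v x $ i * partial i f x)))"
      unfolding A_def by (rule set_lebesgue_integral_cong) (auto simp: div)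
    also have "\<dots> = B n"
      unfolding B_def y_def by (rule integral_cutoff_by_parts[OF v cvd cv(2) bv f cf bdf bf bdiv that])
    finally show ?thesis .
  qed
  have layer: "(LINT x:disc|lborel. 2 * real n * cutoff' (y n x) * 1 * (x \<bullet> x)) \<le> 2 * V" if n: "n \<ge> 1" for n
  proof -
    have j: "jac (\<lambda>x. x) i i = (\<lambda>_. 1)" for i by (simp add: fun_eq_iff jac_def)
    have d: "div2 (\<lambda>x. x) = (\<lambda>_. 2)" by (simp add: fun_eq_iff div2_def j sum_2)
    have "(LINT x:disc|lborel. 2 * real n * cutoff' (y n x) * 1 * (x \<bullet> x)) =
       (LINT x:disc|lborel. disc_cutoff n x * (1 * div2 (\<lambda>x. x) x + (\<Sum>i\<in>UNIV. x $ i * partial i (\<lambda>_. 1) x)))"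
      unfolding y_def
      by (rule integral_cutoff_by_parts[symmetric, OF _ _ _ _ _ _ _ _ _ n])
        (auto simp: j d bounded_on_const intro!: bounded_on_compact[of "cball 0 1"] continuous_intros smooth_differentiable)
    also have "\<dots> = (LINT x:disc|lborel. disc_cutoff n x * 2)" by (simp add: d)
    also have "\<dots> \<le> 2 * measure lborel disc"
    proof (rule order_trans[OF abs_ge_self abs_set_integral_disc_le])
      show "\<bar>disc_cutoff n x * 2\<bar> \<le> 2" for x
        using cutoff_bounds by (simp add: disc_cutoff_def)
    qed (intro continuous_intros)
    finally show ?thesis by (simp add: V_def)
  qed
  have "R \<longlonglongrightarrow> (LINT x:disc|lborel. 2 * 0)"
    unfolding R_def
  proof (rule tendsto_set_integral_disc)
    show "continuous_on disc (\<lambda>x. 2 * (y n x * cutoff' (y n x)))" for n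
      unfolding y_def by (intro continuous_intros)
    have "\<bar>2 * (y n x * cutoff' (y n x))\<bar> \<le> 8" if "x \<in> disc" for n x
      using cutoff'_bound[OF y0[OF that], of n] by (simp add: abs_mult)
    then show "bounded_on (UNIV \<times> disc) (\<lambda>(n, x). 2 * (y n x * cutoff' (y n x)))"
      by (intro bounded_onI[of _ _ 8]) auto
    show "(\<lambda>n. 2 * (y n x * cutoff' (y n x))) \<longlonglongrightarrow> 2 * 0" if "x \<in> disc" for x
      unfolding y_def by (intro tendsto_mult tendsto_const disc_cutoff_limits that)
  qed
  then have R0: "R \<longlonglongrightarrow> 0" by simp
  have small: "\<bar>I\<bar> \<le> F * (\<epsilon> * (2 * V))" if \<epsilon>: "\<epsilon> > 0" for \<epsilon>
  proof -
    have cvx: "continuous_on (cball 0 1) (\<lambda>x. v x \<bullet> x)" by (intro continuous_intros cv)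
    obtain C where C: "C \<ge> 0" "\<And>x. x \<in> cball 0 1 \<Longrightarrow> \<bar>v x \<bullet> x\<bar> \<le> \<epsilon> * (norm x)\<^sup>2 + C * (1 - (norm x)\<^sup>2)"
      using small_near_sphere[OF cvx tang \<epsilon>] by blast
    have bnd: "\<bar>B n\<bar> \<le> F * (\<epsilon> * (2 * V) + C * R n)" if n: "n \<ge> 1" for n
    proof -
      have bx1: "bounded_on disc (\<lambda>x. cutoff' (y n x))" "bounded_on disc (y n)" "bounded_on disc (\<lambda>x. x \<bullet> x)"
        "bounded_on disc (\<lambda>x. v x \<bullet> x)"
        unfolding y_def by (auto intro!: bounded_on_compact[of "cball 0 1"] continuous_intros cv)
      have cy: "continuous_on disc (\<lambda>x. cutoff' (y n x))" "continuous_on disc (y n)"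
        unfolding y_def by (intro continuous_intros)+
      have i1: "set_integrable lborel disc (\<lambda>x. 2 * real n * cutoff' (y n x) * f x * (v x \<bullet> x))"
        by (intro set_integrable_disc continuous_intros cy cfc cvd bounded_on_intros bx1 bdf)
      have i2: "set_integrable lborel disc (\<lambda>x. 2 * real n * cutoff' (y n x) * 1 * (x \<bullet> x))"
        by (intro set_integrable_disc continuous_intros cy bounded_on_intros bx1)
      have i3: "set_integrable lborel disc (\<lambda>x. 2 * (y n x * cutoff' (y n x)))"
        by (intro set_integrable_disc continuous_intros cy bounded_on_intros bx1)
      have "\<bar>B n\<bar> \<le> (LINT x:disc|lborel. norm (2 * real n * cutoff' (y n x) * f x * (v x \<bullet> x)))"
        unfolding B_def real_norm_def[symmetric] by (rule set_integral_norm_bound[OF i1])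
      also have "\<dots> \<le> (LINT x:disc|lborel. F * \<epsilon> * (2 * real n * cutoff' (y n x) * 1 * (x \<bullet> x)) + F * C * (2 * (y n x * cutoff' (y n x))))"
      proof (rule set_integral_mono)
        fix x :: "real^2" assume x: "x \<in> disc"
        have "\<bar>f x\<bar> * \<bar>v x \<bullet> x\<bar> \<le> F * (\<epsilon> * (norm x)\<^sup>2 + C * (1 - (norm x)\<^sup>2))"
          using x by (intro mult_mono F C) (auto simp: F0)
        then have "2 * real n * cutoff' (y n x) * (\<bar>f x\<bar> * \<bar>v x \<bullet> x\<bar>) \<le>
           2 * real n * cutoff' (y n x) * (F * (\<epsilon> * (norm x)\<^sup>2 + C * (1 - (norm x)\<^sup>2)))"
          using cutoff_bounds by (intro mult_left_mono) auto
        then show "norm (2 * real n * cutoff' (y n x) * f x * (v x \<bullet> x)) \<le>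
           F * \<epsilon> * (2 * real n * cutoff' (y n x) * 1 * (x \<bullet> x)) + F * C * (2 * (y n x * cutoff' (y n x)))"
          using cutoff_bounds(3)[of "y n x"]
          by (simp add: abs_mult y_def power2_norm_eq_inner algebra_simps)
      qed (use set_integrable_abs[OF i1] i2 i3 in \<open>auto intro!: set_integral_add(1)\<close>)
      also have "\<dots> = F * \<epsilon> * (LINT x:disc|lborel. 2 * real n * cutoff' (y n x) * 1 * (x \<bullet> x)) + F * C * R n"
        unfolding R_def using i2 i3 by (subst set_integral_add(2)) auto
      also have "\<dots> \<le> F * \<epsilon> * (2 * V) + F * C * R n"
        using \<epsilon> F0 layer[OF n] by (intro add_right_mono mult_left_mono) auto
      finally show ?thesis by (simp add: algebra_simps)
    qed
    have "(\<lambda>n. F * (\<epsilon> * (2 * V) + C * R n)) \<longlonglongrightarrow> F * (\<epsilon> * (2 * V) + C * 0)"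
      by (intro tendsto_intros R0)
    moreover have "(\<lambda>n. \<bar>A n\<bar>) \<longlonglongrightarrow> \<bar>I\<bar>" by (intro tendsto_intros AI)
    moreover have "\<exists>N. \<forall>n\<ge>N. \<bar>A n\<bar> \<le> F * (\<epsilon> * (2 * V) + C * R n)"
      using bnd AB by (intro exI[of _ 1]) auto
    ultimately have "\<bar>I\<bar> \<le> F * (\<epsilon> * (2 * V) + C * 0)" by (intro LIMSEQ_le)
    then show ?thesis by simp
  qed
  have "I = 0"
  proof (rule ccontr)
    assume "I \<noteq> 0"
    have FV: "F * (2 * V) \<ge> 0" using F0 by (simp add: V_def)
    \<comment> \<open>With this \<open>\<epsilon>\<close> the bound is at most half of \<open>\<bar>I\<bar>\<close>.\<close>
    have "\<bar>I\<bar> \<le> F * (2 * V) * (\<bar>I\<bar> / (2 * (F * (2 * V) + 1)))"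
      using small[of "\<bar>I\<bar> / (2 * (F * (2 * V) + 1))"] \<open>I \<noteq> 0\<close> FV by (simp add: mult_ac)
    also have "\<dots> < \<bar>I\<bar>"
    proof -
      have "F * (2 * V) / (2 * (F * (2 * V) + 1)) < 1" using FV by (simp add: divide_less_eq)
      from mult_strict_right_mono[OF this, of "\<bar>I\<bar>"] show ?thesis using \<open>I \<noteq> 0\<close> by simp
    qed
    finally show False by simp
  qed
  then show ?thesis by (simp add: I_def)
qed

section \<open>Uniqueness of the Euler flow\<close>

text \<open>
  Dominated convergence of the difference quotients, which the mean value theorem bounds by the
  supremum of \<open>h'\<close>.
\<close>

lemma has_derivative_disc_integral:
  fixes h h' :: "real \<Rightarrow> real^2 \<Rightarrow> real"
  assumes d: "\<And>s x. s \<ge> 0 \<Longrightarrow> x \<in> disc \<Longrightarrow> ((\<lambda>s. h s x) has_real_derivative h' s x) (at s within {0..})"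
    and c: "\<And>s. s \<ge> 0 \<Longrightarrow> continuous_on disc (h s)" and b: "\<And>s. s \<ge> 0 \<Longrightarrow> bounded_on disc (h s)"
    and C: "\<And>s x. 0 \<le> s \<Longrightarrow> s \<le> t + 1 \<Longrightarrow> x \<in> disc \<Longrightarrow> \<bar>h' s x\<bar> \<le> C"
    and t: "t \<ge> 0"
  shows "((\<lambda>s. LINT x:disc|lborel. h s x) has_real_derivative (LINT x:disc|lborel. h' t x)) (at t within {0..})"
  unfolding has_field_derivative_iff tendsto_at_iff_sequentially
proof (intro allI impI)
  fix X :: "nat \<Rightarrow> real"
  assume X: "\<forall>i. X i \<in> {0..} - {t}" "X \<longlonglongrightarrow> t"
  have X0: "X n \<ge> 0" "X n \<noteq> t" for n using X(1) by auto
  \<comment> \<open>The bound on \<open>h'\<close> holds up to the time \<open>t + 1\<close>, so an initial segment of the sequence is dropped.\<close>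
  have "eventually (\<lambda>n. X n < t + 1) sequentially" using X(2) by (rule order_tendstoD) simp
  then obtain N where N: "\<And>n. n \<ge> N \<Longrightarrow> X n \<le> t + 1"
    unfolding eventually_sequentially by (meson less_imp_le)
  define Y where "Y n = X (n + N)" for n
  have Y: "Y n \<ge> 0" "Y n \<le> t + 1" "Y n \<noteq> t" for n using X0 N by (auto simp: Y_def)
  have Yt: "Y \<longlonglongrightarrow> t" unfolding Y_def by (rule LIMSEQ_ignore_initial_segment[OF X(2)])
  have i: "set_integrable lborel disc (h s)" if "s \<ge> 0" for s
    by (rule set_integrable_disc[OF c[OF that] b[OF that]])
  let ?q = "\<lambda>n x. (h (Y n) x - h t x) / (Y n - t)"
  have "(\<lambda>n. LINT x:disc|lborel. ?q n x) \<longlonglongrightarrow> (LINT x:disc|lborel. h' t x)"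
  proof (rule tendsto_set_integral_disc)
    show "continuous_on disc (?q n)" for n
      using Y(3)[of n] by (intro continuous_intros c Y t) auto
    have "\<bar>?q n x\<bar> \<le> C" if x: "x \<in> disc" for n x
    proof -
      have "norm (h (Y n) x - h t x) \<le> C * norm (Y n - t)"
      proof (rule field_differentiable_bound[where S = "{0..t + 1}" and f' = "\<lambda>s. h' s x"])
        show "((\<lambda>s. h s x) has_real_derivative h' s x) (at s within {0..t + 1})" if "s \<in> {0..t + 1}" for s
          using that by (intro DERIV_subset[OF d[OF _ x]]) auto
      qed (use C[OF _ _ x] Y t in auto)
      then show ?thesis using Y(3)[of n] by (simp add: abs_divide divide_le_eq)
    qed
    then show "bounded_on (UNIV \<times> disc) (\<lambda>(n, x). ?q n x)" by (intro bounded_onI[of _ _ C]) auto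
    show "(\<lambda>n. ?q n x) \<longlonglongrightarrow> h' t x" if x: "x \<in> disc" for x
    proof -
      have "((\<lambda>y. (h y x - h t x) / (y - t)) \<longlongrightarrow> h' t x) (at t within {0..})"
        using d[OF t x] by (simp add: has_field_derivative_iff)
      then have "((\<lambda>y. (h y x - h t x) / (y - t)) \<circ> Y) \<longlonglongrightarrow> h' t x"
        unfolding tendsto_at_iff_sequentially using Y Yt by auto
      then show ?thesis by (simp add: o_def)
    qed
  qed
  moreover have "(LINT x:disc|lborel. ?q n x) = ((LINT x:disc|lborel. h (Y n) x) - (LINT x:disc|lborel. h t x)) / (Y n - t)" for n
    using set_integral_diff(2)[OF i[OF Y(1)[of n]] i[OF t]] by simp
  ultimately have "(\<lambda>n. ((LINT x:disc|lborel. h (Y n) x) - (LINT x:disc|lborel. h t x)) / (Y n - t)) \<longlonglongrightarrow> (LINT x:disc|lborel. h' t x)"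
    by (simp only:)
  then have "(\<lambda>n. ((\<lambda>y. ((LINT x:disc|lborel. h y x) - (LINT x:disc|lborel. h t x)) / (y - t)) \<circ> X) (n + N)) \<longlonglongrightarrow> (LINT x:disc|lborel. h' t x)"
    by (simp add: Y_def o_def)
  then show "((\<lambda>y. ((LINT x:disc|lborel. h y x) - (LINT x:disc|lborel. h t x)) / (y - t)) \<circ> X) \<longlonglongrightarrow> (LINT x:disc|lborel. h' t x)"
    by (rule LIMSEQ_offset)
qed

text \<open>
  The set where \<open>g\<close> is nonzero is open and null, hence empty.
\<close>

lemma nonneg_disc_integral_zero:
  assumes c: "continuous_on disc g" and b: "bounded_on disc g" and nn: "\<And>x. x \<in> disc \<Longrightarrow> g x \<ge> 0"
    and z: "(LINT x:disc|lborel. g x) = 0" and x: "x \<in> disc"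
  shows "g x = 0"
proof -
  define N where "N = {x \<in> disc. g x \<noteq> 0}"
  have "open N"
  proof -
    have "open (disc \<inter> g -` (- {0}))"
      by (rule continuous_open_preimage[OF c]) auto
    moreover have "disc \<inter> g -` (- {0}) = N" by (auto simp: N_def)
    ultimately show ?thesis by simp
  qed
  have i: "integrable lborel (\<lambda>x. indicator disc x *\<^sub>R g x)"
    using set_integrable_disc[OF c b] by (simp add: set_integrable_def)
  have "AE x in lborel. indicator disc x *\<^sub>R g x = 0"
    using integral_nonneg_eq_0_iff_AE[OF i] z nn
    by (auto simp: set_lebesgue_integral_def indicator_def)
  then have "AE x in lborel. x \<notin> N" by eventually_elim (auto simp: N_def indicator_def)
  then have "N \<in> null_sets lborel"
    using \<open>open N\<close> by (subst (asm) AE_iff_null_sets[symmetric]) auto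
  then have "negligible N" by (simp add: negligible_iff_null_sets null_sets_completionI)
  then have "N = {}" using \<open>open N\<close> open_not_negligible by blast
  then show ?thesis using x by (auto simp: N_def)
qed

lemma gronwall_zero:
  fixes E E' :: "real \<Rightarrow> real"
  assumes d: "\<And>s. s \<ge> 0 \<Longrightarrow> (E has_real_derivative E' s) (at s within {0..})"
    and le: "\<And>s. s \<ge> 0 \<Longrightarrow> E' s \<le> c * E s" and E0: "E 0 = 0" and nn: "\<And>s. s \<ge> 0 \<Longrightarrow> E s \<ge> 0" and t: "t \<ge> 0"
  shows "E t = 0"
proof -
  have "exp (- c * t) * E t \<le> exp (- c * 0) * E 0"
  proof (rule DERIV_nonpos_imp_decreasing_open[OF t])
    fix s assume s: "0 < s" "s < t"
    have "at s within {0..} = at s" by (rule at_within_interior) (use s in auto)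
    then have "(E has_real_derivative E' s) (at s)" using d[of s] s by simp
    moreover have "((\<lambda>s. exp (- c * s)) has_real_derivative - c * exp (- c * s)) (at s)"
      by (auto intro!: derivative_eq_intros)
    ultimately have "((\<lambda>s. exp (- c * s) * E s) has_real_derivative - c * exp (- c * s) * E s + E' s * exp (- c * s)) (at s)"
      using DERIV_mult by fast
    moreover have "- c * exp (- c * s) * E s + E' s * exp (- c * s) \<le> 0"
      using mult_right_mono[OF le[of s], of "exp (- c * s)"] s by (simp add: algebra_simps)
    ultimately show "\<exists>y. ((\<lambda>s. exp (- c * s) * E s) has_real_derivative y) (at s) \<and> y \<le> 0" by blast
  next
    have "continuous_on {0..} E"
      using d by (auto simp: continuous_on_eq_continuous_within intro: DERIV_continuous)
    then have "continuous_on {0..t} E" by (rule continuous_on_subset) auto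
    then show "continuous_on {0..t} (\<lambda>s. exp (- c * s) * E s)" by (intro continuous_intros)
  qed
  then have "exp (- c * t) * E t \<le> 0" by (simp add: E0)
  then have "E t \<le> 0" by (simp add: mult_le_0_iff)
  then show ?thesis using nn[OF t] by simp
qed

text \<open>
  Used for the centripetal acceleration of a swirl, which is a radial field and therefore balanced by
  a pressure gradient.
\<close>

lemma radial_potential:
  obtains q where "\<And>x. x \<in> disc \<Longrightarrow> q differentiable (at x)"
    "\<And>x i. x \<in> disc \<Longrightarrow> partial i q x = apply_bcontfun (k :: profile) (norm x) * x $ i"
proof -
  define q where "q x = (norm x)\<^sup>2 * radial_average k (norm x)" for x :: "real^2"
  have d: "(q has_derivative (\<lambda>v. k (norm x) * (x \<bullet> v))) (at x)" if x: "x \<in> disc" for x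
  proof (cases "x = 0")
    case False
    have "((\<lambda>r. r\<^sup>2 * radial_average k r) has_derivative (\<lambda>h. norm x * k (norm x) * h)) (at (norm x))"
      using radial_average_moment_deriv[of "norm x" k] x False
      unfolding has_field_derivative_def by simp
    moreover have "(norm has_derivative (\<lambda>v. x \<bullet> v / norm x)) (at x)"
      using has_derivative_norm[OF False] by (simp add: sgn_div_norm inner_commute divide_inverse_commute)
    ultimately have "((\<lambda>x. (norm x)\<^sup>2 * radial_average k (norm x)) has_derivative (\<lambda>v. norm x * k (norm x) * (x \<bullet> v / norm x))) (at x)"
      by (rule has_derivative_compose[rotated])
    then show ?thesis using False by (simp add: q_def[abs_def])
  next
    case True
    show ?thesis unfolding has_derivative_at True
    proof
      show "((\<lambda>h. norm (q (0 + h) - q 0 - k (norm (0 :: real^2)) * (0 \<bullet> h)) / norm h) \<longlongrightarrow> 0) (at 0)"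
      proof (rule Lim_null_comparison)
        show "\<forall>\<^sub>F h in at 0. norm (norm (q (0 + h) - q 0 - k (norm (0 :: real^2)) * (0 \<bullet> h)) / norm h) \<le> norm h * norm k"
        proof (rule always_eventually, rule allI)
          fix h :: "real^2"
          have "\<bar>radial_average k (norm h)\<bar> \<le> norm k"
            using profile_abs_le[of "radial_average k" "norm h"] norm_radial_average_le[of k] norm_ge_zero[of k] by linarith
          then have "norm h * \<bar>radial_average k (norm h)\<bar> \<le> norm h * norm k" by (intro mult_left_mono) auto
          then show "norm (norm (q (0 + h) - q 0 - k (norm (0 :: real^2)) * (0 \<bullet> h)) / norm h) \<le> norm h * norm k"
            by (simp add: q_def abs_mult power2_eq_square)
        qed
        show "((\<lambda>h :: real^2. norm h * norm k) \<longlongrightarrow> 0) (at 0)" by (intro tendsto_eq_intros) auto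
      qed
    qed (simp add: bounded_linear_zero)
  qed
  show ?thesis
  proof (rule that[of q])
    show "q differentiable (at x)" if "x \<in> disc" for x using d[OF that] by (auto simp: differentiable_def)
    show "partial i q x = k (norm x) * x $ i" if "x \<in> disc" for x i
      using partial_eqI[OF d[OF that]] by (simp add: inner_axis)
  qed
qed

lemma steady_swirl_acceleration:
  "(\<Sum>i\<in>UNIV. swirl f x $ i * swirl_jac f j i x) = - (radial_average f (norm x))\<^sup>2 * x $ j"
proof -
  define c where "c = (f (norm x) - 2 * radial_average f (norm x)) / (norm x)\<^sup>2"
  have "swirl_jac f j i x = radial_average f (norm x) * perp (axis i 1) $ j + c * (perp x $ j * x $ i)" for i
    by (simp add: swirl_jac_def c_def mult.commute)
  then show ?thesis
    using exhaust_2[of j]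
    by (auto simp: swirl_def sum_2 axis_def power2_eq_square algebra_simps)
qed

lemma quadratic_form_bound:
  fixes a :: "real^2"
  assumes "\<And>i j. \<bar>m j i\<bar> \<le> M"
  shows "\<bar>\<Sum>j\<in>UNIV. \<Sum>i\<in>UNIV. a $ j * a $ i * m j i\<bar> \<le> 2 * M * (\<Sum>j\<in>UNIV. (a $ j)\<^sup>2)"
proof -
  have M: "M \<ge> 0" using assms[of 1 1] by linarith
  have "\<bar>\<Sum>j\<in>UNIV. \<Sum>i\<in>UNIV. a $ j * a $ i * m j i\<bar> \<le> (\<Sum>j\<in>UNIV. \<Sum>i\<in>UNIV. \<bar>a $ j\<bar> * \<bar>a $ i\<bar> * M)"
    using assms by (intro order_trans[OF sum_abs] sum_mono) (auto simp: abs_mult intro!: mult_left_mono)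
  also have "\<dots> = M * (\<bar>a $ 1\<bar> + \<bar>a $ 2\<bar>)\<^sup>2"
    by (simp add: sum_2 power2_eq_square algebra_simps)
  also have "\<dots> \<le> M * (2 * ((a $ 1)\<^sup>2 + (a $ 2)\<^sup>2))"
  proof (rule mult_left_mono[OF _ M])
    have "0 \<le> (\<bar>a $ 1\<bar> - \<bar>a $ 2\<bar>)\<^sup>2" by simp
    then show "(\<bar>a $ 1\<bar> + \<bar>a $ 2\<bar>)\<^sup>2 \<le> 2 * ((a $ 1)\<^sup>2 + (a $ 2)\<^sup>2)"
      by (simp add: power2_diff power2_sum)
  qed
  finally show ?thesis by (simp add: sum_2 algebra_simps)
qed

lemma differentiable_component:
  assumes "v differentiable_on disc" "x \<in> disc"
  shows "(\<lambda>y. v y $ j) differentiable (at x)"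
proof -
  have "v differentiable (at x)"
    using assms by (auto simp: differentiable_on_def at_within_open[OF _ open_ball])
  then obtain D where "(v has_derivative D) (at x)" by (auto simp: differentiable_def)
  then have "((\<lambda>y. v y $ j) has_derivative (\<lambda>h. D h $ j)) (at x)"
    by (rule bounded_linear.has_derivative[OF bounded_linear_vec_nth])
  then show ?thesis by (auto simp: differentiable_def)
qed

lemma partial_diff:
  assumes "f differentiable (at x)" "g differentiable (at x)"
  shows "partial i (\<lambda>x. f x - g x) x = partial i f x - partial i g x"
proof -
  from assms obtain f' g' where d: "(f has_derivative f') (at x)" "(g has_derivative g') (at x)"
    by (auto simp: differentiable_def)
  show ?thesis by (simp add: partial_eqI[OF d(1)] partial_eqI[OF d(2)] partial_eqI[OF has_derivative_diff[OF d]])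
qed

text \<open>
  Write \<open>d = u - w\<close> for the difference from the swirl \<open>w\<close>.  Since \<open>(w \<cdot> \<nabla>) w\<close> is a gradient,
  \<open>\<partial>\<^sub>t d + (u \<cdot> \<nabla>) d + (d \<cdot> \<nabla>) w + \<nabla>p = 0\<close> for some \<open>p\<close>.  Paired with \<open>d\<close>, the second and the fourth
  term integrate to zero because \<open>u\<close> and \<open>d\<close> are tangential and divergence free, and the third is
  bounded by the energy because \<open>\<nabla>w\<close> is bounded.
\<close>

lemma euler_solution_unique:
  assumes e: "euler_solution u0 u" and u0: "\<And>x. x \<in> disc \<Longrightarrow> u0 x = swirl f x"
    and t: "t \<ge> 0" and x: "x \<in> disc"
  shows "u t x = swirl f x"
proof -
  from e have C1: "C1_velocity u" and init: "\<And>x. x \<in> disc \<Longrightarrow> u 0 x = u0 x"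
    and divu: "\<And>t x. t \<ge> 0 \<Longrightarrow> x \<in> disc \<Longrightarrow> div2 (u t) x = 0"
    and tang: "\<And>t x. t \<ge> 0 \<Longrightarrow> x \<in> sphere 0 1 \<Longrightarrow> u t x \<bullet> x = 0"
    unfolding euler_solution_def by blast+
  from e obtain ut P where cut: "continuous_on ({0..} \<times> cball 0 1) (\<lambda>(t, x). ut t x)"
    and P: "\<And>t. t \<ge> 0 \<Longrightarrow> P t differentiable_on disc"
    and dut: "\<And>t x. t \<ge> 0 \<Longrightarrow> x \<in> disc \<Longrightarrow> ((\<lambda>s. u s x) has_vector_derivative ut t x) (at t within {0..})"
    and eq: "\<And>t x j. t \<ge> 0 \<Longrightarrow> x \<in> disc \<Longrightarrow>
      ut t x $ j + (\<Sum>i\<in>UNIV. u t x $ i * jac (u t) j i x) + partial j (P t) x = 0"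
    unfolding euler_solution_def by blast
  from C1 have cu: "continuous_on ({0..} \<times> cball 0 1) (\<lambda>(t, x). u t x)"
    and du: "\<And>t. t \<ge> 0 \<Longrightarrow> u t differentiable_on disc"
    and "\<forall>i j. \<exists>g. continuous_on ({0..} \<times> cball 0 1) g \<and> (\<forall>t\<ge>0. \<forall>x\<in>disc. g (t, x) = jac (u t) j i x)"
    unfolding C1_velocity_def by blast+
  then obtain G where G: "\<And>i j. continuous_on ({0..} \<times> cball 0 1) (G i j)"
    "\<And>i j t x. t \<ge> 0 \<Longrightarrow> x \<in> disc \<Longrightarrow> G i j (t, x) = jac (u t) j i x"
    by metis
  have slice: "continuous_on (cball 0 1) (\<lambda>x. g (s, x))" if "continuous_on ({0..} \<times> cball 0 1) g" "s \<ge> 0"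
    for g :: "real \<times> (real^2) \<Rightarrow> 'b :: topological_space" and s
    by (rule continuous_on_compose2[OF that(1)]) (use that(2) in \<open>auto intro!: continuous_intros\<close>)
  have cus: "continuous_on (cball 0 1) (u s)" "continuous_on (cball 0 1) (ut s)" "continuous_on (cball 0 1) (\<lambda>x. G i j (s, x))"
    if "s \<ge> 0" for s i j
    using slice[OF cu that] slice[OF cut that] slice[OF G(1) that] by simp_all
  define d where "d s x = u s x - swirl f x" for s x
  define h where "h s x = (\<Sum>j\<in>UNIV. (d s x $ j)\<^sup>2)" for s x
  define h' where "h' s x = (\<Sum>j\<in>UNIV. 2 * d s x $ j * ut s x $ j)" for s x
  define E where "E s = (LINT x:disc|lborel. h s x)" for s
  define E' where "E' s = (LINT x:disc|lborel. h' s x)" for s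
  have cd: "continuous_on (cball 0 1) (d s)" if "s \<ge> 0" for s
    unfolding d_def by (intro continuous_intros cus that continuous_on_swirl_x)
  have ch: "continuous_on (cball 0 1) (h s)" if "s \<ge> 0" for s
    unfolding h_def by (intro continuous_intros cd that)
  have sub: "continuous_on disc g" if "continuous_on (cball 0 1) g" for g :: "real^2 \<Rightarrow> 'b :: topological_space"
    by (rule continuous_on_subset[OF that]) auto
  have bd: "bounded_on disc g" if "continuous_on (cball 0 1) g" for g :: "real^2 \<Rightarrow> real"
    by (rule bounded_on_compact[OF compact_cball that]) auto
  have dE: "(E has_real_derivative E' s) (at s within {0..})" if s: "s \<ge> 0" for s
  proof -
    have "bounded_on ({0..s + 1} \<times> disc) (\<lambda>z. h' (fst z) (snd z))"
    proof (rule bounded_on_compact[of "{0..s + 1} \<times> cball 0 1"])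
      have "continuous_on ({0..s + 1} \<times> cball 0 1) (\<lambda>z. u (fst z) (snd z))"
        "continuous_on ({0..s + 1} \<times> cball 0 1) (\<lambda>z. ut (fst z) (snd z))"
        using continuous_on_subset[OF cu, of "{0..s + 1} \<times> cball 0 1"]
          continuous_on_subset[OF cut, of "{0..s + 1} \<times> cball 0 1"]
        by (simp_all add: case_prod_beta' Sigma_mono)
      then show "continuous_on ({0..s + 1} \<times> cball 0 1) (\<lambda>z. h' (fst z) (snd z))"
        unfolding h'_def d_def by (intro continuous_intros continuous_on_swirl) auto
    qed (auto intro!: compact_Times)
    then obtain C where C: "\<And>r x. 0 \<le> r \<Longrightarrow> r \<le> s + 1 \<Longrightarrow> x \<in> disc \<Longrightarrow> \<bar>h' r x\<bar> \<le> C"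
      unfolding bounded_on_def by fastforce
    show ?thesis unfolding E_def E'_def
    proof (rule has_derivative_disc_integral[OF _ _ _ C s])
      fix r :: real and x :: "real^2" assume r: "r \<ge> 0" and x: "x \<in> disc"
      have "((\<lambda>r. u r x $ j) has_real_derivative ut r x $ j) (at r within {0..})" for j
        unfolding has_real_derivative_iff_has_vector_derivative
        by (rule bounded_linear.has_vector_derivative[OF bounded_linear_vec_nth dut[OF r x]])
      then show "((\<lambda>r. h r x) has_real_derivative h' r x) (at r within {0..})"
        unfolding h_def h'_def d_def by (auto intro!: derivative_eq_intros simp: algebra_simps)
    qed (auto intro: sub bd ch)
  qed
  have E'le: "E' s \<le> 12 * norm f * E s" if s: "s \<ge> 0" for s
  proof -
    let ?H = "radial_average f"
    define k where "k = profile_of (\<lambda>r. (?H r)\<^sup>2)"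
    have k: "k r = (?H r)\<^sup>2" if "0 \<le> r" "r \<le> 1" for r
      unfolding k_def using that by (subst apply_profile_of) (auto intro!: continuous_intros)
    \<comment> \<open>The pressure of the stationary swirl: its acceleration is \<open>- k(|x|) x\<close>.\<close>
    obtain q where q: "\<And>x. x \<in> disc \<Longrightarrow> q differentiable (at x)"
      "\<And>x i. x \<in> disc \<Longrightarrow> partial i q x = k (norm x) * x $ i"
      using radial_potential[of k] by blast
    define p where "p x = P s x - q x" for x
    define f1 where "f1 x = (\<Sum>j\<in>UNIV. d s x $ j * d s x $ j)" for x
    have ud: "(\<lambda>y. u s y $ j) differentiable (at x)" if "x \<in> disc" for j x
      by (rule differentiable_component[OF du[OF s] that])
    have sd: "(\<lambda>y. swirl f y $ j) differentiable (at x)" if "x \<in> disc" for j x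
      using swirl_has_derivative[OF that] by (auto simp: differentiable_def)
    have dd: "(\<lambda>y. d s y $ j) differentiable (at x)" if "x \<in> disc" for j x
      unfolding d_def vector_minus_component by (intro differentiable_diff ud sd that)
    have jd: "jac (d s) j i x = jac (u s) j i x - swirl_jac f j i x" if "x \<in> disc" for i j x
      using partial_diff[OF ud[OF that, of j] sd[OF that, of j]] jac_swirl[OF that, of f j i]
      by (simp add: jac_def d_def)
    have cG: "continuous_on disc g \<and> bounded_on disc g"
      if "\<And>x. x \<in> disc \<Longrightarrow> g x = e x" "continuous_on (cball 0 1) e" for g e :: "real^2 \<Rightarrow> real"
    proof
      show "continuous_on disc g" by (rule continuous_on_eq[OF sub[OF that(2)]]) (simp add: that(1))
      show "bounded_on disc g" using bd[OF that(2)] that(1) by (auto simp: bounded_on_def)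
    qed
    have jdG: "jac (d s) j i x = G i j (s, x) - swirl_jac f j i x" if "x \<in> disc" for i j x
      using jd[OF that] G(2)[OF s that] by simp
    have cjd: "continuous_on disc (jac (d s) j i) \<and> bounded_on disc (jac (d s) j i)" for i j
      by (rule cG[of "jac (d s) j i" "\<lambda>x. G i j (s, x) - swirl_jac f j i x"])
        (simp add: jdG, intro continuous_intros cus s continuous_on_swirl_jac_x)
    have pf1: "partial i f1 x = (\<Sum>j\<in>UNIV. 2 * d s x $ j * jac (d s) j i x)" if "x \<in> disc" for i x
      unfolding f1_def sum_2 jac_def
      using dd[OF that] by (subst partial_add) (auto intro!: differentiable_mult simp: partial_mult)
    have f1d: "f1 differentiable (at x)" if "x \<in> disc" for x
      unfolding f1_def sum_2 using dd[OF that] by (intro differentiable_add differentiable_mult) auto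
    have Pd: "P s differentiable (at x)" if "x \<in> disc" for x
      using P[OF s] that by (auto simp: differentiable_on_def at_within_open[OF _ open_ball])
    have pp: "partial i p x = partial i (P s) x - k (norm x) * x $ i" if "x \<in> disc" for i x
      unfolding p_def using partial_diff[OF Pd q(1)] q(2) that by simp
    have ppG: "partial i p x = - ut s x $ i - (\<Sum>l\<in>UNIV. u s x $ l * G l i (s, x)) - k (norm x) * x $ i"
      if "x \<in> disc" for i x
      using pp[OF that] eq[OF s that, of i] G(2)[OF s that] by simp
    have cp: "continuous_on disc (partial i p) \<and> bounded_on disc (partial i p)" for i
      by (rule cG[of "partial i p" "\<lambda>x. - ut s x $ i - (\<Sum>l\<in>UNIV. u s x $ l * G l i (s, x)) - k (norm x) * x $ i"])
        (simp add: ppG, intro continuous_intros cus s)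
    have cf1: "continuous_on disc (partial i f1) \<and> bounded_on disc (partial i f1)" for i
      by (rule cG[of "partial i f1" "\<lambda>x. \<Sum>j\<in>UNIV. 2 * d s x $ j * (G i j (s, x) - swirl_jac f j i x)"])
        (simp add: pf1 jdG, intro continuous_intros cus cd s continuous_on_swirl_jac_x)
    note cjd = cjd[THEN conjunct1] cjd[THEN conjunct2]
      and cp = cp[THEN conjunct1] cp[THEN conjunct2] and cf1 = cf1[THEN conjunct1] cf1[THEN conjunct2]
    \<comment> \<open>The three contributions to the energy: transport of \<open>|d|\<^sup>2\<close> by \<open>u\<close>, pressure, and stretching by the gradient of the swirl.\<close>
    define A where "A x = (\<Sum>i\<in>UNIV. u s x $ i * partial i f1 x)" for x
    define B where "B x = (\<Sum>i\<in>UNIV. d s x $ i * partial i p x)" for x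
    define Q where "Q x = (\<Sum>j\<in>UNIV. \<Sum>i\<in>UNIV. d s x $ j * d s x $ i * swirl_jac f j i x)" for x
    have A0: "(LINT x:disc|lborel. A x) = 0"
      unfolding A_def
    proof (rule tangential_flux_zero[OF ud cus(1)[OF s] _ _ divu[OF s] f1d cf1])
      show "continuous_on disc (jac (u s) i i)" for i
        by (rule cG[THEN conjunct1, of _ "\<lambda>x. G i i (s, x)"]) (use G(2)[OF s] cus s in auto)
    qed (use tang[OF s] in auto)
    have B0: "(LINT x:disc|lborel. B x) = 0"
      unfolding B_def
    proof (rule tangential_flux_zero[OF dd cd[OF s] cjd(1) _ _ _ cp])
      show "d s x \<bullet> x = 0" if "norm x = 1" for x
        using tang[OF s, of x] that
        by (simp add: d_def inner_diff_left swirl_def) (simp add: inner_vec_def sum_2)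
      show "div2 (d s) x = 0" if "x \<in> disc" for x
        using divu[OF s that] div2_swirl[OF that, of f] jd[OF that] jac_swirl[OF that]
        by (simp add: div2_def sum_subtractf)
      show "p differentiable (at x)" if "x \<in> disc" for x
        unfolding p_def by (intro differentiable_diff Pd q that)
    qed
    have "h' s x = - (A x + 2 * B x + 2 * Q x)" if x: "x \<in> disc" for x
    proof -
      have kx: "k (norm x) = (?H (norm x))\<^sup>2" using x by (intro k) auto
      have ut: "ut s x $ j = - (\<Sum>i\<in>UNIV. u s x $ i * jac (d s) j i x) - (\<Sum>i\<in>UNIV. d s x $ i * swirl_jac f j i x)
          - partial j p x" for j
      proof -
        have "(\<Sum>i\<in>UNIV. u s x $ i * jac (u s) j i x) = (\<Sum>i\<in>UNIV. u s x $ i * jac (d s) j i x) +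
           (\<Sum>i\<in>UNIV. d s x $ i * swirl_jac f j i x) + (\<Sum>i\<in>UNIV. swirl f x $ i * swirl_jac f j i x)"
          unfolding jd[OF x] by (simp add: sum_2 d_def algebra_simps)
        then show ?thesis
          using eq[OF s x, of j] pp[OF x, of j] by (simp add: steady_swirl_acceleration kx)
      qed
      show ?thesis
        unfolding h'_def A_def B_def Q_def pf1[OF x] ut sum_2 by (simp add: algebra_simps)
    qed
    then have Es: "E' s = (LINT x:disc|lborel. - (A x + 2 * B x + 2 * Q x))"
      unfolding E'_def by (intro set_lebesgue_integral_cong) auto
    have iA: "set_integrable lborel disc A" and iB: "set_integrable lborel disc B"
      unfolding A_def B_def
      by (intro set_integrable_disc continuous_intros bounded_on_intros cf1 cp sub cus cd s
           bd[OF continuous_on_component])+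
    have iQ: "set_integrable lborel disc Q"
      unfolding Q_def
      by (intro set_integrable_disc sub bd continuous_intros continuous_on_swirl_jac_x cd s)
    have "E' s = - 2 * (LINT x:disc|lborel. Q x)"
    proof -
      have "(LINT x:disc|lborel. A x + 2 * B x + 2 * Q x) = (LINT x:disc|lborel. A x) + 2 * (LINT x:disc|lborel. B x) + 2 * (LINT x:disc|lborel. Q x)"
        using iA iB iQ by (subst set_integral_add(2) | simp)+
      then show ?thesis
        using set_integral_mult_right[of lborel disc "- 1" "\<lambda>x. A x + 2 * B x + 2 * Q x"]
        unfolding Es A0 B0 mult_minus1 by simp
    qed
    also have "\<dots> = (LINT x:disc|lborel. - 2 * Q x)"
      by (rule set_integral_mult_right[symmetric])
    also have "\<dots> \<le> (LINT x:disc|lborel. 12 * norm f * h s x)"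
    proof (rule set_integral_mono)
      show "set_integrable lborel disc (\<lambda>x. - 2 * Q x)"
        by (rule set_integrable_mult_right) (rule iQ)
      show "set_integrable lborel disc (\<lambda>x. 12 * norm f * h s x)"
        by (intro set_integrable_disc sub bd continuous_intros ch s)
      show "- 2 * Q x \<le> 12 * norm f * h s x" for x
        using quadratic_form_bound[of "\<lambda>j i. swirl_jac f j i x" "3 * norm f" "d s x"] swirl_jac_le[of f _ _ x]
        unfolding Q_def h_def by (simp add: abs_le_iff)
    qed
    also have "\<dots> = 12 * norm f * E s" by (simp add: E_def)
    finally show ?thesis .
  qed
  have E0: "E 0 = 0"
  proof -
    have "E 0 = (LINT x:disc|lborel. (0::real))"
      unfolding E_def by (rule set_lebesgue_integral_cong) (auto simp: h_def d_def init u0)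
    then show ?thesis by simp
  qed
  have Enn: "E s \<ge> 0" for s
    unfolding E_def set_lebesgue_integral_def
    by (rule Bochner_Integration.integral_nonneg) (auto simp: h_def sum_nonneg)
  have "E t = 0" by (rule gronwall_zero[OF dE E'le E0 Enn t])
  then have "h t x = 0"
    using nonneg_disc_integral_zero[OF sub[OF ch[OF t]] bd[OF ch[OF t]] _ _ x]
    by (auto simp: E_def h_def sum_nonneg)
  then show ?thesis by (simp add: h_def d_def sum_2 vec_eq_iff forall_2 sum_power2_eq_zero_iff)
qed

section \<open>The limit of vanishing viscosity and elasticity\<close>

text \<open>
  Even polynomials are dense, but their slope at \<open>1\<close> need not vanish.  The slope is removed by
  subtracting a multiple of \<open>r\<^bsup>2 m + 2\<^esup>\<close>: a function \<open>s r\<^bsup>2 m + 2\<^esup> / (2 m + 2)\<close> has slope \<open>s\<close> at \<open>1\<close>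
  and is uniformly small for large \<open>m\<close>.
\<close>

lemma neumann_smooth_dense:
  assumes f: "clamped f" and \<epsilon>: "\<epsilon> > 0"
  obtains g c k where "g = const_profile c + radial_inverse_laplacian k" "radial_average k 1 = 0" "norm (f - g) < \<epsilon>"
proof -
  interpret S: bounded_linear radial_inverse_laplacian by (rule bounded_linear_radial_inverse_laplacian)
  interpret A: bounded_linear radial_average by (rule bounded_linear_radial_average)
  define good where "good g \<longleftrightarrow> (\<exists>c k. g = const_profile c + radial_inverse_laplacian k)" for g
  have good_mono: "good (even_monomial i)" for i
  proof (cases i)
    case 0
    have "even_monomial 0 = const_profile 1 + radial_inverse_laplacian 0"
      by (rule bcontfun_eqI) (simp add: even_monomial_apply S.zero const_bcontfun.rep_eq)
    then show ?thesis unfolding good_def 0 by blast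
  next
    case (Suc j)
    have "even_monomial (Suc j) = const_profile 0 + radial_inverse_laplacian ((2 * real j + 2)\<^sup>2 *\<^sub>R even_monomial j)"
      by (simp add: S.scaleR radial_inverse_laplacian_even_monomial)
    then show ?thesis unfolding good_def Suc by blast
  qed
  have good_lin: "good (a *\<^sub>R g + h)" if gh: "good g" "good h" for a g h
  proof -
    from gh obtain c k d l where "g = const_profile c + radial_inverse_laplacian k"
      "h = const_profile d + radial_inverse_laplacian l" unfolding good_def by blast
    then have "a *\<^sub>R g + h = const_profile (a * c + d) + radial_inverse_laplacian (a *\<^sub>R k + l)"
      by (intro bcontfun_eqI) (simp add: S.add S.scaleR const_bcontfun.rep_eq algebra_simps)
    then show ?thesis unfolding good_def by blast
  qed
  have good0: "good 0"
    unfolding good_def by (intro exI[of _ 0]) (simp add: S.zero)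
  have good_poly: "good (\<Sum>i\<le>n. a i *\<^sub>R even_monomial i)" for a and n :: nat
  proof (induction n)
    case 0
    show ?case using good_lin[OF good_mono good0, of "a 0" 0] by simp
  next
    case (Suc n)
    show ?case using good_lin[OF good_mono Suc, of "a (Suc n)" "Suc n"] by (simp add: add.commute)
  qed
  obtain a N where aN: "(\<lambda>n. \<Sum>i\<le>N n. a n i *\<^sub>R even_monomial i) \<longlonglongrightarrow> profile_of (apply_bcontfun f)"
    using even_polynomials_converge .
  have ff: "profile_of (apply_bcontfun f) = f"
    using f by (intro bcontfun_eqI) (simp add: profile_of_clamp clamped_def)
  obtain n where n: "dist (\<Sum>i\<le>N n. a n i *\<^sub>R even_monomial i) f < \<epsilon> / 2"
    using tendstoD[OF aN[unfolded ff], of "\<epsilon> / 2"] \<epsilon> by (auto simp: eventually_sequentially)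
  define p where "p = (\<Sum>i\<le>N n. a n i *\<^sub>R even_monomial i)"
  obtain c k where p: "p = const_profile c + radial_inverse_laplacian k"
    using good_poly[of "a n" "N n"] unfolding p_def good_def by blast
  define s where "s = radial_average k 1"
  obtain m :: nat where m: "\<bar>s\<bar> / real (Suc m) < \<epsilon> / 2"
  proof -
    have "(\<lambda>m. \<bar>s\<bar> * (1 / real (Suc m))) \<longlonglongrightarrow> \<bar>s\<bar> * 0"
      by (intro tendsto_intros LIMSEQ_Suc[OF lim_1_over_n])
    from order_tendstoD(2)[OF this, of "\<epsilon> / 2"] \<epsilon> show ?thesis
      using that by (auto simp: eventually_sequentially)
  qed
  define b where "b = s * (2 * real m + 2)"
  define g where "g = p - radial_inverse_laplacian (b *\<^sub>R even_monomial m)"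
  show ?thesis
  proof (rule that[of g c "k - b *\<^sub>R even_monomial m"])
    show "g = const_profile c + radial_inverse_laplacian (k - b *\<^sub>R even_monomial m)"
      by (simp add: g_def p S.diff)
    show "radial_average (k - b *\<^sub>R even_monomial m) 1 = 0"
      by (simp add: A.diff A.scaleR radial_average_even_monomial even_monomial_apply b_def s_def)
    have "norm (radial_inverse_laplacian (b *\<^sub>R even_monomial m)) \<le> \<bar>s\<bar> / real (Suc m)"
    proof (rule norm_bound)
      fix r
      have e: "radial_inverse_laplacian (b *\<^sub>R even_monomial m) r = s / (2 * real m + 2) * unit_clamp r ^ (2 * Suc m)"
        by (simp add: S.scaleR radial_inverse_laplacian_even_monomial even_monomial_apply b_def power2_eq_square)
      have "\<bar>s / (2 * real m + 2)\<bar> * unit_clamp r ^ (2 * Suc m) \<le> \<bar>s\<bar> / real (Suc m) * 1"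
        by (intro mult_mono power_le_one) (auto simp: abs_divide intro!: divide_left_mono)
      then show "norm (radial_inverse_laplacian (b *\<^sub>R even_monomial m) r) \<le> \<bar>s\<bar> / real (Suc m)"
        unfolding e by (simp add: abs_mult)
    qed
    moreover have "norm (f - g) \<le> norm (p - f) + norm (radial_inverse_laplacian (b *\<^sub>R even_monomial m))"
      using norm_triangle_ineq[of "f - p" "radial_inverse_laplacian (b *\<^sub>R even_monomial m)"]
      by (simp add: g_def norm_minus_commute algebra_simps)
    moreover have "norm (p - f) < \<epsilon> / 2" using n by (simp only: p_def dist_norm)
    ultimately show "norm (f - g) < \<epsilon>" using m by linarith
  qed
qed

lemma vanishing_regime_small:
  assumes "\<delta> > 0"
  shows "eventually (\<lambda>(\<nu>, \<alpha>). 0 < \<nu> \<and> \<nu> < \<delta> \<and> 0 < \<alpha>) vanishing_regime"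
proof -
  have a: "eventually (\<lambda>\<nu>::real. 0 < \<nu> \<and> \<nu> < \<delta>) (at_right 0)"
    unfolding eventually_at_right_field using assms by auto
  have b: "eventually (\<lambda>\<alpha>::real. 0 < \<alpha>) (at_right 0)"
    unfolding eventually_at_right_field using zero_less_one by blast
  have "eventually (\<lambda>z. (0 < fst z \<and> fst z < \<delta>) \<and> 0 < snd z) (at_right (0::real) \<times>\<^sub>F at_right (0::real))"
    by (rule eventually_conj[OF eventually_compose_filterlim[OF a filterlim_fst] eventually_compose_filterlim[OF b filterlim_snd]])
  then show ?thesis
    unfolding vanishing_regime_def
    by (intro filter_leD[OF inf_le1]) (auto simp: case_prod_beta elim: eventually_mono)
qed

lemma vorticity_evolution_converges:
  assumes f: "clamped f" and t: "t \<ge> 0"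
  shows "((\<lambda>(\<nu>, \<alpha>). norm (vorticity_evolution \<nu> \<alpha> f t - f)) \<longlongrightarrow> 0) vanishing_regime"
proof (rule tendstoI)
  fix \<epsilon> :: real assume \<epsilon>: "\<epsilon> > 0"
  obtain g c k where g: "g = const_profile c + radial_inverse_laplacian k" and k: "radial_average k 1 = 0"
    and fg: "norm (f - g) < \<epsilon> / 4"
    using neumann_smooth_dense[OF f, of "\<epsilon> / 4"] \<epsilon> by auto
  define \<delta> where "\<delta> = \<epsilon> / (2 * (t * norm k + 1))"
  have tk: "t * norm k \<ge> 0" using t by simp
  have \<delta>: "\<delta> > 0" using \<epsilon> tk by (simp add: \<delta>_def add_nonneg_pos)
  from vanishing_regime_small[OF \<delta>]
  show "\<forall>\<^sub>F z in vanishing_regime. dist (case z of (\<nu>, \<alpha>) \<Rightarrow> norm (vorticity_evolution \<nu> \<alpha> f t - f)) 0 < \<epsilon>"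
  proof (rule eventually_mono)
    fix z :: "real \<times> real" assume z: "case z of (\<nu>, \<alpha>) \<Rightarrow> 0 < \<nu> \<and> \<nu> < \<delta> \<and> 0 < \<alpha>"
    obtain \<nu> \<alpha> where z': "z = (\<nu>, \<alpha>)" by (cases z)
    with z have \<nu>: "0 < \<nu>" "\<nu> < \<delta>" and \<alpha>: "0 < \<alpha>" by auto
    have "norm (vorticity_evolution \<nu> \<alpha> f t - f) \<le> 2 * norm (f - g) + \<nu> * t * norm k"
      by (rule evolution_close[OF \<alpha> f \<nu>(1) t g k])
    also have "\<nu> * t * norm k \<le> \<delta> * (t * norm k + 1)"
      using \<nu> tk by (simp add: mult.assoc) (intro mult_mono, auto)
    also have "\<delta> * (t * norm k + 1) = \<epsilon> / 2"
      using tk by (simp add: \<delta>_def field_simps)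
    finally show "dist (case z of (\<nu>, \<alpha>) \<Rightarrow> norm (vorticity_evolution \<nu> \<alpha> f t - f)) 0 < \<epsilon>"
      using fg by (simp add: z')
  qed
qed

lemma L2_norm_disc_le:
  assumes "\<And>x. x \<in> disc \<Longrightarrow> norm (g x) \<le> M" "M \<ge> 0"
  shows "0 \<le> L2_norm_disc g" "L2_norm_disc g \<le> M * sqrt (measure lborel (disc))"
proof -
  have nn: "0 \<le> (LINT x:disc|lborel. (norm (g x))\<^sup>2)"
    unfolding set_lebesgue_integral_def by (rule Bochner_Integration.integral_nonneg) auto
  then show "0 \<le> L2_norm_disc g" by (simp add: L2_norm_disc_def)
  have i: "set_integrable lborel disc (\<lambda>x :: real^2. M\<^sup>2)"
    by (intro set_integrable_disc bounded_on_const continuous_intros)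
  have "(LINT x:disc|lborel. (norm (g x))\<^sup>2) \<le> (LINT x:disc|lborel. M\<^sup>2)"
  \<comment> \<open>If the square is not integrable, its integral has the default value \<open>0\<close>.\<close>
  proof (cases "set_integrable lborel disc (\<lambda>x. (norm (g x))\<^sup>2)")
    case True
    then show ?thesis by (rule set_integral_mono[OF _ i]) (use assms in \<open>auto intro: power_mono\<close>)
  next
    case False
    then have "(LINT x:disc|lborel. (norm (g x))\<^sup>2) = 0"
      by (simp add: set_integrable_def set_lebesgue_integral_def not_integrable_integral_eq)
    then show ?thesis by (simp add: set_lebesgue_integral_def)
  qed
  also have "\<dots> = M\<^sup>2 * measure lborel (disc)" by (simp add: set_lebesgue_integral_def)
  finally have "L2_norm_disc g \<le> sqrt (M\<^sup>2 * measure lborel (disc))"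
    unfolding L2_norm_disc_def by (rule real_sqrt_le_mono)
  then show "L2_norm_disc g \<le> M * sqrt (measure lborel (disc))"
    using assms(2) by (simp add: real_sqrt_mult)
qed

lemma L2_and_uniform_limit_of_sup_bound:
  fixes g :: "'i \<Rightarrow> real^2 \<Rightarrow> 'b :: real_normed_vector"
  assumes "eventually (\<lambda>z. \<forall>x\<in>disc. norm (g z x) \<le> M z) F" and M: "(M \<longlongrightarrow> 0) F"
    and M0: "\<And>z. M z \<ge> 0"
  shows "((\<lambda>z. L2_norm_disc (g z)) \<longlongrightarrow> 0) F" "K \<subseteq> disc \<Longrightarrow> uniform_limit K g (\<lambda>_. 0) F"
proof -
  show "((\<lambda>z. L2_norm_disc (g z)) \<longlongrightarrow> 0) F"
  proof (rule Lim_null_comparison)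
    show "\<forall>\<^sub>F z in F. norm (L2_norm_disc (g z)) \<le> M z * sqrt (measure lborel (disc))"
      using assms(1)
    proof (rule eventually_mono)
      fix z assume "\<forall>x\<in>disc. norm (g z x) \<le> M z"
      then show "norm (L2_norm_disc (g z)) \<le> M z * sqrt (measure lborel (disc))"
        using L2_norm_disc_le[of "g z" "M z"] M0 by simp
    qed
    show "((\<lambda>z. M z * sqrt (measure lborel (disc))) \<longlongrightarrow> 0) F"
      using tendsto_mult[OF M tendsto_const[of "sqrt (measure lborel (disc))"]] by simp
  qed
  show "uniform_limit K g (\<lambda>_. 0) F" if "K \<subseteq> disc"
  proof (rule uniform_limitI)
    fix \<epsilon> :: real assume "\<epsilon> > 0"
    from eventually_conj[OF assms(1) order_tendstoD(2)[OF M this]]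
    show "\<forall>\<^sub>F z in F. \<forall>x\<in>K. dist (g z x) 0 < \<epsilon>"
      by (rule eventually_mono) (use that in \<open>auto intro: le_less_trans\<close>)
  qed
qed

theorem theorem1p1:
  fixes \<omega>0 :: "real \<Rightarrow> real"
    and u :: "real \<Rightarrow> real \<Rightarrow> real \<Rightarrow> real^2 \<Rightarrow> real^2"
    and uE :: "real \<Rightarrow> real^2 \<Rightarrow> real^2"
    and T t :: real
  assumes "continuous_on {0..1} \<omega>0"
    and "integral {0..1} (\<lambda>r. r * \<omega>0 r) = 0"
    and sg_solution: "\<And>\<nu> \<alpha>. 0 < \<nu> \<Longrightarrow> 0 < \<alpha> \<Longrightarrow>
          second_grade_solution \<nu> \<alpha> (swirl_velocity \<omega>0) (u \<nu> \<alpha>)"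
    and sg_unique: "\<And>\<nu> \<alpha> w s x. 0 < \<nu> \<Longrightarrow> 0 < \<alpha> \<Longrightarrow>
          second_grade_solution \<nu> \<alpha> (swirl_velocity \<omega>0) w \<Longrightarrow> 0 \<le> s \<Longrightarrow> x \<in> disc \<Longrightarrow>
          w s x = u \<nu> \<alpha> s x"
    and euler: "euler_solution (swirl_velocity \<omega>0) uE"
    and "0 < T" and "t \<in> {0..T}"
  shows "((\<lambda>(\<nu>, \<alpha>). L2_norm_disc (\<lambda>x. u \<nu> \<alpha> t x - uE t x)) \<longlongrightarrow> 0) vanishing_regime \<and>
    ((\<lambda>(\<nu>, \<alpha>). L2_norm_disc (\<lambda>x. curl2 (u \<nu> \<alpha> t) x - curl2 (uE t) x)) \<longlongrightarrow> 0)
      vanishing_regime \<and>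
    (\<forall>K. compact K \<and> K \<subseteq> disc \<longrightarrow>
      uniform_limit K (\<lambda>(\<nu>, \<alpha>) x. u \<nu> \<alpha> t x - uE t x) (\<lambda>_. 0) vanishing_regime \<and>
      uniform_limit K (\<lambda>(\<nu>, \<alpha>) x. curl2 (u \<nu> \<alpha> t) x - curl2 (uE t) x) (\<lambda>_. 0)
        vanishing_regime)"
proof -
  define f where "f = profile_of \<omega>0"
  have t: "t \<ge> 0" using assms(7) by simp
  have fr: "f r = \<omega>0 (unit_clamp r)" for r
    unfolding f_def by (rule apply_profile_of[OF assms(1)])
  have f: "clamped f" by (simp add: clamped_def fr)
  have u0: "swirl_velocity \<omega>0 x = swirl f x" if "x \<in> disc" for x
    using that by (intro swirl_velocity_eq_swirl) (auto simp: fr)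
  have f1: "radial_average f 1 = 0"
  proof -
    have "integral {0..1} (\<lambda>r. r * f r) = integral {0..1} (\<lambda>r. r * \<omega>0 r)"
      by (rule Henstock_Kurzweil_Integration.integral_cong) (auto simp: fr)
    then show ?thesis
      using radial_average_integral[of 1 f] assms(2) by (simp add: integral_unique)
  qed
  have uw: "u \<nu> \<alpha> t x = swirl (vorticity_evolution \<nu> \<alpha> f t) x" if "0 < \<nu>" "0 < \<alpha>" "x \<in> disc" for \<nu> \<alpha> x
    using sg_unique[OF that(1,2) swirl_evolution_is_solution[OF that(1,2) f f1 u0] t that(3)] by simp
  have uE: "uE t x = swirl f x" if "x \<in> disc" for x
    by (rule euler_solution_unique[OF euler u0 t that])
  have curl_cong: "curl2 v x = curl2 w x" if "\<And>y. y \<in> disc \<Longrightarrow> v y = w y" "x \<in> disc" for v w x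
    unfolding curl2_def jac_def
    using that by (intro arg_cong2[where f = "(-)"] partial_cong_open[of disc]) auto
  define M where "M z = (case z of (\<nu>, \<alpha>) \<Rightarrow> norm (vorticity_evolution \<nu> \<alpha> f t - f))" for z
  have "M = (\<lambda>(\<nu>, \<alpha>). norm (vorticity_evolution \<nu> \<alpha> f t - f))"
    by (rule ext) (simp only: M_def)
  then have M: "(M \<longlongrightarrow> 0) vanishing_regime" "\<And>z. M z \<ge> 0"
    using vorticity_evolution_converges[OF f t] by (simp_all add: split_beta)
  have diff: "swirl g x - swirl f x = swirl (g - f) x" for g x
    using swirl_linear(1)[of "g - f" f x] by simp
  have vel: "eventually (\<lambda>z. \<forall>x\<in>disc. norm ((\<lambda>(\<nu>, \<alpha>) x. u \<nu> \<alpha> t x - uE t x) z x) \<le> M z) vanishing_regime"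
    using vanishing_regime_small[OF zero_less_one]
  proof (rule eventually_mono, clarify)
    fix \<nu> \<alpha> :: real and x :: "real^2" assume p: "0 < \<nu>" "0 < \<alpha>" and x: "x \<in> disc"
    have "norm (u \<nu> \<alpha> t x - uE t x) \<le> M (\<nu>, \<alpha>) / 2 * norm x"
      using norm_swirl_le[of "vorticity_evolution \<nu> \<alpha> f t - f" x] by (simp add: uw[OF p x] uE[OF x] diff M_def)
    also have "\<dots> \<le> M (\<nu>, \<alpha>) * 1" using x M(2)[of "(\<nu>, \<alpha>)"] by (intro mult_mono) auto
    finally show "norm (u \<nu> \<alpha> t x - uE t x) \<le> M (\<nu>, \<alpha>)" by simp
  qed
  have vort: "eventually (\<lambda>z. \<forall>x\<in>disc. norm ((\<lambda>(\<nu>, \<alpha>) x. curl2 (u \<nu> \<alpha> t) x - curl2 (uE t) x) z x) \<le> M z) vanishing_regime"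
    using vanishing_regime_small[OF zero_less_one]
  proof (rule eventually_mono, clarify)
    fix \<nu> \<alpha> :: real and x :: "real^2" assume p: "0 < \<nu>" "0 < \<alpha>" and x: "x \<in> disc"
    have "curl2 (u \<nu> \<alpha> t) x - curl2 (uE t) x = (vorticity_evolution \<nu> \<alpha> f t - f) (norm x)"
      using curl_cong[of "u \<nu> \<alpha> t", OF uw[OF p] x] curl_cong[OF uE x] by (simp add: curl2_swirl[OF x])
    then show "norm (curl2 (u \<nu> \<alpha> t) x - curl2 (uE t) x) \<le> M (\<nu>, \<alpha>)"
      using profile_abs_le[of "vorticity_evolution \<nu> \<alpha> f t - f" "norm x"] by (simp add: M_def)
  qed
  show ?thesis
    using L2_and_uniform_limit_of_sup_bound[OF vel M] L2_and_uniform_limit_of_sup_bound[OF vort M]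
    by (simp add: case_prod_beta')
qed

end
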